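(* Let $p$ be an odd prime, let $G=G_{\mathbf{E}}$ be a multi-EGS group acting on the $p$-adic rooted tree that is not a GGS-group, and let $r$ be the dimension of the $\mathbb{F}_p$-vector space spanned by all defining vectors of $G$. Then the finite group $G/\mathrm{St}_G(k)$ admits a ramification structure for (i) all $k\ge r+1$, if $G$ is regular branch over $G'$; (ii) all $k\ge 5$, if $G$ is periodic and not regular branch over $G'$; (iii) all $k\ge 3$, if $G$ is non-periodic and not regular branch over $G'$.
   Context: Tree notation. $p$ is an odd prime. $\mathcal{T}$ is the $p$-adic rooted tree, whose vertices are the finite words over $X=\{1,\dots,p\}$ (the root is the empty word $\varnothing$; each word $\omega$ is joined by an edge to $\omega x$, $x\in X$); the $n$th-level vertices are the words of length $n$. $\mathrm{Aut}(\mathcal{T})$ is its group of (root-preserving) automorphisms, acting on the right. For $G\le \mathrm{Aut}(\mathcal{T})$, $\mathrm{St}_G(n)$ is the normal subgroup of elements of $G$ fixing every vertex of level $n$. For a vertex $u$, the subtree $\mathcal{T}_u$ of all words with prefix $u$ is identified with $\mathcal{T}$ by deleting the prefix $u$. The map $\psi:\mathrm{St}_{\mathrm{Aut}(\mathcal{T})}(1)\to \mathrm{Aut}(\mathcal{T})\times\overset{p}{\cdots}\times\mathrm{Aut}(\mathcal{T})$ is the isomorphism sending $g$ to its restrictions $(g_1,\dots,g_p)$ to the subtrees rooted at the first-level vertices $1,\dots,p$. $G'$ denotes the derived subgroup. Let $a\in\mathrm{Aut}(\mathcal{T})$ be the rooted automorphism corresponding to the $p$-cycle $(1\,2\,\cdots\,p)$,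 i.e. it permutes the first letter of every non-empty word by this cycle and leaves the other letters unchanged. GGS-group: a group $\langle a,b\rangle$, where for some nonzero vector $(e_1,\dots,e_{p-1})\in(\mathbb{F}_p)^{p-1}$, $b\in \mathrm{St}_{\mathrm{Aut}(\mathcal{T})}(1)$ is defined recursively by $\psi(b)=(a^{e_1},\dots,a^{e_{p-1}},b)$. Multi-EGS group: for $j\in\{1,\dots,p\}$ let $r_j\in\{0,1,\dots,p-1\}$, with $r_j\neq 0$ for at least one $j$. Let $\mathbf{E}=(\mathbf{E}^{(1)},\dots,\mathbf{E}^{(p)})$, where each $\mathbf{E}^{(j)}=(\mathbf{e}^{(j)}_1,\dots,\mathbf{e}^{(j)}_{r_j})$ is an $r_j$-tuple of $\mathbb{F}_p$-linearly independent vectors $\mathbf{e}^{(j)}_i=(e^{(j)}_{i,1},\dots,e^{(j)}_{i,p-1})\in(\mathbb{F}_p)^{p-1}$. The multi-EGS group associated to $\mathbf{E}$ is $$G_{\mathbf{E}}=\big\langle \{a\}\cup\{b^{(j)}_i\mid 1\le j\le p,\ 1\le i\le r_j\}\big\rangle,$$ where $b_i^{(j)}\in\mathrm{St}_{\mathrm{Aut}(\mathcal{T})}(1)$ is defined recursively by $$\psi(b^{(j)}_i)=\big(a^{e^{(j)}_{i,j}},\dots,a^{e^{(j)}_{i,p-1}},\,b^{(j)}_i,\,a^{e^{(j)}_{i,1}},\dots,a^{e^{(j)}_{i,j-1}}\big),$$ so that $b_i^{(j)}$ occurs in position $p-j+1$. The vectors $\mathbf{e}^{(j)}_i$ are the defining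 vectors of $G$. Periodic means every element has finite order. A group $G\le\mathrm{Aut}(\mathcal{T})$ is self-similar if for every vertex $\omega$ and every $g\in G$ fixing $\omega$, the restriction of $g$ to $\mathcal{T}_\omega$ (viewed in $\mathrm{Aut}(\mathcal{T})$) lies in $G$. A self-similar group $G$ that is transitive on every level is regular branch over a subgroup $K\ne 1$ of $G$ if $|G:K|<\infty$ and $K\times\overset{p}{\cdots}\times K\subseteq\psi(\mathrm{St}_K(1))$. (Multi-EGS groups are self-similar and transitive on every level.) Ramification structure: let $\Gamma$ be a finite group. A tuple $T=(g_1,\dots,g_m)$ of non-trivial elements of $\Gamma$ is a (spherical) system of generators if $\langle g_1,\dots,g_m\rangle=\Gamma$ and $g_1g_2\cdots g_m=1$. Put $\Sigma(T)=\bigcup_{g\in\Gamma}\bigcup_{i=1}^m\langle g_i\rangle^g$. Two tuples $T_1,T_2$ are disjoint if $\Sigma(T_1)\cap\Sigma(T_2)=\{1\}$. A ramification structure for $\Gamma$ is a pair $(T_1,T_2)$ of disjoint systems of generators of $\Gamma$ with $|T_1|=|T_2|$ (unmixed, of equal sizes). *)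

theory Defs
  imports
    "HOL-Algebra.Generated_Groups"
    "HOL-Number_Theory.Residues"
    "HOL-Combinatorics.Permutations"
    "Jordan_Normal_Form.Missing_VectorSpace"
begin

section \<open>The rooted tree and its automorphism group\<close>

definition tree_words :: "nat \<Rightarrow> nat list set" where
  "tree_words p = lists {1..p}"

definition tree_adj :: "nat \<Rightarrow> nat list \<Rightarrow> nat list \<Rightarrow> bool" where
  "tree_adj p u v \<longleftrightarrow> (\<exists>x\<in>{1..p}. v = u @ [x] \<or> u = v @ [x])"

text \<open>Automorphisms act on the right, so the product of \<open>g\<close> and \<open>h\<close> is ``first \<open>g\<close>, then \<open>h\<close>''.
  Being total functions on lists, they are normalised to be the identity outside the tree.\<close>

definition tree_aut :: "nat \<Rightarrow> (nat list \<Rightarrow> nat list) monoid" where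
  "tree_aut p =
    \<lparr>carrier = {g. g permutes tree_words p \<and> g [] = [] \<and>
       (\<forall>u\<in>tree_words p. \<forall>v\<in>tree_words p. tree_adj p (g u) (g v) \<longleftrightarrow> tree_adj p u v)},
     monoid.mult = (\<lambda>g h. h \<circ> g),
     one = id\<rparr>"

definition level_stab :: "nat \<Rightarrow> (nat list \<Rightarrow> nat list) set \<Rightarrow> nat \<Rightarrow> (nat list \<Rightarrow> nat list) set" where
  "level_stab p G n = {g \<in> G. \<forall>w\<in>tree_words p. length w = n \<longrightarrow> g w = w}"

text \<open>The restriction of \<open>g\<close> to the subtree of words with prefix \<open>u\<close>, read on the whole tree by
  deleting prefixes; only meaningful as an automorphism restricted to that subtree if \<open>g u = u\<close>.\<close>

definition tree_restr :: "nat list \<Rightarrow> (nat list \<Rightarrow> nat list) \<Rightarrow> nat list \<Rightarrow> nat list" where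
  "tree_restr u g = (\<lambda>w. drop (length u) (g (u @ w)))"

definition psi :: "nat \<Rightarrow> (nat list \<Rightarrow> nat list) \<Rightarrow> (nat list \<Rightarrow> nat list) list" where
  "psi p g = map (\<lambda>x. tree_restr [x] g) [1..<p+1]"

definition self_similar :: "nat \<Rightarrow> (nat list \<Rightarrow> nat list) set \<Rightarrow> bool" where
  "self_similar p G \<longleftrightarrow> (\<forall>w\<in>tree_words p. \<forall>g\<in>G. g w = w \<longrightarrow> tree_restr w g \<in> G)"

definition level_transitive :: "nat \<Rightarrow> (nat list \<Rightarrow> nat list) set \<Rightarrow> bool" where
  "level_transitive p G \<longleftrightarrow>
    (\<forall>u\<in>tree_words p. \<forall>v\<in>tree_words p. length u = length v \<longrightarrow> (\<exists>g\<in>G. g u = v))"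

definition regular_branch_over ::
    "nat \<Rightarrow> (nat list \<Rightarrow> nat list) set \<Rightarrow> (nat list \<Rightarrow> nat list) set \<Rightarrow> bool" where
  "regular_branch_over p G K \<longleftrightarrow>
     subgroup G (tree_aut p) \<and> self_similar p G \<and> level_transitive p G \<and>
     subgroup K ((tree_aut p)\<lparr>carrier := G\<rparr>) \<and> K \<noteq> {\<one>\<^bsub>tree_aut p\<^esub>} \<and>
     finite (rcosets\<^bsub>(tree_aut p)\<lparr>carrier := G\<rparr>\<^esub> K) \<and>
     {ks. length ks = p \<and> set ks \<subseteq> K} \<subseteq> psi p ` level_stab p K 1"

definition periodic_group :: "('a, 'b) monoid_scheme \<Rightarrow> bool" where
  "periodic_group \<Gamma> \<longleftrightarrow> (\<forall>g\<in>carrier \<Gamma>. \<exists>n::nat. n > 0 \<and> g [^]\<^bsub>\<Gamma>\<^esub> n = \<one>\<^bsub>\<Gamma>\<^esub>)"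


section \<open>Defining vectors\<close>

abbreviation Fp :: "nat \<Rightarrow> int ring" where
  "Fp p \<equiv> residue_ring (int p)"

text \<open>Vectors have coordinates indexed by \<open>1, \<dots>, p - 1\<close> and entries in \<open>{0..int p - 1}\<close>.\<close>

definition Fp_space :: "nat \<Rightarrow> (int, nat \<Rightarrow> int) module" where
  "Fp_space p = LinearCombinations.ring.func_space (Fp p) {1..p-1}"

text \<open>Linear independence of a tuple means distinct entries and linear independence of the
  set of entries.\<close>

definition multi_EGS_data :: "nat \<Rightarrow> (nat \<Rightarrow> (nat \<Rightarrow> int) list) \<Rightarrow> bool" where
  "multi_EGS_data p E \<longleftrightarrow>
     (\<forall>j\<in>{1..p}. length (E j) \<le> p - 1 \<and> set (E j) \<subseteq> carrier (Fp_space p) \<and>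
        distinct (E j) \<and> \<not> LinearCombinations.module.lin_dep (Fp p) (Fp_space p) (set (E j))) \<and>
     (\<exists>j\<in>{1..p}. length (E j) \<noteq> 0)"

definition defining_vectors :: "nat \<Rightarrow> (nat \<Rightarrow> (nat \<Rightarrow> int) list) \<Rightarrow> (nat \<Rightarrow> int) set" where
  "defining_vectors p E = (\<Union>j\<in>{1..p}. set (E j))"

definition span_dim :: "nat \<Rightarrow> (nat \<Rightarrow> int) set \<Rightarrow> nat" where
  "span_dim p S = vectorspace.dim (Fp p)
     ((Fp_space p)\<lparr>carrier := LinearCombinations.module.span (Fp p) (Fp_space p) S\<rparr>)"


section \<open>Multi-EGS groups and GGS-groups\<close>

definition rooted_a :: "nat \<Rightarrow> nat list \<Rightarrow> nat list" where
  "rooted_a p w = (case w of [] \<Rightarrow> [] | x # v \<Rightarrow>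
     if w \<in> tree_words p then (if x = p then 1 else x + 1) # v else w)"

text \<open>The right-hand side of the recursion for the directed generator of family \<open>j\<close> with defining
  vector \<open>e\<close>. Exponents of \<open>a\<close> are integer representatives modulo \<open>p\<close>, the order of \<open>a\<close>. The solution
  \<open>b\<close> of the recursion exists and is unique by \<open>directed_b_ex1\<close> below; for \<open>j = 1\<close> it is the
  directed generator of a GGS-group.\<close>

definition directed_tuple ::
    "nat \<Rightarrow> nat \<Rightarrow> (nat \<Rightarrow> int) \<Rightarrow> (nat list \<Rightarrow> nat list) \<Rightarrow> (nat list \<Rightarrow> nat list) list" where
  "directed_tuple p j e b =
     map (\<lambda>k. rooted_a p [^]\<^bsub>tree_aut p\<^esub> e k) [j..<p] @ [b] @
     map (\<lambda>k. rooted_a p [^]\<^bsub>tree_aut p\<^esub> e k) [1..<j]"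

definition directed_b :: "nat \<Rightarrow> nat \<Rightarrow> (nat \<Rightarrow> int) \<Rightarrow> nat list \<Rightarrow> nat list" where
  "directed_b p j e =
     (THE b. b \<in> level_stab p (carrier (tree_aut p)) 1 \<and> psi p b = directed_tuple p j e b)"

definition multi_EGS ::
    "nat \<Rightarrow> (nat \<Rightarrow> (nat \<Rightarrow> int) list) \<Rightarrow> (nat list \<Rightarrow> nat list) set" where
  "multi_EGS p E = generate (tree_aut p)
     ({rooted_a p} \<union> {directed_b p j e | j e. j \<in> {1..p} \<and> e \<in> set (E j)})"

definition GGS_group :: "nat \<Rightarrow> (nat list \<Rightarrow> nat list) set \<Rightarrow> bool" where
  "GGS_group p G \<longleftrightarrow>
     (\<exists>e\<in>carrier (Fp_space p). e \<noteq> \<zero>\<^bsub>Fp_space p\<^esub> \<and>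
        G = generate (tree_aut p) {rooted_a p, directed_b p 1 e})"


section \<open>Ramification structures\<close>

definition generating_system :: "('a, 'b) monoid_scheme \<Rightarrow> 'a list \<Rightarrow> bool" where
  "generating_system \<Gamma> T \<longleftrightarrow>
     set T \<subseteq> carrier \<Gamma> - {\<one>\<^bsub>\<Gamma>\<^esub>} \<and> generate \<Gamma> (set T) = carrier \<Gamma> \<and>
     foldr (\<otimes>\<^bsub>\<Gamma>\<^esub>) T \<one>\<^bsub>\<Gamma>\<^esub> = \<one>\<^bsub>\<Gamma>\<^esub>"

definition Sigma_set :: "('a, 'b) monoid_scheme \<Rightarrow> 'a list \<Rightarrow> 'a set" where
  "Sigma_set \<Gamma> T = (\<Union>g\<in>carrier \<Gamma>. \<Union>t\<in>set T.
     (\<lambda>h. inv\<^bsub>\<Gamma>\<^esub> g \<otimes>\<^bsub>\<Gamma>\<^esub> h \<otimes>\<^bsub>\<Gamma>\<^esub> g) ` generate \<Gamma> {t})"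

definition ramification_structure :: "('a, 'b) monoid_scheme \<Rightarrow> 'a list \<Rightarrow> 'a list \<Rightarrow> bool" where
  "ramification_structure \<Gamma> T1 T2 \<longleftrightarrow>
     group \<Gamma> \<and> finite (carrier \<Gamma>) \<and>
     generating_system \<Gamma> T1 \<and> generating_system \<Gamma> T2 \<and>
     Sigma_set \<Gamma> T1 \<inter> Sigma_set \<Gamma> T2 = {\<one>\<^bsub>\<Gamma>\<^esub>} \<and> length T1 = length T2"


section \<open>Well-definedness\<close>

subsection \<open>The automorphism group\<close>

lemma tree_autD:
  assumes "g \<in> carrier (tree_aut p)"
  shows "g permutes tree_words p" "g [] = []"
    "\<And>u v. u \<in> tree_words p \<Longrightarrow> v \<in> tree_words p \<Longrightarrow> tree_adj p (g u) (g v) \<longleftrightarrow> tree_adj p u v"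
  using assms by (auto simp: tree_aut_def)

lemma tree_words_snoc: "w @ [x] \<in> tree_words p \<longleftrightarrow> w \<in> tree_words p \<and> x \<in> {1..p}"
  by (auto simp: tree_words_def)

lemma tree_words_Cons: "x # w \<in> tree_words p \<longleftrightarrow> x \<in> {1..p} \<and> w \<in> tree_words p"
  by (auto simp: tree_words_def)

lemma tree_words_Nil [simp]: "[] \<in> tree_words p"
  by (auto simp: tree_words_def)

lemma group_tree_aut: "group (tree_aut p)"
proof (rule groupI)
  fix g h assume "g \<in> carrier (tree_aut p)" "h \<in> carrier (tree_aut p)"
  then show "g \<otimes>\<^bsub>tree_aut p\<^esub> h \<in> carrier (tree_aut p)"
    by (auto simp: tree_aut_def permutes_compose permutes_in_image)
next
  fix g assume g: "g \<in> carrier (tree_aut p)"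
  note gD = tree_autD[OF g]
  let ?h = "inv_into UNIV g"
  have h: "?h permutes tree_words p" using gD(1) by (rule permutes_inv)
  have gh: "g (?h w) = w" "?h (g w) = w" for w
    using permutes_inverses[OF gD(1)] by auto
  have nil: "?h [] = []" using gh(2)[of "[]"] gD(2) by simp
  have adj: "tree_adj p (?h u) (?h v) \<longleftrightarrow> tree_adj p u v"
    if "u \<in> tree_words p" "v \<in> tree_words p" for u v
    using gD(3)[of "?h u" "?h v"] permutes_in_image[OF h] that unfolding gh by blast
  have "?h \<in> carrier (tree_aut p)"
    unfolding tree_aut_def using h nil adj by simp
  moreover have "?h \<otimes>\<^bsub>tree_aut p\<^esub> g = \<one>\<^bsub>tree_aut p\<^esub>"
    by (auto simp: tree_aut_def gh)
  ultimately show "\<exists>h\<in>carrier (tree_aut p). h \<otimes>\<^bsub>tree_aut p\<^esub> g = \<one>\<^bsub>tree_aut p\<^esub>" by blast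
qed (auto simp: tree_aut_def permutes_id)

lemma tree_aut_snoc:
  assumes g: "g \<in> carrier (tree_aut p)"
  shows "w \<in> tree_words p \<Longrightarrow> length (g w) = length w \<and> (w \<noteq> [] \<longrightarrow> butlast (g w) = g (butlast w))"
proof (induction w rule: rev_induct)
  case Nil
  then show ?case using tree_autD(2)[OF g] by simp
next
  case (snoc x u)
  note gD = tree_autD[OF g]
  have u: "u \<in> tree_words p" and x: "x \<in> {1..p}" using snoc.prems by (auto simp: tree_words_snoc)
  have IH: "length (g u) = length u" "u \<noteq> [] \<Longrightarrow> butlast (g u) = g (butlast u)"
    using snoc.IH[OF u] by auto
  have "tree_adj p (g u) (g (u @ [x]))"
    using gD(3)[OF u snoc.prems] x by (auto simp: tree_adj_def)
  then obtain y where "g (u @ [x]) = g u @ [y] \<or> g u = g (u @ [x]) @ [y]"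
    by (auto simp: tree_adj_def)
  then show ?case
  proof
    assume "g (u @ [x]) = g u @ [y]"
    then show ?thesis using IH by simp
  next
    assume *: "g u = g (u @ [x]) @ [y]"
    then have ne: "u \<noteq> []" using gD(2) by auto
    have "g (butlast u) = g (u @ [x])" using IH(2)[OF ne] * by simp
    then have "butlast u = u @ [x]" using permutes_inj[OF gD(1)] by (auto dest: injD)
    then have "length (butlast u) = length (u @ [x])" by simp
    then show ?thesis by simp
  qed
qed

lemma tree_autI:
  assumes g: "g permutes tree_words p"
    and len: "\<And>w. w \<in> tree_words p \<Longrightarrow> length (g w) = length w"
    and bl: "\<And>w x. w @ [x] \<in> tree_words p \<Longrightarrow> butlast (g (w @ [x])) = g w"
  shows "g \<in> carrier (tree_aut p)"
proof -
  have 1: "(\<exists>x\<in>{1..p}. g v = g u @ [x]) \<longleftrightarrow> (\<exists>x\<in>{1..p}. v = u @ [x])"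
    if u: "u \<in> tree_words p" and v: "v \<in> tree_words p" for u v
  proof
    assume "\<exists>x\<in>{1..p}. g v = g u @ [x]"
    then obtain x where x: "g v = g u @ [x]" by blast
    then have "length v = Suc (length u)" using len[OF u] len[OF v] by simp
    then obtain v' y where v': "v = v' @ [y]" by (cases v rule: rev_cases) auto
    have "g v' = g u" using bl[of v' y] v v' x by simp
    then have "v' = u" using permutes_inj[OF g] by (auto dest: injD)
    then show "\<exists>x\<in>{1..p}. v = u @ [x]" using v' v by (auto simp: tree_words_snoc)
  next
    assume "\<exists>x\<in>{1..p}. v = u @ [x]"
    then obtain x where x: "v = u @ [x]" by blast
    have "g v \<noteq> []" using len[OF v] x by (metis length_0_conv snoc_eq_iff_butlast)
    then have "g v = g u @ [last (g v)]"
      using bl[of u x] v x by (metis append_butlast_last_id)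
    moreover have "g v \<in> tree_words p" using permutes_in_image[OF g] v by blast
    ultimately show "\<exists>x\<in>{1..p}. g v = g u @ [x]" by (metis tree_words_snoc)
  qed
  have "tree_adj p (g u) (g v) \<longleftrightarrow> tree_adj p u v"
    if "u \<in> tree_words p" "v \<in> tree_words p" for u v
    using 1[OF that] 1[OF that(2,1)] unfolding tree_adj_def by blast
  moreover have "g [] = []" using len[of "[]"] by simp
  ultimately show ?thesis unfolding tree_aut_def using g by simp
qed

lemma tree_aut_hd:
  assumes g: "g \<in> carrier (tree_aut p)"
  shows "x # w \<in> tree_words p \<Longrightarrow> take 1 (g (x # w)) = g [x]"
proof (induction w rule: rev_induct)
  case Nil
  then show ?case using tree_aut_snoc[OF g, of "[x]"] by simp
next
  case (snoc y w)
  have w: "x # w \<in> tree_words p" using snoc.prems by (auto simp: tree_words_def)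
  have *: "butlast (g (x # w @ [y])) = g (x # w)" "length (g (x # w @ [y])) = length w + 2"
    using tree_aut_snoc[OF g snoc.prems] by (auto simp: butlast_append)
  have "take 1 (butlast (g (x # w @ [y]))) = take 1 (g (x # w @ [y]))"
    using *(2) by (simp add: take_butlast)
  then show ?case using * snoc.IH[OF w] by simp
qed


subsection \<open>Level stabilisers are normal\<close>

lemma level_stab_normal:
  assumes G: "subgroup G (tree_aut p)"
  shows "level_stab p G n \<lhd> (tree_aut p)\<lparr>carrier := G\<rparr>"
proof -
  let ?A = "tree_aut p" and ?G = "(tree_aut p)\<lparr>carrier := G\<rparr>" and ?S = "level_stab p G n"
  interpret A: group ?A by (rule group_tree_aut)
  interpret GG: group ?G using A.subgroup_imp_group[OF G] .
  have inv_eq: "inv\<^bsub>?G\<^esub> g = inv\<^bsub>?A\<^esub> g" if "g \<in> G" for g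
    using A.m_inv_consistent[OF G that] .
  have inv1: "g ((inv\<^bsub>?A\<^esub> g) w) = w" "(inv\<^bsub>?A\<^esub> g) (g w) = w" if "g \<in> G" for g w
  proof -
    have gA: "g \<in> carrier ?A" using that G by (auto dest: subgroup.mem_carrier)
    show "g ((inv\<^bsub>?A\<^esub> g) w) = w" "(inv\<^bsub>?A\<^esub> g) (g w) = w"
      using fun_cong[OF A.l_inv[OF gA], of w] fun_cong[OF A.r_inv[OF gA], of w]
      by (simp_all add: tree_aut_def)
  qed
  have lev: "g w \<in> tree_words p" "length (g w) = length w" if "g \<in> G" "w \<in> tree_words p" for g w
  proof -
    have gA: "g \<in> carrier ?A" using that G by (auto dest: subgroup.mem_carrier)
    show "g w \<in> tree_words p" "length (g w) = length w"
      using permutes_in_image[OF tree_autD(1)[OF gA]] tree_aut_snoc[OF gA] that by auto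
  qed
  have sub: "subgroup ?S ?G"
  proof (rule GG.subgroupI)
    show "?S \<subseteq> carrier ?G" by (auto simp: level_stab_def)
    have "\<one>\<^bsub>?A\<^esub> \<in> ?S" using subgroup.one_closed[OF G] by (auto simp: level_stab_def tree_aut_def)
    then show "?S \<noteq> {}" by blast
  next
    fix g assume g: "g \<in> ?S"
    then have gG: "g \<in> G" by (auto simp: level_stab_def)
    have "(inv\<^bsub>?A\<^esub> g) w = w" if "w \<in> tree_words p" "length w = n" for w
      using inv1(2)[OF gG, of w] g that by (auto simp: level_stab_def)
    then show "inv\<^bsub>?G\<^esub> g \<in> ?S"
      using inv_eq[OF gG] subgroup.m_inv_closed[OF G gG] by (auto simp: level_stab_def)
  next
    fix g h assume "g \<in> ?S" "h \<in> ?S"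
    then show "g \<otimes>\<^bsub>?G\<^esub> h \<in> ?S"
      using subgroup.m_closed[OF G, of g h] by (auto simp: level_stab_def tree_aut_def)
  qed
  have "g \<otimes>\<^bsub>?G\<^esub> h \<otimes>\<^bsub>?G\<^esub> inv\<^bsub>?G\<^esub> g \<in> ?S" if gc: "g \<in> carrier ?G" and h: "h \<in> ?S" for g h
  proof -
    have g: "g \<in> G" and hG: "h \<in> G" using gc h by (auto simp: level_stab_def)
    have "g \<otimes>\<^bsub>?A\<^esub> h \<otimes>\<^bsub>?A\<^esub> inv\<^bsub>?A\<^esub> g \<in> G"
      using g hG G by (simp add: subgroup.m_closed subgroup.m_inv_closed)
    moreover have "(g \<otimes>\<^bsub>?A\<^esub> h \<otimes>\<^bsub>?A\<^esub> inv\<^bsub>?A\<^esub> g) w = w"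
      if w: "w \<in> tree_words p" "length w = n" for w
    proof -
      have "(g \<otimes>\<^bsub>?A\<^esub> h \<otimes>\<^bsub>?A\<^esub> inv\<^bsub>?A\<^esub> g) w = (inv\<^bsub>?A\<^esub> g) (h (g w))"
        by (simp add: tree_aut_def)
      also have "h (g w) = g w"
        using h lev[OF g w(1)] w by (auto simp: level_stab_def)
      finally show ?thesis using inv1(2)[OF g] by simp
    qed
    ultimately show ?thesis using inv_eq[OF g] by (simp add: level_stab_def)
  qed
  then have "\<forall>g\<in>carrier ?G. \<forall>h\<in>?S. g \<otimes>\<^bsub>?G\<^esub> h \<otimes>\<^bsub>?G\<^esub> inv\<^bsub>?G\<^esub> g \<in> ?S" by (intro ballI)
  with sub show ?thesis by (intro iffD2[OF GG.normal_inv_iff] conjI)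
qed


subsection \<open>The generators exist and are unique\<close>

lemma rooted_a_closed:
  assumes p: "p > 0"
  shows "rooted_a p \<in> carrier (tree_aut p)"
proof (rule tree_autI)
  show "rooted_a p permutes tree_words p"
  proof (rule bij_imp_permutes)
    define c where "c = (\<lambda>x::nat. if x = p then 1 else x + 1)"
    define d where "d = (\<lambda>x::nat. if x = 1 then p else x - 1)"
    define a' where "a' = (\<lambda>w::nat list. case w of [] \<Rightarrow> [] | x # v \<Rightarrow> d x # v)"
    have cd: "c x \<in> {1..p}" "d x \<in> {1..p}" "c (d x) = x" "d (c x) = x" if "x \<in> {1..p}" for x
      using that p by (auto simp: c_def d_def)
    have a: "rooted_a p w = (case w of [] \<Rightarrow> [] | x # v \<Rightarrow> c x # v)" if "w \<in> tree_words p" for w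
      using that by (auto simp: rooted_a_def c_def split: list.splits)
    have mem: "rooted_a p w \<in> tree_words p" "a' w \<in> tree_words p"
        "a' (rooted_a p w) = w" "rooted_a p (a' w) = w" if "w \<in> tree_words p" for w
    proof -
      have "rooted_a p w \<in> tree_words p \<and> a' w \<in> tree_words p \<and>
          a' (rooted_a p w) = w \<and> rooted_a p (a' w) = w"
      proof (cases w)
        case Nil
        then show ?thesis by (simp add: rooted_a_def a'_def)
      next
        case (Cons x v)
        then have x: "x \<in> {1..p}" and v: "v \<in> tree_words p" using that by (auto simp: tree_words_Cons)
        have w': "c x # v \<in> tree_words p" "d x # v \<in> tree_words p"
          using cd(1,2)[OF x] v by (auto simp: tree_words_Cons)
        have e: "rooted_a p w = c x # v" "a' w = d x # v" "a' (rooted_a p w) = d (c x) # v"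
            "rooted_a p (a' w) = c (d x) # v"
          using a[OF that] a[OF w'(2)] Cons by (simp_all add: a'_def)
        have "a' (rooted_a p w) = w" "rooted_a p (a' w) = w"
          by (simp_all only: e(3,4) cd(3,4)[OF x] local.Cons[symmetric])
        moreover have "rooted_a p w \<in> tree_words p" "a' w \<in> tree_words p"
          unfolding e using w' by simp_all
        ultimately show ?thesis by blast
      qed
      then show "rooted_a p w \<in> tree_words p" "a' w \<in> tree_words p"
        "a' (rooted_a p w) = w" "rooted_a p (a' w) = w" by blast+
    qed
    show "bij_betw (rooted_a p) (tree_words p) (tree_words p)"
      by (rule bij_betw_byWitness[where f' = a']) (use mem in blast)+
  qed (auto simp: rooted_a_def split: list.splits)
next
  fix w assume "w \<in> tree_words p"
  then show "length (rooted_a p w) = length w" by (auto simp: rooted_a_def split: list.splits)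
next
  fix w x assume "w @ [x] \<in> tree_words p"
  then show "butlast (rooted_a p (w @ [x])) = rooted_a p w"
    by (cases w) (auto simp: rooted_a_def tree_words_def)
qed

lemma rooted_a_int_pow_closed:
  "p > 0 \<Longrightarrow> rooted_a p [^]\<^bsub>tree_aut p\<^esub> (i::int) \<in> carrier (tree_aut p)"
  using group.int_pow_closed[OF group_tree_aut rooted_a_closed] .

primrec dir_fun ::
    "(nat \<Rightarrow> nat list \<Rightarrow> nat list) \<Rightarrow> nat \<Rightarrow> nat list \<Rightarrow> nat list" where
  "dir_fun F q [] = []"
| "dir_fun F q (x # w) = x # (if x = q then dir_fun F q w else F x w)"

lemma dir_fun_closed:
  assumes F: "\<And>x. x \<in> {1..p} \<Longrightarrow> F x \<in> carrier (tree_aut p)"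
    and F_out: "\<And>x. x \<notin> {1..p} \<Longrightarrow> F x = id"
    and q: "q \<in> {1..p}"
  shows "dir_fun F q \<in> carrier (tree_aut p)"
proof (rule tree_autI)
  let ?F' = "\<lambda>x. inv_into UNIV (F x)"
  have perm: "F x permutes tree_words p" for x
    using tree_autD(1)[OF F, of x] F_out[of x] by (cases "x \<in> {1..p}") (auto simp: permutes_id)
  have inv: "?F' x (F x w) = w" "F x (?F' x w) = w" for x w
    using permutes_inverses[OF perm] by auto
  have 1: "dir_fun ?F' q (dir_fun F q w) = w" for w
    by (induction w) (auto simp: inv)
  have 2: "dir_fun F q (dir_fun ?F' q w) = w" for w
    by (induction w) (auto simp: inv)
  have 3: "dir_fun F q w = w" if "w \<notin> tree_words p" for w
    using that
  proof (induction w)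
    case (Cons x w)
    then show ?case
      using F_out[of x] q permutes_not_in[OF perm] by (auto simp: tree_words_Cons)
  qed simp
  have "\<exists>!w. dir_fun F q w = v" for v
    using 1 2 by metis
  then show "dir_fun F q permutes tree_words p"
    using 3 by (auto simp: permutes_def)
next
  fix w assume "w \<in> tree_words p"
  then show "length (dir_fun F q w) = length w"
    by (induction w) (auto simp: tree_words_Cons tree_aut_snoc[OF F])
next
  fix w x assume "w @ [x] \<in> tree_words p"
  then show "butlast (dir_fun F q (w @ [x])) = dir_fun F q w"
  proof (induction w)
    case Nil
    then show ?case using tree_autD(2)[OF F] by (auto simp: tree_words_Cons)
  next
    case (Cons y w)
    have w: "w @ [x] \<in> tree_words p" and y: "y \<in> {1..p}" using Cons.prems by (auto simp: tree_words_Cons)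
    note IH = Cons.IH[OF w]
    have Fy: "butlast (F y (w @ [x])) = F y w" "length (F y (w @ [x])) = Suc (length w)"
      using tree_aut_snoc[OF F[OF y] w] by auto
    have ne: "F y (w @ [x]) \<noteq> []" using Fy(2) by auto
    have "dir_fun F q (w @ [x]) \<noteq> []" by (cases w) auto
    then show ?case using IH ne Fy(1) by auto
  qed
qed

lemma directed_b_ex1:
  assumes p: "p > 0" and j: "j \<in> {1..p}"
  shows "\<exists>!b. b \<in> level_stab p (carrier (tree_aut p)) 1 \<and> psi p b = directed_tuple p j e b"
proof (rule ex_ex1I)
  define a where "a = (\<lambda>k. rooted_a p [^]\<^bsub>tree_aut p\<^esub> e k)"
  define F where "F = (\<lambda>x. if x \<notin> {1..p} then id
      else if x \<le> p - j then a (x + j - 1) else a (x + j - 1 - p))"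
  let ?b = "dir_fun F (p - j + 1)"
  have F: "F x \<in> carrier (tree_aut p)" if "x \<in> {1..p}" for x
    using that rooted_a_int_pow_closed[OF p] by (auto simp: F_def a_def)
  have b: "?b \<in> carrier (tree_aut p)"
    by (rule dir_fun_closed[OF F]) (use j in \<open>auto simp: F_def\<close>)
  have "?b w = w" if "w \<in> tree_words p" "length w = 1" for w
    using that tree_autD(2)[OF F] by (cases w) (auto simp: tree_words_Cons)
  then have "?b \<in> level_stab p (carrier (tree_aut p)) 1" using b by (auto simp: level_stab_def)
  moreover have "psi p ?b = directed_tuple p j e ?b"
  proof (rule nth_equalityI)
    show "length (psi p ?b) = length (directed_tuple p j e ?b)"
      using j by (auto simp: psi_def directed_tuple_def)
    fix i assume "i < length (psi p ?b)"
    then have i: "i < p" by (simp add: psi_def del: upt_Suc)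
    have L: "psi p ?b ! i = (if i = p - j then ?b else F (Suc i))"
      using i by (auto simp: psi_def tree_restr_def simp del: upt_Suc)
    have R: "directed_tuple p j e ?b ! i =
        (if i < p - j then a (j + i) else if i = p - j then ?b else a (i - (p - j)))"
      using i j by (auto simp: directed_tuple_def a_def nth_append nth_Cons' Suc_diff_Suc)
    consider "i < p - j" | "i = p - j" | "i > p - j" by linarith
    then show "psi p ?b ! i = directed_tuple p j e ?b ! i"
    proof cases
      case 1
      then have "F (Suc i) = a (Suc i + j - 1)" using i by (simp add: F_def)
      also have "Suc i + j - 1 = j + i" by simp
      finally show ?thesis unfolding L R using 1 by simp
    next
      case 2
      then show ?thesis unfolding L R by simp
    next
      case 3
      then have "F (Suc i) = a (Suc i + j - 1 - p)" using i by (simp add: F_def)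
      also have "Suc i + j - 1 - p = i - (p - j)" using i j 3 by auto
      finally show ?thesis unfolding L R using 3 by simp
    qed
  qed
  ultimately show "\<exists>b. b \<in> level_stab p (carrier (tree_aut p)) 1 \<and> psi p b = directed_tuple p j e b"
    by blast
next
  fix b c
  assume b: "b \<in> level_stab p (carrier (tree_aut p)) 1 \<and> psi p b = directed_tuple p j e b"
    and c: "c \<in> level_stab p (carrier (tree_aut p)) 1 \<and> psi p c = directed_tuple p j e c"
  have step: "g (x # w) = x # tree_restr [x] g w"
    if "g \<in> level_stab p (carrier (tree_aut p)) 1" "x # w \<in> tree_words p" for g x w
  proof -
    have "take 1 (g (x # w)) = [x]"
      using tree_aut_hd[of g p x w] that by (auto simp: level_stab_def tree_words_Cons)
    then show ?thesis by (cases "g (x # w)") (auto simp: tree_restr_def)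
  qed
  have nth: "tree_restr [x] g = psi p g ! (x - 1)" if "x \<in> {1..p}" for x g
    using that by (auto simp: psi_def simp del: upt_Suc)
  have "b w = c w" if "w \<in> tree_words p" for w
    using that
  proof (induction w)
    case Nil
    then show ?case using b c tree_autD(2)[of b p] tree_autD(2)[of c p] by (auto simp: level_stab_def)
  next
    case (Cons x w)
    then have x: "x \<in> {1..p}" and w: "b w = c w" by (auto simp: tree_words_Cons)
    have "(directed_tuple p j e b ! (x - 1)) w = (directed_tuple p j e c ! (x - 1)) w"
      using w by (auto simp: directed_tuple_def nth_append nth_Cons')
    then have "tree_restr [x] b w = tree_restr [x] c w"
      using b c by (simp add: nth[OF x])
    then show ?case using step[of b x w] step[of c x w] b c Cons.prems by simp
  qed
  moreover have "b w = c w" if "w \<notin> tree_words p" for w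
    using that b c by (auto simp: level_stab_def permutes_not_in[OF tree_autD(1)])
  ultimately show "b = c" by blast
qed

lemma directed_b:
  assumes "p > 0" "j \<in> {1..p}"
  shows "directed_b p j e \<in> level_stab p (carrier (tree_aut p)) 1"
    "psi p (directed_b p j e) = directed_tuple p j e (directed_b p j e)"
  using theI'[OF directed_b_ex1[OF assms, of e]] by (auto simp: directed_b_def)

lemma subgroup_multi_EGS:
  assumes p: "p > 0"
  shows "subgroup (multi_EGS p E) (tree_aut p)"
  unfolding multi_EGS_def
  by (rule group.generate_is_subgroup[OF group_tree_aut])
    (use rooted_a_closed[OF p] directed_b(1)[OF p] in \<open>auto simp: level_stab_def\<close>)


subsection \<open>The space of vectors\<close>

lemma vectorspace_Fp_space:
  assumes "prime p"
  shows "vectorspace (Fp p) (Fp_space p)"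
proof -
  interpret R: residues_prime p "Fp p"
    using assms by (simp add: residues_prime_def)
  have "field (Fp p)" by (rule R.is_field)
  moreover have "module (Fp p) (Fp_space p)"
    unfolding Fp_space_def by (rule LinearCombinations.cring.func_space_is_module) (rule R.cring)
  ultimately show ?thesis by (simp add: vectorspace_def)
qed

end

theory Submission
  imports Defs "HOL-Algebra.Multiplicative_Group"
begin

text \<open>The letters are read as residues modulo \<open>p\<close>. Every element \<open>g\<close> of a multi-EGS group acts below
  each vertex \<open>w\<close> by rotating the next letter by some \<open>rot g w\<close> in \<open>\<int>/p\<close>, and
  \<open>rot\<close> satisfies a cocycle identity. All computations take place with these labels, on the vertices of
  levels 0, 1 and 2.

  The group \<open>G\<close> is generated by \<open>a\<close> and the directed generators \<open>b\<close>, which all have order \<open>p\<close> and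
  act faithfully on level 2. These generators form one side of the ramification structure. Since a list
  may contain each entry next to its inverse, and entries may be repeated, the whole problem is to find a
  second generating set such that no conjugate of a non-trivial power of a generator is a power of one of its
  members (\<open>ramification_structure_quotient\<close>).

  For levels \<open>k\<close> \<open>\<ge>\<close> 3 the second set consists of the \<^emph>\<open>deep\<close> elements: those for which each power of
  order at most \<open>p\<close> on level 3 fixes level 2. A power of a generator which is conjugate to a power of a
  deep element fixes level 2 and so is trivial. It remains to see that deep elements generate \<open>G\<close>.
  Let \<open>\<sigma>\<close>\<open>(g)\<close> be the sum of the rotations of \<open>g\<close> over level 1, a homomorphism to \<open>\<int>/p\<close>.
  If \<open>\<sigma>\<close> does not vanish on some generator, then the elements which
  move level 1 and have non-zero \<open>\<sigma>\<close> generate; such an element permutes each of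
  the levels 1, 2, 3 in a single cycle and is therefore deep (\<open>deep_if_sums_nonzero\<close>). If \<open>\<sigma>\<close>
  vanishes on \<open>G\<close> and \<open>u\<close> moves level 1, then \<open>u^p\<close> fixes level 2, and \<open>u\<close> is deep unless \<open>u^p\<close>
  fixes level 3. In that last case there is a commutator \<open>Q\<close> of two conjugates of a directed generator,
  fixing level 2, such that \<open>u Q\<close> and \<open>u Q Q\<close> are deep, whence \<open>u\<close> is a product of deep elements and
  their inverses. That \<open>Q\<close> can be chosen (\<open>moving_witness_exists\<close>) is the heart of the
  matter: \<open>(u Q)^p\<close> rotates by sums of the rotations of \<open>Q\<close> over orbits of \<open>u\<close>; if they
  vanished for \<open>Q\<close> and for a suitable conjugate of \<open>Q\<close>, the defining vector would be a linear function
  on \<open>\<int>/p\<close>, and for a linear function these sums are visibly not zero (\<open>affine_contradiction\<close>).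

  As the span of the defining vectors has dimension \<open>r\<close> \<open>\<ge>\<close> 1, a level
  \<open>k\<close> \<open>\<ge>\<close> \<open>r + 1\<close> below 3 is \<open>k = 2\<close>, with \<open>r = 1\<close>. Then all defining vectors are proportional, and the elements \<open>a b\<close> and \<open>a b b\<close>
  serve as the second set. They are separated from \<open>a\<close> by a homomorphism to \<open>\<int>/p\<close> which is trivial on \<open>a\<close>
  and on no \<open>b\<close>, namely the first power moment of the level-1 rotations which is not identically zero on \<open>G\<close>
  (\<open>invariant_exists\<close>); they are separated from \<open>b\<close> because their \<open>p\<close>-th powers rotate by the
  same amount everywhere on level 1, while a power of \<open>b\<close> has rotation 0 at one letter.\<close>


section \<open>Ramification structures from two generating sets\<close>

lemma (in group) foldr_mult_inverse_pairs:
  assumes "set xs \<subseteq> carrier G"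
  shows "foldr (\<otimes>) (concat (map (\<lambda>x. [x, inv x]) xs)) \<one> = \<one>"
  using assms by (induction xs) (auto simp: inv_equality m_assoc[symmetric])

lemma (in group) generate_inv_singleton:
  assumes "x \<in> carrier G"
  shows "generate G {inv x} = generate G {x}"
proof
  have "inv x \<in> generate G {x}" by (rule generate.inv) simp
  then show "generate G {inv x} \<subseteq> generate G {x}"
    using generate_subgroup_incl[of "{inv x}" "generate G {x}"] generate_is_subgroup[of "{x}"] assms
    by auto
  have "inv (inv x) \<in> generate G {inv x}" by (rule generate.inv) simp
  then have "x \<in> generate G {inv x}" using assms by simp
  then show "generate G {x} \<subseteq> generate G {inv x}"
    using generate_subgroup_incl[of "{x}" "generate G {inv x}"] generate_is_subgroup[of "{inv x}"] assms
    by auto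
qed

text \<open>Listing each element of a generating set together with its inverse makes the product trivial and does
  not change the union of the conjugates of the cyclic subgroups; so only the two sets matter, not their
  sizes or any relation between their elements.\<close>

lemma (in group) ramification_structure_from_sets:
  assumes fin: "finite (carrier G)"
    and X: "X \<noteq> {}" "X \<subseteq> carrier G - {\<one>}" "generate G X = carrier G"
    and Y: "Y \<noteq> {}" "Y \<subseteq> carrier G - {\<one>}" "generate G Y = carrier G"
    and disj: "\<And>x y g m n. x \<in> X \<Longrightarrow> y \<in> Y \<Longrightarrow> g \<in> carrier G \<Longrightarrow>
      inv g \<otimes> x [^] (m::nat) \<otimes> g = y [^] (n::nat) \<Longrightarrow> x [^] m = \<one>"
  shows "\<exists>T1 T2. ramification_structure G T1 T2"
proof -
  define D where "D = (\<lambda>xs::'a list. concat (map (\<lambda>x. [x, inv x]) xs))"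
  have setD: "set (D xs) = set xs \<union> (\<lambda>x. inv x) ` set xs" for xs by (auto simp: D_def)
  have lenD: "length (D xs) = 2 * length xs" for xs
    by (induction xs) (auto simp: D_def)
  have genD: "generating_system G (D xs)"
    if "set xs = S" "S \<subseteq> carrier G - {\<one>}" "generate G S = carrier G" for xs S
    unfolding generating_system_def
  proof (intro conjI)
    have S: "S \<subseteq> carrier G" using that by auto
    show sub: "set (D xs) \<subseteq> carrier G - {\<one>}" using that by (auto simp: setD)
    show "generate G (set (D xs)) = carrier G"
      using mono_generate[of S "set (D xs)"] generate_incl[of "set (D xs)"] sub that by (auto simp: setD)
    show "foldr (\<otimes>) (D xs) \<one> = \<one>"
      unfolding D_def by (rule foldr_mult_inverse_pairs) (use that S in simp)
  qed
  have mem_Sigma: "\<exists>g\<in>carrier G. \<exists>s\<in>S. \<exists>n::nat. h = inv g \<otimes> s [^] n \<otimes> g"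
    if h: "h \<in> Sigma_set G (D xs)" and xs: "set xs = S" "S \<subseteq> carrier G" for xs S h
  proof -
    obtain g t u where g: "g \<in> carrier G" and t: "t \<in> set (D xs)" "u \<in> generate G {t}"
      and hu: "h = inv g \<otimes> u \<otimes> g"
      using h unfolding Sigma_set_def by auto
    from t(1) obtain s where s: "s \<in> S" "t = s \<or> t = inv s" by (auto simp: setD xs)
    then have "generate G {t} = generate G {s}" using generate_inv_singleton xs(2) by blast
    then have "u \<in> generate G {s}" using t(2) by simp
    moreover have "ord s \<noteq> 0" using ord_ge_1[OF fin, of s] s(1) xs(2) by auto
    ultimately obtain n :: nat where "u = s [^] n" using generate_pow_nat[of s] s(1) xs(2) by auto
    then show ?thesis using g s hu by blast
  qed
  have one_Sigma: "\<one> \<in> Sigma_set G (D xs)" if "set xs = S" "S \<noteq> {}" for xs S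
  proof -
    from that(2) obtain t where "t \<in> S" by blast
    then have "t \<in> set (D xs)" using that by (simp add: setD)
    moreover have "inv \<one> \<otimes> \<one> \<otimes> \<one> = \<one>" by simp
    ultimately show ?thesis unfolding Sigma_set_def
      using generate.one[of G] by (metis (no_types, lifting) UN_iff image_eqI one_closed)
  qed
  have "finite X" "finite Y" using X Y fin by (auto intro: finite_subset)
  then obtain xs ys where xs: "set xs = X" and ys: "set ys = Y" using finite_list by metis
  \<comment> \<open>Repeating an entry changes neither condition, so the shorter list can be padded.\<close>
  define xs' ys' where "xs' = xs @ replicate (length ys) (hd xs)" and "ys' = ys @ replicate (length xs) (hd ys)"
  have sets: "set xs' = X" "set ys' = Y"
    using xs ys X(1) Y(1) by (auto simp: xs'_def ys'_def)
  have "Sigma_set G (D xs') \<inter> Sigma_set G (D ys') \<subseteq> {\<one>}"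
  proof
    fix h assume h: "h \<in> Sigma_set G (D xs') \<inter> Sigma_set G (D ys')"
    obtain g x and m::nat where 1: "g \<in> carrier G" "x \<in> X" "h = inv g \<otimes> x [^] m \<otimes> g"
      using mem_Sigma[OF _ sets(1), of h] h X by auto
    obtain k y and n::nat where 2: "k \<in> carrier G" "y \<in> Y" "h = inv k \<otimes> y [^] n \<otimes> k"
      using mem_Sigma[OF _ sets(2), of h] h Y by auto
    have c: "x [^] m \<in> carrier G" "y [^] n \<in> carrier G" using 1 2 X Y by auto
    have "inv (g \<otimes> inv k) \<otimes> x [^] m \<otimes> (g \<otimes> inv k) = k \<otimes> h \<otimes> inv k"
      using 1 2 c by (simp add: inv_mult_group m_assoc)
    also have "\<dots> = y [^] n"
    proof -
      have "k \<otimes> (inv k \<otimes> y [^] n) = y [^] n"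
        using 2(1) c by (simp add: m_assoc[symmetric])
      then show ?thesis unfolding 2(3) using 2(1) c by (simp add: m_assoc)
    qed
    finally have "x [^] m = \<one>"
      using disj[of x y "g \<otimes> inv k" m n] 1 2 by simp
    then show "h \<in> {\<one>}" using 1 by simp
  qed
  then have "Sigma_set G (D xs') \<inter> Sigma_set G (D ys') = {\<one>}"
    using one_Sigma sets X(1) Y(1) by blast
  then have "ramification_structure G (D xs') (D ys')"
    unfolding ramification_structure_def
    using fin genD[OF sets(1) X(2,3)] genD[OF sets(2) Y(2,3)] is_group
    by (simp add: lenD xs'_def ys'_def)
  then show ?thesis by blast
qed

text \<open>The same criterion for a quotient, with the hypotheses on representatives: a subset of \<open>G\<close> that
  generates \<open>G\<close> generates every quotient.\<close>

lemma (in normal) ramification_structure_quotient: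
  assumes fin: "finite (carrier (G Mod H))"
    and X: "X \<noteq> {}" "X \<subseteq> carrier G - H" "generate G X = carrier G"
    and Y: "Y \<noteq> {}" "Y \<subseteq> carrier G - H" "generate G Y = carrier G"
    and disj: "\<And>x y g h m n. x \<in> X \<Longrightarrow> y \<in> Y \<Longrightarrow> g \<in> carrier G \<Longrightarrow> h \<in> H \<Longrightarrow>
      inv g \<otimes> x [^] (m::nat) \<otimes> g = h \<otimes> y [^] (n::nat) \<Longrightarrow> x [^] m \<in> H"
  shows "\<exists>T1 T2. ramification_structure (G Mod H) T1 T2"
proof -
  interpret Q: group "G Mod H" by (rule factorgroup_is_group)
  interpret hom: group_hom G "G Mod H" "\<lambda>x. H #> x"
    by unfold_locales (rule r_coset_hom_Mod)
  have gen: "generate (G Mod H) ((\<lambda>x. H #> x) ` S) = carrier (G Mod H)"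
    if "S \<subseteq> carrier G" "generate G S = carrier G" for S
    using hom.generate_img[OF that(1)] that(2)
    by (simp only: carrier_FactGroup)
  have one: "x \<in> H" if "H #> x = \<one>\<^bsub>G Mod H\<^esub>" "x \<in> carrier G" for x
    using that rcos_self[OF that(2) subgroup_axioms] by (simp add: FactGroup_def)
  show ?thesis
  proof (rule Q.ramification_structure_from_sets[OF fin, of "(\<lambda>x. H #> x) ` X" "(\<lambda>x. H #> x) ` Y"])
    show "(\<lambda>x. H #> x) ` X \<noteq> {}" "(\<lambda>x. H #> x) ` Y \<noteq> {}" using X Y by auto
    show "(\<lambda>x. H #> x) ` X \<subseteq> carrier (G Mod H) - {\<one>\<^bsub>G Mod H\<^esub>}"
      "(\<lambda>x. H #> x) ` Y \<subseteq> carrier (G Mod H) - {\<one>\<^bsub>G Mod H\<^esub>}"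
      using one X(2) Y(2) hom.hom_closed by auto
    show "generate (G Mod H) ((\<lambda>x. H #> x) ` X) = carrier (G Mod H)"
      "generate (G Mod H) ((\<lambda>x. H #> x) ` Y) = carrier (G Mod H)"
      by (rule gen; use X Y in auto)+
    fix x' y' g' and m n :: nat
    assume "x' \<in> (\<lambda>x. H #> x) ` X" "y' \<in> (\<lambda>x. H #> x) ` Y" "g' \<in> carrier (G Mod H)"
      and eq: "inv\<^bsub>G Mod H\<^esub> g' \<otimes>\<^bsub>G Mod H\<^esub> x' [^]\<^bsub>G Mod H\<^esub> m \<otimes>\<^bsub>G Mod H\<^esub> g' = y' [^]\<^bsub>G Mod H\<^esub> n"
    then obtain x y g where x: "x \<in> X" "x' = H #> x" and y: "y \<in> Y" "y' = H #> y"
      and g: "g \<in> carrier G" "g' = H #> g"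
      by (auto simp: FactGroup_def RCOSETS_def)
    have xc: "x \<in> carrier G" "y \<in> carrier G" using x y X Y by auto
    have pw: "x' [^]\<^bsub>G Mod H\<^esub> m = H #> x [^] m" "y' [^]\<^bsub>G Mod H\<^esub> n = H #> y [^] n"
      unfolding x y using hom.hom_nat_pow[of x m] hom.hom_nat_pow[of y n] xc by simp_all
    have "H #> (inv g \<otimes> x [^] m \<otimes> g) = H #> y [^] n"
      using eq unfolding pw g(2) using g xc by simp
    then have "inv g \<otimes> x [^] m \<otimes> g \<in> H #> y [^] n"
      using rcos_self[OF _ subgroup_axioms, of "inv g \<otimes> x [^] m \<otimes> g"] g xc by simp
    then obtain h where "h \<in> H" "inv g \<otimes> x [^] m \<otimes> g = h \<otimes> y [^] n"
      by (auto simp: r_coset_def)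
    then have "x [^] m \<in> H" using disj[of x y g h m n] x y g by blast
    then show "x' [^]\<^bsub>G Mod H\<^esub> m = \<one>\<^bsub>G Mod H\<^esub>"
      unfolding pw by (simp add: rcos_const is_subgroup FactGroup_def)
  qed
qed

lemma (in group) conj_nat_pow:
  assumes "g \<in> carrier G" "x \<in> carrier G"
  shows "(inv g \<otimes> x \<otimes> g) [^] (n::nat) = inv g \<otimes> x [^] n \<otimes> g"
proof (induction n)
  case (Suc n)
  have "inv g \<otimes> x [^] n \<otimes> g \<otimes> (inv g \<otimes> x \<otimes> g) = inv g \<otimes> x [^] n \<otimes> (g \<otimes> inv g) \<otimes> x \<otimes> g"
    using assms by (simp only: m_assoc m_closed inv_closed nat_pow_closed)
  then show ?case using Suc assms by (simp add: m_assoc)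
qed (use assms in simp)

text \<open>The \<open>p\<close>-th power of a conjugate of \<open>x [^] m\<close> is trivial, so \<open>y [^] (n * p)\<close> lies in \<open>H\<close>. The hypothesis
  on \<open>y\<close> moves \<open>y [^] n\<close> and with it the conjugate of \<open>x [^] m\<close> into \<open>M\<close>, where powers of \<open>x\<close> are in \<open>H\<close>.\<close>

lemma (in normal) conj_power_mem:
  assumes M: "M \<lhd> G" "H \<subseteq> M"
    and x: "x \<in> carrier G" "x [^] p = \<one>" "x [^] m \<in> M \<Longrightarrow> x [^] m \<in> H"
    and y: "y \<in> carrier G" "y [^] (n * p) \<in> H \<Longrightarrow> y [^] n \<in> M"
    and g: "g \<in> carrier G" "h \<in> H" "inv g \<otimes> x [^] (m::nat) \<otimes> g = h \<otimes> y [^] (n::nat)"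
  shows "x [^] m \<in> H"
proof -
  interpret M: normal M G by (rule M(1))
  interpret Q: group "G Mod H" by (rule factorgroup_is_group)
  interpret hom: group_hom G "G Mod H" "\<lambda>x. H #> x"
    by unfold_locales (rule r_coset_hom_Mod)
  have h: "h \<in> carrier G" using g(2) subset by auto
  let ?z = "inv g \<otimes> x [^] m \<otimes> g"
  have "?z [^] p = inv g \<otimes> (x [^] p) [^] m \<otimes> g"
    using conj_nat_pow[OF g(1), of "x [^] m" p] x(1) by (simp add: nat_pow_pow mult.commute)
  also have "\<dots> = \<one>" using x g by simp
  finally have zp: "?z [^] p = \<one>" .
  have "H #> ?z = (H #> h) \<otimes>\<^bsub>G Mod H\<^esub> (H #> y [^] n)"
    unfolding g(3) using hom.hom_mult[of h "y [^] n"] h y(1) by simp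
  also have "H #> h = \<one>\<^bsub>G Mod H\<^esub>" using g(2) is_subgroup by (simp add: rcos_const FactGroup_def)
  also have "\<one>\<^bsub>G Mod H\<^esub> \<otimes>\<^bsub>G Mod H\<^esub> (H #> y [^] n) = H #> y [^] n"
    using y(1) by (intro Q.l_one hom.hom_closed nat_pow_closed)
  finally have "H #> ?z = H #> y [^] n" .
  then have "H #> (?z [^] p) = H #> ((y [^] n) [^] p)"
    using hom.hom_nat_pow[of ?z p] hom.hom_nat_pow[of "y [^] n" p] y(1) x(1) g(1) by simp
  then have "H #> (y [^] (n * p)) = H"
    unfolding zp using y(1) subset by (simp add: nat_pow_pow coset_mult_one)
  then have "y [^] (n * p) \<in> H"
    using rcos_self[OF _ subgroup_axioms, of "y [^] (n * p)"] y(1) by simp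
  then have "h \<otimes> y [^] n \<in> M" using y(2) g(2) M(2) by auto
  then have "inv (inv g) \<otimes> ?z \<otimes> inv g \<in> M"
    using M.inv_op_closed1[of "inv g" ?z] g by simp
  also have "inv (inv g) \<otimes> ?z \<otimes> inv g = x [^] m"
  proof -
    have "g \<otimes> (inv g \<otimes> x [^] m) = x [^] m"
      using g(1) x(1) by (simp add: m_assoc[symmetric])
    then show ?thesis using g(1) x(1) by (simp add: m_assoc)
  qed
  finally show ?thesis by (rule x(3))
qed

section \<open>Automorphisms with cyclic local action\<close>

lemma tree_aut_simps [simp]:
  "g \<otimes>\<^bsub>tree_aut p\<^esub> h = h \<circ> g" "\<one>\<^bsub>tree_aut p\<^esub> = id"
  by (simp_all add: tree_aut_def)

lemma tree_aut_nat_pow: "g [^]\<^bsub>tree_aut p\<^esub> (n::nat) = g ^^ n"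
  by (induction n) (simp_all add: nat_pow_def tree_aut_def fun_eq_iff funpow_swap1)

lemma tree_words_append: "u @ w \<in> tree_words p \<longleftrightarrow> u \<in> tree_words p \<and> w \<in> tree_words p"
  by (auto simp: tree_words_def)

lemma tree_aut_words:
  assumes "g \<in> carrier (tree_aut p)"
  shows "g w \<in> tree_words p \<longleftrightarrow> w \<in> tree_words p" "inj g" "surj g"
    "w \<in> tree_words p \<Longrightarrow> length (g w) = length w"
  using permutes_in_image[OF tree_autD(1)[OF assms]] permutes_inj[OF tree_autD(1)[OF assms]]
    permutes_surj[OF tree_autD(1)[OF assms]] tree_aut_snoc[OF assms]
  by auto

text \<open>The letter representing a residue class modulo \<open>p\<close>; the letter \<open>p\<close> plays the role of 0.\<close>

definition letter :: "nat \<Rightarrow> int \<Rightarrow> nat" where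
  "letter p z = nat ((z - 1) mod int p) + 1"

text \<open>The amount by which \<open>g\<close> rotates the letters following \<open>w\<close>, read off from the image of the first child
  of \<open>w\<close>. It is meaningful modulo \<open>p\<close> and for the automorphisms defined next.\<close>

definition rot :: "(nat list \<Rightarrow> nat list) \<Rightarrow> nat list \<Rightarrow> int" where
  "rot g w = int (last (g (w @ [1]))) - 1"

text \<open>The automorphisms acting below every vertex by a power of the cycle \<open>(1 2 ... p)\<close>; they form a Sylow
  pro-\<open>p\<close> subgroup of the automorphism group.\<close>

definition cyclic_aut :: "nat \<Rightarrow> (nat list \<Rightarrow> nat list) set" where
  "cyclic_aut p = {g \<in> carrier (tree_aut p).
     \<forall>w\<in>tree_words p. \<exists>c. \<forall>x\<in>{1..p}. g (w @ [x]) = g w @ [letter p (int x + c)]}"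

definition level :: "nat \<Rightarrow> nat \<Rightarrow> nat list set" where
  "level p n = {w \<in> tree_words p. length w = n}"

lemma level_0 [simp]: "level p 0 = {[]}"
  by (auto simp: level_def)

lemma level_Suc: "level p (Suc n) = (\<lambda>(w, x). w @ [x]) ` (level p n \<times> {1..p})"
proof
  show "level p (Suc n) \<subseteq> (\<lambda>(w, x). w @ [x]) ` (level p n \<times> {1..p})"
  proof
    fix v assume v: "v \<in> level p (Suc n)"
    then obtain w x where "v = w @ [x]" by (cases v rule: rev_cases) (auto simp: level_def)
    then show "v \<in> (\<lambda>(w, x). w @ [x]) ` (level p n \<times> {1..p})"
      using v by (force simp: level_def tree_words_snoc)
  qed
qed (auto simp: level_def tree_words_snoc)

lemma level_1: "level p (Suc 0) = (\<lambda>x. [x]) ` {1..p}"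
  using level_Suc[of p 0] by (auto simp: image_iff)

lemma level_2: "level p (Suc (Suc 0)) = (\<lambda>(x, y). [x, y]) ` ({1..p} \<times> {1..p})"
  by (force simp: level_Suc)

lemma finite_level: "finite (level p n)"
  by (induction n) (simp_all add: level_Suc)

lemma card_level: "card (level p n) = p ^ n"
proof (induction n)
  case (Suc n)
  have "inj_on (\<lambda>(w, x). w @ [x]) (level p n \<times> {1..p})" by (auto simp: inj_on_def)
  then show ?case using Suc by (simp add: level_Suc card_image card_cartesian_product)
qed simp

lemma tree_aut_bij_level:
  assumes "g \<in> carrier (tree_aut p)"
  shows "bij_betw g (level p n) (level p n)"
proof -
  have "g ` level p n \<subseteq> level p n" using tree_aut_words[OF assms] by (auto simp: level_def)
  moreover have "inj_on g (level p n)" using tree_aut_words(2)[OF assms] by (auto intro: inj_on_subset)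
  ultimately show ?thesis
    using endo_inj_surj[OF finite_level] by (auto simp: bij_betw_def)
qed

locale odd_prime_tree =
  fixes p :: nat
  assumes prime_p: "prime p" and odd_p: "odd p"
begin

abbreviation pcong :: "int \<Rightarrow> int \<Rightarrow> bool" (infix "=\<^sub>p" 50) where
  "a =\<^sub>p b \<equiv> [a = b] (mod int p)"

lemma p_pos: "p > 0" and p_gt2: "p > 2"
  using prime_p odd_p prime_gt_0_nat[of p] prime_ge_2_nat[of p] by (auto simp: le_less)

lemma prime_int_p: "prime (int p)" using prime_p by simp

lemma pcong_coprime: "\<not> c =\<^sub>p 0 \<Longrightarrow> coprime c (int p)"
  using prime_imp_coprime[OF prime_int_p, of c] by (simp add: cong_0_iff coprime_commute)

lemma pcong_mult_cancel: "\<not> c =\<^sub>p 0 \<Longrightarrow> c * a =\<^sub>p c * b \<longleftrightarrow> a =\<^sub>p b"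
  by (intro cong_mult_lcancel pcong_coprime)

lemma pcong_mult_0: "a * b =\<^sub>p 0 \<longleftrightarrow> a =\<^sub>p 0 \<or> b =\<^sub>p 0"
  using prime_int_p by (simp add: cong_0_iff prime_dvd_mult_iff)

lemma pcong_2_not_0: "\<not> 2 =\<^sub>p 0"
  using p_gt2 by (auto simp: cong_0_iff dest: zdvd_imp_le)

lemma pcong_inverse: "\<not> d =\<^sub>p 0 \<Longrightarrow> \<exists>n::nat. int n * d =\<^sub>p z"
proof -
  assume "\<not> d =\<^sub>p 0"
  then have "coprime d (int p)" by (rule pcong_coprime)
  then obtain c where "d * c =\<^sub>p 1" using cong_solve_coprime_int by blast
  then have "d * c * z =\<^sub>p 1 * z" by (rule cong_scalar_right)
  moreover have "int (nat ((c * z) mod int p)) * d =\<^sub>p c * z * d"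
    using p_pos by (intro cong_mult) (auto simp: cong_def)
  ultimately show ?thesis by (metis cong_trans mult.assoc mult.commute mult_1)
qed

lemma letter_range: "letter p z \<in> {1..p}"
proof -
  have "0 \<le> (z - 1) mod int p" "(z - 1) mod int p < int p" using p_pos by auto
  then show ?thesis by (auto simp: letter_def nat_less_iff Suc_le_eq)
qed

lemma letter_pcong: "int (letter p z) =\<^sub>p z"
proof -
  have "int (letter p z) = (z - 1) mod int p + 1" using p_pos by (simp add: letter_def)
  then show ?thesis by (simp add: cong_def mod_add_left_eq)
qed

lemma letter_cong: "a =\<^sub>p b \<Longrightarrow> letter p a = letter p b"
  using cong_diff[of a b "int p" 1 1] by (simp add: letter_def cong_def)

lemma letters_eq: "x \<in> {1..p} \<Longrightarrow> y \<in> {1..p} \<Longrightarrow> int x =\<^sub>p int y \<Longrightarrow> x = y"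
proof -
  assume xy: "x \<in> {1..p}" "y \<in> {1..p}" "int x =\<^sub>p int y"
  then have "int p dvd int x - int y" by (simp add: cong_iff_dvd_diff)
  moreover have "\<bar>int x - int y\<bar> < int p" using xy by auto
  ultimately show "x = y" using zdvd_imp_le[of "int p" "\<bar>int x - int y\<bar>"] by (cases "x = y") auto
qed

lemma letter_eqI: "x \<in> {1..p} \<Longrightarrow> int x =\<^sub>p z \<Longrightarrow> letter p z = x"
  by (rule letters_eq[OF letter_range]) (auto intro: cong_trans[OF letter_pcong] simp: cong_sym)

lemma letter_inject: "letter p a = letter p b \<longleftrightarrow> a =\<^sub>p b"
  by (metis cong_sym cong_trans letter_cong letter_pcong)

lemma letter_letter [simp]: "letter p (int (letter p a) + c) = letter p (a + c)"
  "letter p (c + int (letter p a)) = letter p (c + a)"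
  by (intro letter_cong cong_add letter_pcong cong_refl)+

lemma letter_int [simp]: "x \<in> {1..p} \<Longrightarrow> letter p (int x) = x"
  by (rule letter_eqI) auto

sublocale A: group "tree_aut p" by (rule group_tree_aut)

lemma cyclic_aut_closed: "g \<in> cyclic_aut p \<Longrightarrow> g \<in> carrier (tree_aut p)"
  by (simp add: cyclic_aut_def)

lemma rot_pcongI:
  assumes "g (w @ [1]) = g w @ [letter p (1 + c)]"
  shows "rot g w =\<^sub>p c"
  using cong_diff[OF letter_pcong[of "1 + c"] cong_refl[of 1]] assms by (simp add: rot_def)

lemma cyclic_aut_snoc:
  assumes "g \<in> cyclic_aut p" "w \<in> tree_words p" "x \<in> {1..p}"
  shows "g (w @ [x]) = g w @ [letter p (int x + rot g w)]"
proof -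
  obtain c where c: "\<And>x. x \<in> {1..p} \<Longrightarrow> g (w @ [x]) = g w @ [letter p (int x + c)]"
    using assms by (auto simp: cyclic_aut_def)
  have "rot g w =\<^sub>p c" using c[of 1] p_pos by (intro rot_pcongI) auto
  then have "letter p (int x + rot g w) = letter p (int x + c)" by (intro letter_cong cong_add) auto
  then show ?thesis using c assms by simp
qed

lemma cyclic_autI:
  assumes "g \<in> carrier (tree_aut p)"
    and "\<And>w x. w \<in> tree_words p \<Longrightarrow> x \<in> {1..p} \<Longrightarrow> g (w @ [x]) = g w @ [letter p (int x + c w)]"
  shows "g \<in> cyclic_aut p"
  using assms by (auto simp: cyclic_aut_def)

text \<open>The cocycle identity for rotations. The product is written as a composition, with \<open>g\<close> acting first.\<close>

lemma rot_mult:
  assumes "g \<in> cyclic_aut p" "h \<in> cyclic_aut p" "w \<in> tree_words p"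
  shows "rot (h \<circ> g) w =\<^sub>p rot g w + rot h (g w)"
  using p_pos tree_aut_words(1)[OF cyclic_aut_closed[OF assms(1)]] assms(3)
  by (intro rot_pcongI)
     (simp add: cyclic_aut_snoc[OF assms(1,3)] cyclic_aut_snoc[OF assms(2)] letter_range[simplified] ac_simps)

lemma rot_id [simp]: "rot id w = 0"
  by (simp add: rot_def)

lemma subgroup_cyclic_aut: "subgroup (cyclic_aut p) (tree_aut p)"
proof (rule A.subgroupI)
  show "cyclic_aut p \<subseteq> carrier (tree_aut p)" by (auto simp: cyclic_aut_def)
  have "id \<in> cyclic_aut p"
    using A.one_closed by (intro cyclic_autI[of id "\<lambda>_. 0"]) auto
  then show "cyclic_aut p \<noteq> {}" by blast
next
  fix g assume g: "g \<in> cyclic_aut p"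
  note gc = cyclic_aut_closed[OF g]
  let ?h = "inv\<^bsub>tree_aut p\<^esub> g"
  have h: "?h \<in> carrier (tree_aut p)" using gc by simp
  have gh: "g (?h w) = w" "?h (g w) = w" for w
    using A.l_inv[OF gc] A.r_inv[OF gc] by (simp_all add: fun_eq_iff)
  show "?h \<in> cyclic_aut p"
  proof (rule cyclic_autI[OF h])
    fix w x assume w: "w \<in> tree_words p" "x \<in> {1..p}"
    have "g (?h w @ [letter p (int x + - rot g (?h w))]) = w @ [x]"
      using w h tree_aut_words(1)[OF h]
      by (subst cyclic_aut_snoc[OF g]) (simp_all add: letter_range[simplified] gh)
    then show "?h (w @ [x]) = ?h w @ [letter p (int x + - rot g (?h w))]"
      using gh(2) by metis
  qed
next
  fix g h assume gh: "g \<in> cyclic_aut p" "h \<in> cyclic_aut p"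
  show "g \<otimes>\<^bsub>tree_aut p\<^esub> h \<in> cyclic_aut p"
  proof (rule cyclic_autI)
    show "g \<otimes>\<^bsub>tree_aut p\<^esub> h \<in> carrier (tree_aut p)"
      by (intro A.m_closed cyclic_aut_closed gh)
    fix w x assume w: "w \<in> tree_words p" "x \<in> {1..p}"
    show "(g \<otimes>\<^bsub>tree_aut p\<^esub> h) (w @ [x]) =
      (g \<otimes>\<^bsub>tree_aut p\<^esub> h) w @ [letter p (int x + (rot g w + rot h (g w)))]"
      using w tree_aut_words(1)[OF cyclic_aut_closed[OF gh(1)]]
      by (simp add: cyclic_aut_snoc[OF gh(1)] cyclic_aut_snoc[OF gh(2)] letter_range[simplified] ac_simps)
  qed
qed

lemma funpow_cyclic_aut: "g \<in> cyclic_aut p \<Longrightarrow> g ^^ n \<in> cyclic_aut p"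
proof (induction n)
  case 0
  then show ?case using subgroup.one_closed[OF subgroup_cyclic_aut] by (simp add: id_def)
next
  case (Suc n)
  then show ?case using subgroup.m_closed[OF subgroup_cyclic_aut, of "g ^^ n" g] by (simp add: o_def)
qed

lemma funpow_words:
  "g \<in> cyclic_aut p \<Longrightarrow> (g ^^ n) w \<in> tree_words p \<longleftrightarrow> w \<in> tree_words p"
  by (intro tree_aut_words(1) cyclic_aut_closed funpow_cyclic_aut)

lemma rot_funpow:
  assumes "g \<in> cyclic_aut p" "w \<in> tree_words p"
  shows "rot (g ^^ n) w =\<^sub>p (\<Sum>m<n. rot g ((g ^^ m) w))"
proof (induction n)
  case 0
  then show ?case by (simp add: rot_def)
next
  case (Suc n)
  have "rot (g ^^ Suc n) w =\<^sub>p rot (g ^^ n) w + rot g ((g ^^ n) w)"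
    using rot_mult[OF funpow_cyclic_aut assms(1,2), of g n] assms by (simp add: o_def)
  also have "rot (g ^^ n) w + rot g ((g ^^ n) w) =\<^sub>p (\<Sum>m<n. rot g ((g ^^ m) w)) + rot g ((g ^^ n) w)"
    by (intro cong_add Suc cong_refl)
  finally show ?case by (simp add: add.commute o_def)
qed

text \<open>Fixing a level is expressed by rotations, so that membership in level stabilisers becomes arithmetic modulo
  \<open>p\<close>.\<close>

lemma fixes_level_Suc:
  assumes "g \<in> cyclic_aut p"
  shows "(\<forall>w\<in>level p (Suc n). g w = w) \<longleftrightarrow>
    (\<forall>w\<in>level p n. g w = w) \<and> (\<forall>w\<in>level p n. rot g w =\<^sub>p 0)"
proof -
  have "(\<forall>x\<in>{1..p}. g (w @ [x]) = w @ [x]) \<longleftrightarrow> g w = w \<and> rot g w =\<^sub>p 0" if w: "w \<in> level p n" for w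
  proof -
    have ww: "w \<in> tree_words p" using w by (simp add: level_def)
    have *: "letter p (int x + rot g w) = x \<longleftrightarrow> rot g w =\<^sub>p 0" if "x \<in> {1..p}" for x
      using letter_inject[of "int x + rot g w" "int x"] that cong_add_lcancel_0[of "int x" "rot g w"]
      by simp
    show ?thesis
      using cyclic_aut_snoc[OF assms ww] * p_pos
      by (auto intro!: bexI[of _ 1])
  qed
  then show ?thesis by (auto simp: level_Suc)
qed

definition sum_rot :: "nat \<Rightarrow> (nat list \<Rightarrow> nat list) \<Rightarrow> int" where
  "sum_rot n g = (\<Sum>w\<in>level p n. rot g w)"

text \<open>Since \<open>g\<close> permutes the level, summing the cocycle identity over it gives a homomorphism to \<open>\<int>/p\<close>.\<close>

lemma sum_rot_mult:
  assumes "g \<in> cyclic_aut p" "h \<in> cyclic_aut p"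
  shows "sum_rot n (h \<circ> g) =\<^sub>p sum_rot n g + sum_rot n h"
proof -
  have "sum_rot n (h \<circ> g) =\<^sub>p (\<Sum>w\<in>level p n. rot g w + rot h (g w))"
    unfolding sum_rot_def by (intro cong_sum rot_mult assms) (simp add: level_def)
  also have "(\<Sum>w\<in>level p n. rot g w + rot h (g w)) = sum_rot n g + (\<Sum>w\<in>level p n. rot h (g w))"
    by (simp add: sum.distrib sum_rot_def)
  also have "(\<Sum>w\<in>level p n. rot h (g w)) = sum_rot n h"
    unfolding sum_rot_def
    by (rule sum.reindex_bij_betw[OF tree_aut_bij_level[OF cyclic_aut_closed[OF assms(1)]]])
  finally show ?thesis .
qed

end

section \<open>The rooted and the directed generators\<close>

lemma first_level_fixing_Cons:
  assumes "g \<in> level_stab p (carrier (tree_aut p)) 1" "x # w \<in> tree_words p"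
  shows "g (x # w) = x # tree_restr [x] g w"
proof -
  have "take 1 (g (x # w)) = [x]"
    using tree_aut_hd[of g p x w] assms by (auto simp: level_stab_def tree_words_Cons)
  then show ?thesis by (cases "g (x # w)") (auto simp: tree_restr_def)
qed

lemma rot_Cons:
  assumes "\<And>w. x # w \<in> tree_words p \<Longrightarrow> g (x # w) = x # s w"
    and "s \<in> carrier (tree_aut p)" "x # w \<in> tree_words p"
  shows "rot g (x # w) = rot s w"
proof -
  have "p > 0" using assms(3) by (auto simp: tree_words_def)
  then have *: "x # w @ [1] \<in> tree_words p" using assms(3) by (auto simp: tree_words_def)
  then have "length (s (w @ [1])) = Suc (length w)"
    using tree_aut_words(4)[OF assms(2), of "w @ [1]"] by (auto simp: tree_words_def)
  then have "s (w @ [1]) \<noteq> []" by auto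
  then show ?thesis using assms(1)[OF *] by (simp add: rot_def)
qed

context odd_prime_tree
begin

lemma rooted_a_Cons:
  "x # w \<in> tree_words p \<Longrightarrow> rooted_a p (x # w) = letter p (int x + 1) # w"
proof -
  assume "x # w \<in> tree_words p"
  moreover from this have x: "x \<in> {1..p}" by (simp add: tree_words_Cons)
  have "letter p (int x + 1) = (if x = p then 1 else x + 1)"
    using x p_gt2 by (intro letter_eqI) (auto simp: cong_iff_dvd_diff)
  ultimately show ?thesis by (simp add: rooted_a_def)
qed

lemma rooted_a_cyclic: "rooted_a p \<in> cyclic_aut p"
proof (rule cyclic_autI[OF rooted_a_closed[OF p_pos]])
  fix w x assume w: "w \<in> tree_words p" "x \<in> {1..p}"
  show "rooted_a p (w @ [x]) = rooted_a p w @ [letter p (int x + (if w = [] then 1 else 0))]"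
  proof (cases w)
    case Nil
    then show ?thesis using w rooted_a_Cons[of x "[]"] by (simp add: tree_words_Cons rooted_a_def)
  next
    case (Cons y v)
    then show ?thesis
      using w rooted_a_Cons[of y "v @ [x]"] rooted_a_Cons[of y v]
      by (simp add: tree_words_Cons tree_words_append)
  qed
qed

lemma rot_rooted_a: "w \<in> tree_words p \<Longrightarrow> rot (rooted_a p) w =\<^sub>p (if w = [] then 1 else 0)"
proof (cases w)
  case Nil
  then show ?thesis
    using rooted_a_Cons[of 1 "[]"] p_pos cong_diff[OF letter_pcong[of "2"] cong_refl[of 1]]
    by (simp add: tree_words_Cons rot_def)
next
  case (Cons y v)
  moreover assume "w \<in> tree_words p"
  ultimately show ?thesis
    using rooted_a_Cons[of y "v @ [1]"] p_pos by (simp add: tree_words_Cons tree_words_append rot_def)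
qed

lemma rooted_a_funpow_Cons:
  "x # w \<in> tree_words p \<Longrightarrow> (rooted_a p ^^ n) (x # w) = letter p (int x + int n) # w"
proof (induction n)
  case 0
  then show ?case by (simp add: tree_words_Cons)
next
  case (Suc n)
  then show ?case using rooted_a_Cons[of "letter p (int x + int n)" w] letter_range[of "int x + int n"]
    by (simp add: tree_words_Cons ac_simps)
qed

lemma funpow_outside: "g \<in> cyclic_aut p \<Longrightarrow> w \<notin> tree_words p \<Longrightarrow> (g ^^ n) w = w"
  using permutes_not_in[OF tree_autD(1)[OF cyclic_aut_closed]] by (induction n) auto

lemma rooted_a_order: "rooted_a p ^^ p = id"
proof
  fix w
  show "(rooted_a p ^^ p) w = id w"
  proof (cases "w \<in> tree_words p")
    case True
    show ?thesis
    proof (cases w)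
      case Nil
      have "(rooted_a p ^^ n) [] = []" for n by (induction n) (auto simp: rooted_a_def)
      then show ?thesis using Nil by simp
    next
      case (Cons x v)
      then have "letter p (int x + int p) = x"
        using True by (intro letter_eqI) (auto simp: tree_words_Cons cong_iff_dvd_diff)
      then show ?thesis using rooted_a_funpow_Cons[of x v p] True Cons by simp
    qed
  qed (simp add: funpow_outside[OF rooted_a_cyclic])
qed

lemma rot_rooted_a_funpow:
  assumes "w \<in> tree_words p"
  shows "rot (rooted_a p ^^ n) w =\<^sub>p (if w = [] then int n else 0)"
proof -
  have "rot (rooted_a p ^^ n) w =\<^sub>p (\<Sum>m<n. rot (rooted_a p) ((rooted_a p ^^ m) w))"
    by (rule rot_funpow[OF rooted_a_cyclic assms])
  also have "(\<Sum>m<n. rot (rooted_a p) ((rooted_a p ^^ m) w)) =\<^sub>p (\<Sum>m<n. if w = [] then 1 else 0)"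
  proof (rule cong_sum)
    fix m
    have "(rooted_a p ^^ m) w = [] \<longleftrightarrow> w = []"
      using rooted_a_funpow_Cons assms by (cases w; induction m) (auto simp: rooted_a_def)
    then show "rot (rooted_a p) ((rooted_a p ^^ m) w) =\<^sub>p (if w = [] then 1 else 0)"
      using rot_rooted_a[of "(rooted_a p ^^ m) w"] funpow_words[OF rooted_a_cyclic, of m w] assms by simp
  qed
  also have "(\<Sum>m<n. if w = [] then 1 else (0::int)) = (if w = [] then int n else 0)" by simp
  finally show ?thesis .
qed

text \<open>A directed automorphism with spine letter \<open>q\<close>: it fixes level 1, acts as itself below \<open>q\<close> and as a
  power of \<open>a\<close> below every other letter. The recursion is recorded down to level 2 only, because the action on
  level 3 depends on the rotations up to level 2.\<close>

definition directed :: "nat \<Rightarrow> (nat list \<Rightarrow> nat list) \<Rightarrow> bool" where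
  "directed q b \<longleftrightarrow> b \<in> cyclic_aut p \<and> b ^^ p = id \<and> q \<in> {1..p} \<and>
     rot b [] =\<^sub>p 0 \<and> rot b [q] =\<^sub>p 0 \<and>
     (\<forall>y\<in>{1..p}. rot b [q, y] =\<^sub>p rot b [y]) \<and>
     (\<forall>x\<in>{1..p}. \<forall>y\<in>{1..p}. x \<noteq> q \<longrightarrow> rot b [x, y] =\<^sub>p 0) \<and>
     (\<exists>x\<in>{1..p}. \<not> rot b [x] =\<^sub>p 0)"

text \<open>A defining vector as a function on \<open>\<int>/p\<close> with value 0 at 0. With this convention the level-1 rotations of
  a directed generator form a translate of its vector, the value 0 falling on the spine letter.\<close>

definition vec_entry :: "(nat \<Rightarrow> int) \<Rightarrow> int \<Rightarrow> int" where
  "vec_entry e z = (if z =\<^sub>p 0 then 0 else e (nat (z mod int p)))"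

lemma vec_entry_cong: "y =\<^sub>p z \<Longrightarrow> vec_entry e y = vec_entry e z"
  by (simp add: vec_entry_def cong_def)

lemma Fp_space_carrier:
  "e \<in> carrier (Fp_space p) \<longleftrightarrow> e \<in> {1..p-1} \<rightarrow>\<^sub>E {0..int p - 1}"
proof -
  interpret R: residues "int p" "Fp p" using p_gt2 by unfold_locales auto
  show ?thesis unfolding Fp_space_def R.func_space_def by (simp add: residue_ring_def)
qed

lemma Fp_space_zero: "\<zero>\<^bsub>Fp_space p\<^esub> = (\<lambda>k. if k \<in> {1..p-1} then 0 else undefined)"
proof -
  interpret R: residues "int p" "Fp p" using p_gt2 by unfold_locales auto
  show ?thesis unfolding Fp_space_def R.func_space_def by (auto simp: residue_ring_def)
qed

text \<open>In the defining tuple the exponents follow the entry \<open>b\<close> in cyclic order, starting with the first entry of the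
  vector, so the index of an exponent is the distance of its position from that of \<open>b\<close>.\<close>

lemma directed_b_section:
  assumes j: "j \<in> {1..p}" and x: "x \<in> {1..p}"
  shows "tree_restr [x] (directed_b p j e) =
    (if x = p - j + 1 then directed_b p j e
     else rooted_a p [^]\<^bsub>tree_aut p\<^esub> vec_entry e (int x - int (p - j + 1)))"
proof -
  let ?b = "directed_b p j e"
  have "tree_restr [x] ?b = psi p ?b ! (x - 1)" using x by (auto simp: psi_def simp del: upt_Suc)
  also have "\<dots> = directed_tuple p j e ?b ! (x - 1)"
    using directed_b(2)[OF p_pos j] by simp
  also have "\<dots> = (if x - 1 < p - j then rooted_a p [^]\<^bsub>tree_aut p\<^esub> e (j + x - 1)
      else if x - 1 = p - j then ?b else rooted_a p [^]\<^bsub>tree_aut p\<^esub> e (x - 1 - (p - j)))"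
    using j x by (auto simp: directed_tuple_def nth_append nth_Cons' Suc_diff_Suc)
  also have "\<dots> = (if x = p - j + 1 then ?b
     else rooted_a p [^]\<^bsub>tree_aut p\<^esub> vec_entry e (int x - int (p - j + 1)))"
  proof -
    have "vec_entry e (int x - int (p - j + 1)) = e (j + x - 1)" if "x - 1 < p - j"
    proof -
      have "(int x - int (p - j + 1)) mod int p = int (j + x - 1) mod int p"
        using that j x by (intro cong_def[THEN iffD1]) (auto simp: cong_iff_dvd_diff of_nat_diff)
      also have "\<dots> = int (j + x - 1)" using that j x by (intro mod_pos_pos_trivial) auto
      finally have m: "(int x - int (p - j + 1)) mod int p = int (j + x - 1)" .
      have "j + x - 1 \<noteq> 0" using j x by auto
      then show ?thesis unfolding vec_entry_def cong_def m nat_int by simp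
    qed
    moreover have "vec_entry e (int x - int (p - j + 1)) = e (x - 1 - (p - j))" if "x - 1 > p - j"
    proof -
      have m: "(int x - int (p - j + 1)) mod int p = int (x - 1 - (p - j))"
        using that j x by (subst mod_pos_pos_trivial) auto
      have "x - 1 - (p - j) \<noteq> 0" using that by auto
      then show ?thesis unfolding vec_entry_def cong_def m nat_int by simp
    qed
    ultimately show ?thesis using x j by auto
  qed
  finally show ?thesis .
qed

lemma
  assumes j: "j \<in> {1..p}" and e: "e \<in> carrier (Fp_space p)"
  defines "b \<equiv> directed_b p j e" and "q \<equiv> p - j + 1"
  shows directed_b_rot: "x \<in> {1..p} \<Longrightarrow> rot b [x] =\<^sub>p vec_entry e (int x - int q)"
    and directed_directed_b: "e \<noteq> \<zero>\<^bsub>Fp_space p\<^esub> \<Longrightarrow> directed q b"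
proof -
  let ?a = "rooted_a p"
  have q: "q \<in> {1..p}" using j by (auto simp: q_def)
  define c where "c = (\<lambda>x. nat (vec_entry e (int x - int q)))"
  have nonneg: "vec_entry e z \<ge> 0" for z
  proof -
    have "nat (z mod int p) \<in> {1..p-1}" if "\<not> z =\<^sub>p 0"
    proof -
      have "z mod int p \<noteq> 0" "0 \<le> z mod int p" "z mod int p < int p" using that p_pos by (auto simp: cong_def)
      then show ?thesis by auto
    qed
    then show ?thesis using e unfolding Fp_space_carrier by (fastforce simp: vec_entry_def)
  qed
  then have c: "int (c x) = vec_entry e (int x - int q)" for x by (simp add: c_def)
  have st: "b \<in> level_stab p (carrier (tree_aut p)) 1" unfolding b_def by (rule directed_b(1)[OF p_pos j])
  then have bc: "b \<in> carrier (tree_aut p)" by (simp add: level_stab_def)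
  have b_q: "b (q # w) = q # b w" if "q # w \<in> tree_words p" for w
    using first_level_fixing_Cons[OF st that] directed_b_section[OF j q, of e]
    by (simp add: b_def q_def)
  have b_x: "b (x # w) = x # (?a ^^ c x) w" if "x # w \<in> tree_words p" "x \<noteq> q" for x w
  proof -
    have "?a [^]\<^bsub>tree_aut p\<^esub> vec_entry e (int x - int q) = ?a ^^ c x"
      by (simp only: c[symmetric] int_pow_int tree_aut_nat_pow)
    then show ?thesis using first_level_fixing_Cons[OF st that(1)] directed_b_section[OF j, of x e] that
      by (simp add: b_def q_def tree_words_Cons)
  qed
  have "\<exists>z. \<forall>x\<in>{1..p}. b (w @ [x]) = b w @ [letter p (int x + z)]" if "w \<in> tree_words p" for w
    using that
  proof (induction w)
    case Nil
    then show ?case using st tree_autD(2)[OF bc]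
      by (intro exI[of _ 0]) (auto simp: level_stab_def tree_words_Cons letter_int[simplified])
  next
    case (Cons y w)
    then have yw: "y \<in> {1..p}" "w \<in> tree_words p" by (auto simp: tree_words_Cons)
    show ?case
    proof (cases "y = q")
      case True
      then show ?thesis using Cons.IH[OF yw(2)] b_q Cons.prems by (simp add: tree_words_Cons tree_words_append)
    next
      case False
      have "\<forall>x\<in>{1..p}. b ((y # w) @ [x]) = b (y # w) @ [letter p (int x + rot (?a ^^ c y) w)]"
        using cyclic_aut_snoc[OF funpow_cyclic_aut[OF rooted_a_cyclic] yw(2)] b_x False yw
        by (auto simp: tree_words_Cons tree_words_append)
      then show ?thesis by blast
    qed
  qed
  then have b: "b \<in> cyclic_aut p" using bc by (simp add: cyclic_aut_def)
  have "b [1] = [1]" using st p_pos by (auto simp: level_stab_def tree_words_Cons)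
  then have rot0: "rot b [] = 0" by (simp add: rot_def)
  have rotq: "rot b (q # w) = rot b w" if "w \<in> tree_words p" for w
    by (rule rot_Cons[OF b_q bc]) (use that q in \<open>auto simp: tree_words_Cons\<close>)
  have rotx: "rot b (x # w) =\<^sub>p (if w = [] then int (c x) else 0)"
    if "x \<in> {1..p}" "w \<in> tree_words p" "x \<noteq> q" for x w
    using rot_rooted_a_funpow[OF that(2), of "c x"]
      rot_Cons[OF b_x[OF _ that(3)] cyclic_aut_closed[OF funpow_cyclic_aut[OF rooted_a_cyclic]], where w=w] that
    by (simp add: tree_words_Cons)
  show rot1: "rot b [x] =\<^sub>p vec_entry e (int x - int q)" if "x \<in> {1..p}" for x
  proof (cases "x = q")
    case True
    then show ?thesis using rotq[of "[]"] rot0 by (simp add: vec_entry_def)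
  next
    case False
    then show ?thesis using rotx[of x "[]"] that c[of x] by simp
  qed
  \<comment> \<open>A section of the \<open>p\<close>-th power is the \<open>p\<close>-th power of a power of \<open>a\<close>, or the \<open>p\<close>-th power itself.\<close>
  have ord: "(b ^^ p) w = w" if "w \<in> tree_words p" for w
    using that
  proof (induction w)
    case Nil
    have "(b ^^ n) [] = []" for n by (induction n) (auto simp: tree_autD(2)[OF bc])
    then show ?case by simp
  next
    case (Cons x w)
    then have xw: "x \<in> {1..p}" "w \<in> tree_words p" by (auto simp: tree_words_Cons)
    show ?case
    proof (cases "x = q")
      case True
      have "(b ^^ n) (q # w) = q # (b ^^ n) w" for n
        using funpow_words[OF b] xw q by (induction n) (auto simp: tree_words_Cons b_q)
      then show ?thesis using Cons True xw by simp
    next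
      case False
      have *: "(b ^^ n) (x # w) = x # ((?a ^^ c x) ^^ n) w" for n
        using funpow_words[OF funpow_cyclic_aut[OF rooted_a_cyclic]] xw False
        by (induction n) (auto simp: tree_words_Cons b_x)
      have "(?a ^^ c x) ^^ p = (?a ^^ p) ^^ c x" by (simp only: funpow_mult mult.commute)
      also have "\<dots> = id" by (simp add: rooted_a_order id_funpow)
      finally show ?thesis using * by simp
    qed
  qed
  have ord: "b ^^ p = id"
  proof
    fix w show "(b ^^ p) w = id w"
      using ord[of w] funpow_outside[OF b, of w p] by (cases "w \<in> tree_words p") auto
  qed
  show "directed q b" if ne: "e \<noteq> \<zero>\<^bsub>Fp_space p\<^esub>"
  proof -
    have "\<exists>k\<in>{1..p-1}. e k \<noteq> 0"
    proof (rule ccontr)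
      assume "\<not> ?thesis"
      then have "e k = (\<zero>\<^bsub>Fp_space p\<^esub>) k" for k
        using e unfolding Fp_space_carrier Fp_space_zero
        by (cases "k \<in> {1..p-1}") (auto simp: PiE_def extensional_def)
      then show False using ne by auto
    qed
    then obtain k where k: "k \<in> {1..p-1}" "e k \<noteq> 0" by blast
    define x where "x = letter p (int q + int k)"
    have "int x =\<^sub>p int q + int k" unfolding x_def by (rule letter_pcong)
    then have "int x - int q =\<^sub>p int k" using cong_diff[of "int x" "int q + int k" "int p" "int q" "int q"] by simp
    then have "vec_entry e (int x - int q) = vec_entry e (int k)" by (rule vec_entry_cong)
    also have "\<dots> = e k" using k nat_dvd_not_less[of k p] by (auto simp: vec_entry_def cong_def mod_pos_pos_trivial)
    finally have "rot b [x] =\<^sub>p e k" using rot1[of x] letter_range by (simp add: x_def)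
    moreover have "\<not> e k =\<^sub>p 0"
    proof -
      have "0 \<le> e k" "e k < int p" using e k(1) unfolding Fp_space_carrier by fastforce+
      then show ?thesis using k(2) by (simp add: cong_def)
    qed
    ultimately have "\<exists>x\<in>{1..p}. \<not> rot b [x] =\<^sub>p 0"
      using letter_range[of "int q + int k"] cong_trans cong_sym unfolding x_def by blast
    then show ?thesis
      unfolding directed_def using b ord q rot0 rotq rotx[where w="[_]"]
      by (auto simp: tree_words_Cons)
  qed
qed

end

section \<open>Orbits and deep elements\<close>

definition fixes_level :: "nat \<Rightarrow> nat \<Rightarrow> (nat list \<Rightarrow> nat list) \<Rightarrow> bool" where
  "fixes_level p n g \<longleftrightarrow> (\<forall>w\<in>level p n. g w = w)"

lemma level_stab_fixes_level: "level_stab p G n = {g \<in> G. fixes_level p n g}"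
  by (auto simp: level_stab_def fixes_level_def level_def)

context odd_prime_tree
begin

lemma pcong_0_iff: "a =\<^sub>p b \<Longrightarrow> a =\<^sub>p 0 \<longleftrightarrow> b =\<^sub>p 0"
  by (simp add: cong_def)

abbreviation "fixlev \<equiv> fixes_level p"

lemma fixlev_Suc:
  "g \<in> cyclic_aut p \<Longrightarrow> fixlev (Suc n) g \<longleftrightarrow> fixlev n g \<and> (\<forall>w\<in>level p n. rot g w =\<^sub>p 0)"
  unfolding fixes_level_def by (rule fixes_level_Suc)

lemma fixlev_2: "g \<in> cyclic_aut p \<Longrightarrow> fixlev 2 g \<longleftrightarrow> fixlev 1 g \<and> (\<forall>x\<in>{1..p}. rot g [x] =\<^sub>p 0)"
  using fixlev_Suc[of g 1] by (simp add: level_1 numeral_2_eq_2)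

lemma fixlev_3: "g \<in> cyclic_aut p \<Longrightarrow> fixlev 3 g \<longleftrightarrow> fixlev 2 g \<and> (\<forall>w\<in>level p 2. rot g w =\<^sub>p 0)"
  using fixlev_Suc[of g 2] by (simp add: eval_nat_numeral)

lemma fixlev_mono: "g \<in> cyclic_aut p \<Longrightarrow> fixlev n g \<Longrightarrow> m \<le> n \<Longrightarrow> fixlev m g"
proof (induction n)
  case (Suc n)
  then show ?case using fixlev_Suc[of g n] by (cases "m = Suc n") auto
qed simp

lemma fixlev_0: "g \<in> cyclic_aut p \<Longrightarrow> fixlev 0 g"
  using tree_autD(2)[OF cyclic_aut_closed] by (simp add: fixes_level_def)

lemma funpow_fixed: "g w = w \<Longrightarrow> (g ^^ n) w = w"
  by (induction n) auto

lemma fixlev_funpow: "fixlev n g \<Longrightarrow> fixlev n (g ^^ m)"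
  by (simp add: fixes_level_def funpow_fixed)

lemma rot_funpow_fixed:
  assumes "g \<in> cyclic_aut p" "w \<in> tree_words p" "g w = w"
  shows "rot (g ^^ n) w =\<^sub>p int n * rot g w"
  using rot_funpow[OF assms(1,2), of n] funpow_fixed[of g w, OF assms(3)] by simp

lemma action_level_1:
  assumes "g \<in> cyclic_aut p" "x \<in> {1..p}"
  shows "g [x] = [letter p (int x + rot g [])]"
  using cyclic_aut_snoc[OF assms(1), of "[]" x] assms tree_autD(2)[OF cyclic_aut_closed[OF assms(1)]]
  by simp

lemma action_level_2:
  assumes "g \<in> cyclic_aut p" "x \<in> {1..p}" "y \<in> {1..p}"
  shows "g [x, y] = [letter p (int x + rot g []), letter p (int y + rot g [x])]"
  using cyclic_aut_snoc[OF assms(1), of "[x]" y] assms action_level_1[OF assms(1,2)]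
  by (simp add: tree_words_Cons)

lemma rot_nat_mult_0: "\<not> c =\<^sub>p 0 \<Longrightarrow> int n * c =\<^sub>p 0 \<longleftrightarrow> p dvd n"
  by (simp add: pcong_mult_0) (simp add: cong_0_iff)

lemma letter_fixed: "x \<in> {1..p} \<Longrightarrow> letter p (int x + c) = x \<longleftrightarrow> c =\<^sub>p 0"
  using letter_inject[of "int x + c" "int x"] cong_add_lcancel_0[of "int x" c] by simp

lemma funpow_level_1:
  assumes "g \<in> cyclic_aut p" "x \<in> {1..p}"
  shows "(g ^^ n) [x] = [letter p (int x + int n * rot g [])]"
proof -
  have "rot (g ^^ n) [] =\<^sub>p int n * rot g []"
    using tree_autD(2)[OF cyclic_aut_closed[OF assms(1)]] by (intro rot_funpow_fixed assms) auto
  then show ?thesis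
    using action_level_1[OF funpow_cyclic_aut[OF assms(1)] assms(2), of n]
    by (simp add: letter_inject cong_add_lcancel)
qed

text \<open>If the orbit of \<open>w\<close> is as long as possible, it is the whole level.\<close>

lemma orbit_sum_level:
  assumes g: "g \<in> cyclic_aut p" and w: "w \<in> level p n"
    and free: "\<And>m. (g ^^ m) w = w \<Longrightarrow> p ^ n dvd m"
  shows "(\<Sum>m<p ^ n. F ((g ^^ m) w)) = (\<Sum>v\<in>level p n. F v)"
proof -
  have inj: "inj_on (\<lambda>m. (g ^^ m) w) {..<p ^ n}"
  proof (rule linorder_inj_onI)
    fix k m :: nat assume km: "k < m" "k \<in> {..<p ^ n}" "m \<in> {..<p ^ n}"
    show "(g ^^ k) w \<noteq> (g ^^ m) w"
    proof
      assume "(g ^^ k) w = (g ^^ m) w"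
      then have "(g ^^ k) w = (g ^^ k) ((g ^^ (m - k)) w)"
        using km(1) funpow_add[of k "m - k" g] by simp
      then have "w = (g ^^ (m - k)) w"
        by (rule injD[OF tree_aut_words(2)[OF cyclic_aut_closed[OF funpow_cyclic_aut[OF g]]]])
      then have "p ^ n dvd m - k" using free[of "m - k"] by simp
      moreover have "0 < m - k" "m - k < p ^ n" using km by auto
      ultimately show False using nat_dvd_not_less by blast
    qed
  qed auto
  have "(\<lambda>m. (g ^^ m) w) ` {..<p ^ n} \<subseteq> level p n"
    using w bij_betw_apply[OF tree_aut_bij_level[OF cyclic_aut_closed[OF funpow_cyclic_aut[OF g]]]]
    by blast
  then have "(\<lambda>m. (g ^^ m) w) ` {..<p ^ n} = level p n"
    using inj by (intro card_subset_eq) (simp_all add: finite_level card_level card_image)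
  then have "bij_betw (\<lambda>m. (g ^^ m) w) {..<p ^ n} (level p n)" using inj by (simp add: bij_betw_def)
  then show ?thesis by (rule sum.reindex_bij_betw)
qed

text \<open>An element that moves level 1 visits each of its vertices exactly once in \<open>p\<close> steps, so that every vertex
  collects the same total rotation.\<close>

lemma rot_power_p:
  assumes g: "g \<in> cyclic_aut p" "\<not> rot g [] =\<^sub>p 0" and x: "x \<in> {1..p}"
  shows "rot (g ^^ p) [x] =\<^sub>p sum_rot 1 g"
proof -
  have "rot (g ^^ p) [x] =\<^sub>p (\<Sum>m<p. rot g ((g ^^ m) [x]))"
    using x by (intro rot_funpow g) (auto simp: tree_words_Cons)
  also have "(\<Sum>m<p. rot g ((g ^^ m) [x])) = sum_rot 1 g"
  proof -
    have "p ^ 1 dvd m" if "(g ^^ m) [x] = [x]" for m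
      using that letter_fixed[OF x] rot_nat_mult_0[OF g(2), of m] funpow_level_1[OF g(1) x, of m] by simp
    then show ?thesis
      using orbit_sum_level[OF g(1), of "[x]" 1 "rot g"] x
      by (simp add: level_1 sum_rot_def)
  qed
  finally show ?thesis .
qed

lemma fixlev_1_iff: "g \<in> cyclic_aut p \<Longrightarrow> fixlev 1 g \<longleftrightarrow> rot g [] =\<^sub>p 0"
  by (simp add: fixlev_Suc fixlev_0)

lemma fixlev_1_funpow:
  assumes "g \<in> cyclic_aut p" "\<not> rot g [] =\<^sub>p 0"
  shows "fixlev 1 (g ^^ n) \<longleftrightarrow> p dvd n"
  unfolding fixlev_1_iff[OF funpow_cyclic_aut[OF assms(1)]]
  using pcong_0_iff[OF rot_funpow_fixed[OF assms(1) tree_words_Nil, of n]] rot_nat_mult_0[OF assms(2)]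
    tree_autD(2)[OF cyclic_aut_closed[OF assms(1)]]
  by simp

text \<open>In every quotient acting on level 3 or deeper, the subgroup of order \<open>p\<close> of the cyclic group generated by a
  deep element fixes level 2. The generators of a multi-EGS group have order \<open>p\<close> and act faithfully on level 2,
  so none of their conjugates meets such a subgroup.\<close>

definition deep :: "(nat list \<Rightarrow> nat list) \<Rightarrow> bool" where
  "deep g \<longleftrightarrow> \<not> fixlev 3 g \<and> (\<forall>n. fixlev 3 (g ^^ (n * p)) \<longrightarrow> fixlev 2 (g ^^ n))"

text \<open>The orbits of \<open>g\<close> on level 1 and on level 2 have full length, and \<open>g ^^ p ^ 2\<close> has the rotation
  \<open>sum_rot 2 g\<close> everywhere on level 2. Hence for \<open>n\<close> \<open>\<le>\<close> 3 a power \<open>g ^^ m\<close> fixes level \<open>n\<close> only if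
  \<open>p ^ n\<close> divides \<open>m\<close>.\<close>

lemma deep_if_sums_nonzero:
  assumes g: "g \<in> cyclic_aut p" "\<not> rot g [] =\<^sub>p 0" "\<not> sum_rot 1 g =\<^sub>p 0" "\<not> sum_rot 2 g =\<^sub>p 0"
  shows "deep g"
proof -
  note gn = funpow_cyclic_aut[OF g(1)]
  have fixed2: "p ^ 2 dvd m" if fx: "(g ^^ m) [x, y] = [x, y]" and xy: "x \<in> {1..p}" "y \<in> {1..p}" for m x y
  proof -
    have "[letter p (int x + rot (g ^^ m) []), letter p (int y + rot (g ^^ m) [x])] = [x, y]"
      by (rule trans[OF action_level_2[OF gn xy, symmetric] fx])
    then have rots: "rot (g ^^ m) [] =\<^sub>p 0" "rot (g ^^ m) [x] =\<^sub>p 0"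
      by (simp_all only: list.inject letter_fixed[OF xy(1)] letter_fixed[OF xy(2)])
    from rots(1) have "p dvd m" using fixlev_1_funpow[OF g(1,2)] fixlev_1_iff[OF gn] by simp
    then obtain k where k: "m = p * k" by blast
    have "(g ^^ p) [x] = [x]"
      using fixlev_1_funpow[OF g(1,2), of p] xy by (simp add: fixes_level_def level_1)
    then have "rot ((g ^^ p) ^^ k) [x] =\<^sub>p int k * rot (g ^^ p) [x]"
      using xy by (intro rot_funpow_fixed gn) (auto simp: tree_words_Cons)
    also have "int k * rot (g ^^ p) [x] =\<^sub>p int k * sum_rot 1 g"
      by (intro cong_mult cong_refl rot_power_p g xy)
    finally have "rot (g ^^ m) [x] =\<^sub>p int k * sum_rot 1 g"
      by (simp add: k funpow_mult)
    then have "p dvd k" using rot_nat_mult_0[OF g(3)] pcong_0_iff rots(2) by blast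
    then show ?thesis by (auto simp: k power2_eq_square)
  qed
  have fix2: "fixlev 2 (g ^^ m) \<longleftrightarrow> p ^ 2 dvd m" for m
  proof
    assume "fixlev 2 (g ^^ m)"
    moreover have "[1, 1] \<in> level p 2" using p_pos by (auto simp: level_def tree_words_def)
    ultimately show "p ^ 2 dvd m" using fixed2[of m 1 1] p_pos by (auto simp: fixes_level_def)
  next
    assume "p ^ 2 dvd m"
    then obtain k where k: "m = p ^ 2 * k" by blast
    have fp: "fixlev 1 (g ^^ p)" using fixlev_1_funpow[OF g(1,2), of p] by simp
    have "rot (g ^^ (p * p)) [x] =\<^sub>p 0" if x: "x \<in> {1..p}" for x
    proof -
      have "rot ((g ^^ p) ^^ p) [x] =\<^sub>p int p * rot (g ^^ p) [x]"
        using fp x by (intro rot_funpow_fixed gn) (auto simp: fixes_level_def level_1 tree_words_Cons)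
      then show ?thesis by (simp add: funpow_mult cong_def)
    qed
    then have "fixlev 2 (g ^^ (p * p))"
      using fixlev_funpow[OF fp, of p] by (simp add: fixlev_2[OF gn] funpow_mult)
    then have "fixlev 2 (g ^^ (p ^ 2))" by (simp add: power2_eq_square)
    then show "fixlev 2 (g ^^ m)" unfolding k using fixlev_funpow[of 2 "g ^^ p\<^sup>2" k] by (simp only: funpow_mult)
  qed
  have rot2: "rot (g ^^ (p ^ 2)) w =\<^sub>p sum_rot 2 g" if w: "w \<in> level p 2" for w
  proof -
    obtain x y where xy: "w = [x, y]" "x \<in> {1..p}" "y \<in> {1..p}"
      using w by (auto simp: numeral_2_eq_2 level_2)
    have "rot (g ^^ (p ^ 2)) w =\<^sub>p (\<Sum>m<p ^ 2. rot g ((g ^^ m) w))"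
      using w by (intro rot_funpow g) (auto simp: level_def)
    also have "(\<Sum>m<p ^ 2. rot g ((g ^^ m) w)) = sum_rot 2 g"
      unfolding sum_rot_def using fixed2 xy by (intro orbit_sum_level g w) auto
    finally show ?thesis .
  qed
  have fix3: "p ^ 3 dvd m" if f3: "fixlev 3 (g ^^ m)" for m
  proof -
    have f: "fixlev 2 (g ^^ m)" "\<forall>w\<in>level p 2. rot (g ^^ m) w =\<^sub>p 0"
      using f3 by (simp_all add: fixlev_3[OF gn])
    then obtain k where k: "m = p ^ 2 * k" using fix2 by blast
    have w: "[1, 1] \<in> level p 2" using p_pos by (auto simp: level_def tree_words_def)
    then have "rot ((g ^^ p ^ 2) ^^ k) [1, 1] =\<^sub>p int k * rot (g ^^ p ^ 2) [1, 1]"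
      using fix2[of "p ^ 2"] by (intro rot_funpow_fixed gn) (auto simp: fixes_level_def level_def)
    also have "int k * rot (g ^^ p ^ 2) [1, 1] =\<^sub>p int k * sum_rot 2 g"
      by (intro cong_mult cong_refl rot2 w)
    finally have "int k * sum_rot 2 g =\<^sub>p 0"
      using f(2) w pcong_0_iff unfolding k funpow_mult by blast
    then have "p dvd k" using rot_nat_mult_0[OF g(4)] by simp
    then show ?thesis by (auto simp: k power2_eq_square power3_eq_cube)
  qed
  show ?thesis
    unfolding deep_def
  proof (intro conjI allI impI)
    have "\<not> p ^ 3 dvd 1" using p_gt2 by simp
    then show "\<not> fixlev 3 g" using fix3[of 1] by auto
    fix n assume "fixlev 3 (g ^^ (n * p))"
    then have "p ^ 2 * p dvd n * p" using fix3 by (simp add: power3_eq_cube power2_eq_square)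
    then have "p ^ 2 dvd n" using p_pos by simp
    then show "fixlev 2 (g ^^ n)" by (simp add: fix2)
  qed
qed

text \<open>When the rotations on level 1 sum to zero, \<open>g ^^ p\<close> fixes level 2. If it moves level 3, then
  \<open>g\<close> has order \<open>p ^ 2\<close> on level 3.\<close>

lemma deep_if_power_p_nontrivial:
  assumes g: "g \<in> cyclic_aut p" "\<not> rot g [] =\<^sub>p 0" "sum_rot 1 g =\<^sub>p 0"
    and ne: "\<not> fixlev 3 (g ^^ p)"
  shows "deep g"
proof -
  note gn = funpow_cyclic_aut[OF g(1)]
  have fp2: "fixlev 2 (g ^^ p)"
    using fixlev_1_funpow[OF g(1,2), of p] pcong_0_iff[OF rot_power_p[OF g(1,2)]] g(3)
    by (simp add: fixlev_2[OF gn])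
  then obtain w where w: "w \<in> level p 2" "\<not> rot (g ^^ p) w =\<^sub>p 0"
    using ne by (auto simp: fixlev_3[OF gn])
  show ?thesis
    unfolding deep_def
  proof (intro conjI allI impI)
    show "\<not> fixlev 3 g" using ne fixlev_funpow by blast
    fix n assume "fixlev 3 (g ^^ (n * p))"
    then have "rot (g ^^ (n * p)) w =\<^sub>p 0"
      using w(1) by (simp add: fixlev_3[OF gn])
    moreover have "rot ((g ^^ p) ^^ n) w =\<^sub>p int n * rot (g ^^ p) w"
      using fp2 w(1) by (intro rot_funpow_fixed gn) (auto simp: fixes_level_def level_def)
    ultimately have "int n * rot (g ^^ p) w =\<^sub>p 0"
      using pcong_0_iff by (simp only: funpow_mult mult.commute[of n p])
    then obtain k where "n = p * k" using rot_nat_mult_0[OF w(2)] by auto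
    then show "fixlev 2 (g ^^ n)" using fixlev_funpow[OF fp2, of k] by (simp add: funpow_mult)
  qed
qed

end

section \<open>Groups generated by the rooted and directed automorphisms\<close>

lemma finite_image_factor:
  assumes "finite (r ` S)" "\<And>x y. x \<in> S \<Longrightarrow> y \<in> S \<Longrightarrow> r x = r y \<Longrightarrow> f x = f y"
  shows "finite (f ` S)"
proof -
  have "f ` S \<subseteq> (\<lambda>v. f (SOME x. x \<in> S \<and> r x = v)) ` (r ` S)"
  proof
    fix z assume "z \<in> f ` S"
    then obtain x where x: "x \<in> S" "z = f x" by blast
    have "(SOME y. y \<in> S \<and> r y = r x) \<in> S \<and> r (SOME y. y \<in> S \<and> r y = r x) = r x"
      by (rule someI[of _ x]) (use x in simp)
    then have "z = f (SOME y. y \<in> S \<and> r y = r x)" using assms(2)[of x "SOME y. y \<in> S \<and> r y = r x"] x by simp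
    then show "z \<in> (\<lambda>v. f (SOME x. x \<in> S \<and> r x = v)) ` (r ` S)" using x(1) by blast
  qed
  then show ?thesis using assms(1) finite_subset by blast
qed

locale directed_group = odd_prime_tree +
  fixes B :: "(nat list \<Rightarrow> nat list) set"
  assumes B_ne: "B \<noteq> {}"
    and B_directed: "b \<in> B \<Longrightarrow> \<exists>q. directed q b"
begin

definition G :: "(nat list \<Rightarrow> nat list) set" where
  "G = generate (tree_aut p) (insert (rooted_a p) B)"

abbreviation GG :: "(nat list \<Rightarrow> nat list) monoid" where
  "GG \<equiv> (tree_aut p)\<lparr>carrier := G\<rparr>"

lemma gens_cyclic: "insert (rooted_a p) B \<subseteq> cyclic_aut p"
  using rooted_a_cyclic B_directed by (auto simp: directed_def)

lemma subgroup_G: "subgroup G (tree_aut p)"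
  unfolding G_def using gens_cyclic cyclic_aut_closed by (intro A.generate_is_subgroup) blast

sublocale GG: group GG
  by (rule A.subgroup_imp_group[OF subgroup_G])

lemma G_cyclic: "g \<in> G \<Longrightarrow> g \<in> cyclic_aut p"
  using A.generate_subgroup_incl[OF gens_cyclic subgroup_cyclic_aut] by (auto simp: G_def)

lemma gens_in_G: "rooted_a p \<in> G" "b \<in> B \<Longrightarrow> b \<in> G"
  by (auto simp: G_def intro: generate.incl)

lemma comp_in_G: "g \<in> G \<Longrightarrow> h \<in> G \<Longrightarrow> h \<circ> g \<in> G"
  using subgroup.m_closed[OF subgroup_G, of g h] by simp

lemma GG_simps: "g \<otimes>\<^bsub>GG\<^esub> h = h \<circ> g" "\<one>\<^bsub>GG\<^esub> = id" "g [^]\<^bsub>GG\<^esub> (n::nat) = g ^^ n"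
proof -
  show "g \<otimes>\<^bsub>GG\<^esub> h = h \<circ> g" "\<one>\<^bsub>GG\<^esub> = id" by simp_all
  show "g [^]\<^bsub>GG\<^esub> n = g ^^ n"
    by (induction n) simp_all
qed

lemma generate_GG: "S \<subseteq> G \<Longrightarrow> generate GG S = generate (tree_aut p) S"
  by (rule A.generate_consistent[OF _ subgroup_G])

lemma generate_eq_G:
  assumes "S \<subseteq> G" "rooted_a p \<in> generate (tree_aut p) S" "B \<subseteq> generate (tree_aut p) S"
  shows "generate GG S = G"
proof -
  have S: "S \<subseteq> carrier (tree_aut p)" using assms(1) G_cyclic cyclic_aut_closed by blast
  have "G \<subseteq> generate (tree_aut p) S"
    unfolding G_def using assms(2,3) A.generate_is_subgroup[OF S]
    by (intro A.generate_subgroup_incl) auto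
  moreover have "generate (tree_aut p) S \<subseteq> G"
    by (rule A.generate_subgroup_incl[OF assms(1) subgroup_G])
  ultimately show ?thesis using generate_GG[OF assms(1)] by simp
qed

lemma generate_gens: "generate GG (insert (rooted_a p) B) = carrier GG"
  using gens_in_G by (subst generate_GG) (auto simp: G_def)

lemma stab_normal: "level_stab p G n \<lhd> GG"
  by (rule level_stab_normal[OF subgroup_G])

text \<open>An element of \<open>G\<close> is determined modulo the stabiliser of level \<open>n\<close> by its restriction to the finite set
  of vertices of this level.\<close>

lemma finite_quotient: "finite (carrier (GG Mod level_stab p G n))"
proof -
  interpret N: normal "level_stab p G n" GG by (rule stab_normal)
  let ?r = "\<lambda>g. restrict g (level p n)"
  have "?r g \<in> level p n \<rightarrow>\<^sub>E level p n" if "g \<in> G" for g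
    unfolding restrict_PiE_iff
    using bij_betw_apply[OF tree_aut_bij_level[OF cyclic_aut_closed[OF G_cyclic[OF that]]]] by blast
  then have "?r ` G \<subseteq> level p n \<rightarrow>\<^sub>E level p n" by blast
  then have fin: "finite (?r ` G)" by (rule finite_subset) (intro finite_PiE finite_level)
  have "level_stab p G n #>\<^bsub>GG\<^esub> g = level_stab p G n #>\<^bsub>GG\<^esub> h"
    if g: "g \<in> G" and h: "h \<in> G" and eq: "?r g = ?r h" for g h
  proof -
    let ?k = "inv\<^bsub>GG\<^esub> h"
    have kh: "?k (h w) = w" for w using fun_cong[OF GG.r_inv[of h], of w] h by simp
    have "g w = h w" if "w \<in> level p n" for w using fun_cong[OF eq, of w] that by simp
    then have "fixes_level p n (?k \<circ> g)" by (simp add: fixes_level_def kh)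
    moreover have "g \<otimes>\<^bsub>GG\<^esub> ?k \<in> G" using GG.m_closed[of g ?k] GG.inv_closed[of h] g h by simp
    ultimately have "g \<otimes>\<^bsub>GG\<^esub> ?k \<in> level_stab p G n" by (simp add: level_stab_fixes_level)
    then have "g \<in> level_stab p G n #>\<^bsub>GG\<^esub> h"
      using N.rcos_module[OF GG.is_group, of h g] g h by simp
    then show ?thesis using GG.repr_independence[OF _ _ N.subgroup_axioms, of g h] h by simp
  qed
  note same = this
  have fin': "finite ((\<lambda>g. level_stab p G n #>\<^bsub>GG\<^esub> g) ` G)"
    by (rule finite_image_factor[OF fin same])
  have c: "carrier GG = G" by simp
  show ?thesis unfolding carrier_FactGroup c by (rule fin')
qed

lemma gen_order_p:
  assumes "x \<in> insert (rooted_a p) B"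
  shows "x ^^ p = id"
  using assms rooted_a_order B_directed by (auto simp: directed_def)

text \<open>The generators act faithfully on level 2: they have order \<open>p\<close>, and \<open>a\<close> moves level 1, while a directed
  generator moves some vertex of level 2 because its vector is not zero.\<close>

lemma gen_power_deep:
  assumes x: "x \<in> insert (rooted_a p) B" and f: "fixlev 2 (x ^^ m)"
  shows "x ^^ m = id"
proof -
  note xc = subsetD[OF gens_cyclic x]
  note f' = f[unfolded fixlev_2[OF funpow_cyclic_aut[OF xc]] fixlev_1_iff[OF funpow_cyclic_aut[OF xc]]]
  have "p dvd m"
  proof (cases "x = rooted_a p")
    case True
    have "rot (rooted_a p) [] =\<^sub>p 1" using rot_rooted_a[of "[]"] by simp
    then have "\<not> rot (rooted_a p) [] =\<^sub>p 0" using p_gt2 by (auto simp: cong_def)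
    then show ?thesis using fixlev_1_funpow[OF rooted_a_cyclic] f' True fixlev_1_iff[OF funpow_cyclic_aut[OF xc]] by blast
  next
    case False
    then obtain q where "directed q x" using x B_directed by auto
    then obtain z where z: "z \<in> {1..p}" "\<not> rot x [z] =\<^sub>p 0" "rot x [] =\<^sub>p 0" by (auto simp: directed_def)
    have "x [z] = [z]" using fixlev_1_iff[OF xc] z by (simp add: fixes_level_def level_1)
    then have "rot (x ^^ m) [z] =\<^sub>p int m * rot x [z]"
      using z by (intro rot_funpow_fixed xc) (auto simp: tree_words_Cons)
    moreover have "rot (x ^^ m) [z] =\<^sub>p 0" using f' z(1) by blast
    ultimately show ?thesis using rot_nat_mult_0[OF z(2)] pcong_0_iff by blast
  qed
  then obtain k where "m = p * k" by blast
  then have "x ^^ m = (x ^^ p) ^^ k" by (simp add: funpow_mult)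
  then show ?thesis using gen_order_p[OF x] by (simp add: id_funpow)
qed

lemma gen_not_deep: "x \<in> insert (rooted_a p) B \<Longrightarrow> \<not> fixlev 2 x"
proof
  assume x: "x \<in> insert (rooted_a p) B" and "fixlev 2 x"
  then have id: "x = id" using gen_power_deep[of x 1] by simp
  have "\<not> directed q id" for q by (simp add: directed_def)
  then have "rooted_a p = id" using x B_directed id by auto
  then show False using rot_rooted_a[of "[]"] p_gt2 by (simp add: cong_def)
qed

lemma ramification_structure_from_deep:
  assumes k: "k \<ge> 3" and gen: "generate GG {g \<in> G. deep g} = G"
  shows "\<exists>T1 T2. ramification_structure (GG Mod level_stab p G k) T1 T2"
proof -
  interpret N: normal "level_stab p G k" GG by (rule stab_normal)
  show ?thesis
  proof (rule N.ramification_structure_quotient[OF finite_quotient, of "insert (rooted_a p) B" "{g \<in> G. deep g}"])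
    have fix_2: "fixlev 2 g" if "g \<in> G" "fixlev k g" for g
      using fixlev_mono[OF G_cyclic] that k by simp
    show "insert (rooted_a p) B \<subseteq> carrier GG - level_stab p G k"
      using gens_in_G gen_not_deep fix_2 by (auto simp: level_stab_fixes_level)
    show "{g \<in> G. deep g} \<subseteq> carrier GG - level_stab p G k"
      using fixlev_mono[OF G_cyclic _ k] by (auto simp: level_stab_fixes_level deep_def)
    show "generate GG (insert (rooted_a p) B) = carrier GG" by (rule generate_gens)
    show "generate GG {g \<in> G. deep g} = carrier GG" using gen by simp
    show "{g \<in> G. deep g} \<noteq> {}"
    proof
      assume e: "{g \<in> G. deep g} = {}"
      have "generate GG {} = G" using gen unfolding e .
      then have "G = {id}" using GG.generate_empty by simp
      then have "rooted_a p = id" using gens_in_G(1) by blast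
      then have "fixlev 2 (rooted_a p)" by (simp add: fixes_level_def)
      then show False using gen_not_deep[of "rooted_a p"] by simp
    qed
    fix x y g h and m n :: nat
    assume a: "x \<in> insert (rooted_a p) B" "y \<in> {g \<in> G. deep g}" "g \<in> carrier GG"
      "h \<in> level_stab p G k"
      "inv\<^bsub>GG\<^esub> g \<otimes>\<^bsub>GG\<^esub> x [^]\<^bsub>GG\<^esub> m \<otimes>\<^bsub>GG\<^esub> g = h \<otimes>\<^bsub>GG\<^esub> y [^]\<^bsub>GG\<^esub> n"
    have xG: "x \<in> G" using a(1) gens_in_G by auto
    have pw: "z ^^ n \<in> G" if "z \<in> G" for z n using GG.nat_pow_closed[of z n] that by (simp add: GG_simps)
    show "x [^]\<^bsub>GG\<^esub> m \<in> level_stab p G k"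
    proof (rule N.conj_power_mem[OF stab_normal[of 2] _ _ _ _ _ _ a(3,4,5)])
      show "level_stab p G k \<subseteq> level_stab p G 2" using fix_2 by (auto simp: level_stab_fixes_level)
      show "x [^]\<^bsub>GG\<^esub> p = \<one>\<^bsub>GG\<^esub>" using gen_order_p[OF a(1)] by (simp only: GG_simps)
      show "x [^]\<^bsub>GG\<^esub> m \<in> level_stab p G k" if "x [^]\<^bsub>GG\<^esub> m \<in> level_stab p G 2"
        using that gen_power_deep[OF a(1), of m] pw[OF xG, of m] unfolding GG_simps
        by (auto simp: level_stab_fixes_level fixes_level_def)
      show "y [^]\<^bsub>GG\<^esub> n \<in> level_stab p G 2" if "y [^]\<^bsub>GG\<^esub> (n * p) \<in> level_stab p G k"
        using that a(2) pw[of y n] fixlev_mono[OF G_cyclic _ k, of "y ^^ (n * p)"]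
        unfolding GG_simps level_stab_fixes_level deep_def by auto
    qed (use xG a in simp_all)
  qed simp
qed

lemma id_in_G: "id \<in> G"
  using subgroup.one_closed[OF subgroup_G] by simp

lemma funpow_in_G: "g \<in> G \<Longrightarrow> g ^^ n \<in> G"
proof (induction n)
  case (Suc n)
  show ?case using comp_in_G[OF Suc.IH[OF Suc.prems] Suc.prems] by (simp only: funpow.simps)
qed (use id_in_G in \<open>simp only: funpow.simps\<close>)

lemma hom_id:
  assumes hom: "\<And>g h. g \<in> G \<Longrightarrow> h \<in> G \<Longrightarrow> \<phi> (h \<circ> g) =\<^sub>p \<phi> g + \<phi> h"
  shows "\<phi> id =\<^sub>p 0"
proof -
  have "\<phi> id =\<^sub>p \<phi> id + \<phi> id" using hom[OF id_in_G id_in_G] unfolding o_id .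
  then show ?thesis by (simp add: cong_iff_dvd_diff)
qed

lemma hom_funpow:
  assumes hom: "\<And>g h. g \<in> G \<Longrightarrow> h \<in> G \<Longrightarrow> \<phi> (h \<circ> g) =\<^sub>p \<phi> g + \<phi> h" and g: "g \<in> G"
  shows "\<phi> (g ^^ n) =\<^sub>p int n * \<phi> g"
proof (induction n)
  case 0
  show ?case unfolding funpow.simps of_nat_0 mult_zero_left by (rule hom_id[OF hom])
next
  case (Suc n)
  have "\<phi> (g \<circ> g ^^ n) =\<^sub>p \<phi> (g ^^ n) + \<phi> g" by (rule hom[OF funpow_in_G[OF g] g])
  also have "\<phi> (g ^^ n) + \<phi> g =\<^sub>p int n * \<phi> g + \<phi> g" by (intro cong_add Suc cong_refl)
  finally have "\<phi> (g \<circ> g ^^ n) =\<^sub>p int n * \<phi> g + \<phi> g" .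
  moreover have "int (Suc n) * \<phi> g = int n * \<phi> g + \<phi> g" by (simp add: algebra_simps)
  ultimately show ?case by (simp only: funpow.simps)
qed

text \<open>The function \<open>\<phi>\<close> is required to be additive on \<open>G\<close> only, because the moments used for level 2 are
  additive on \<open>G\<close> but not on all of \<open>cyclic_aut p\<close>.\<close>

lemma hom_vanishes_on_G:
  fixes \<phi> :: "(nat list \<Rightarrow> nat list) \<Rightarrow> int"
  assumes hom: "\<And>g h. g \<in> G \<Longrightarrow> h \<in> G \<Longrightarrow> \<phi> (h \<circ> g) =\<^sub>p \<phi> g + \<phi> h"
    and gens: "\<And>x. x \<in> insert (rooted_a p) B \<Longrightarrow> \<phi> x =\<^sub>p 0"
    and g: "g \<in> G"
  shows "\<phi> g =\<^sub>p 0"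
proof -
  have id0: "\<phi> id =\<^sub>p 0" by (rule hom_id[OF hom])
  show ?thesis
    using g unfolding G_def
  proof (induction rule: generate.induct)
    case one
    show ?case using id0 by (simp only: tree_aut_simps)
  next
    case (incl h)
    then show ?case by (rule gens)
  next
    case (inv h)
    let ?h = "inv\<^bsub>tree_aut p\<^esub> h"
    have h: "h \<in> G" using inv gens_in_G by blast
    have "?h \<in> G" using subgroup.m_inv_closed[OF subgroup_G h] .
    then have "\<phi> (?h \<circ> h) =\<^sub>p \<phi> h + \<phi> ?h" by (rule hom[OF h])
    moreover have "?h \<circ> h = id" using A.r_inv[OF cyclic_aut_closed[OF G_cyclic[OF h]]] by (simp only: tree_aut_simps)
    ultimately have "\<phi> h + \<phi> ?h =\<^sub>p 0" using pcong_0_iff[of "\<phi> (?h \<circ> h)"] id0 by metis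
    then show ?case using gens[OF inv] by (simp add: cong_0_iff dvd_add_right_iff)
  next
    case (eng g h)
    have "g \<in> G" "h \<in> G" using eng by (simp_all add: G_def)
    then have *: "\<phi> (h \<circ> g) =\<^sub>p \<phi> g + \<phi> h" by (rule hom)
    have "\<phi> g + \<phi> h =\<^sub>p 0" using cong_add[OF eng.IH] by simp
    then show ?case using pcong_0_iff[OF *] by (simp only: tree_aut_simps)
  qed
qed

section \<open>Orbit sums of commutators\<close>

lemma sum_rot_1: "sum_rot 1 g = (\<Sum>x\<in>{1..p}. rot g [x])"
proof -
  have "inj_on (\<lambda>x. [x]) {1..p}" by (simp add: inj_on_def)
  then show ?thesis by (simp add: sum_rot_def level_1 sum.reindex)
qed

lemma sum_rot_2: "sum_rot 2 g = (\<Sum>x\<in>{1..p}. \<Sum>y\<in>{1..p}. rot g [x, y])"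
proof -
  have inj: "inj_on (\<lambda>(x, y). [x, y]) ({1..p} \<times> {1..p})" by (auto simp: inj_on_def)
  have "sum_rot 2 g = (\<Sum>z\<in>{1..p} \<times> {1..p}. rot g (case z of (x, y) \<Rightarrow> [x, y]))"
    unfolding sum_rot_def numeral_2_eq_2 level_2 sum.reindex[OF inj] by (simp only: o_def)
  also have "\<dots> = (\<Sum>x\<in>{1..p}. \<Sum>y\<in>{1..p}. rot g [x, y])"
    unfolding sum.cartesian_product by (rule sum.cong) auto
  finally show ?thesis .
qed

lemma sum_rot_rooted_a: "n > 0 \<Longrightarrow> sum_rot n (rooted_a p) =\<^sub>p 0"
proof -
  assume "n > 0"
  then have "rot (rooted_a p) w =\<^sub>p 0" if "w \<in> level p n" for w
    using that rot_rooted_a[of w] by (auto simp: level_def)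
  then have "sum_rot n (rooted_a p) =\<^sub>p (\<Sum>w\<in>level p n. 0)"
    unfolding sum_rot_def by (rule cong_sum)
  then show ?thesis by simp
qed

text \<open>On level 2 the directed automorphism has non-zero rotations only below the spine letter, where it repeats
  its rotations on level 1.\<close>

lemma sum_rot_directed:
  assumes "directed q b"
  shows "sum_rot 2 b =\<^sub>p sum_rot 1 b"
proof -
  have "(\<Sum>y\<in>{1..p}. rot b [x, y]) =\<^sub>p (if x = q then \<Sum>y\<in>{1..p}. rot b [y] else 0)"
    if "x \<in> {1..p}" for x
  proof (cases "x = q")
    case True
    then show ?thesis using assms by (auto simp: directed_def intro: cong_sum)
  next
    case False
    have "(\<Sum>y\<in>{1..p}. rot b [x, y]) =\<^sub>p (\<Sum>y\<in>{1..p}. 0)"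
      using assms that False by (intro cong_sum) (auto simp: directed_def)
    then show ?thesis using False by simp
  qed
  then have "sum_rot 2 b =\<^sub>p (\<Sum>x\<in>{1..p}. if x = q then \<Sum>y\<in>{1..p}. rot b [y] else 0)"
    unfolding sum_rot_2 by (rule cong_sum)
  also have "(\<Sum>x\<in>{1..p}. if x = q then \<Sum>y\<in>{1..p}. rot b [y] else 0) = sum_rot 1 b"
    unfolding sum_rot_1 using assms by (simp add: directed_def)
  finally show ?thesis .
qed

text \<open>Subtracting the two families of congruences shows that the difference \<open>f z - f (z - d)\<close>, where
  \<open>d = f i\<close>, is invariant under translation by the unit \<open>d\<close>, so it is a constant \<open>\<kappa>\<close>. Thus \<open>f\<close> is linear, and
  \<open>f (- i) = - f i\<close>. For such an \<open>f\<close> the first congruence reads \<open>2 \<kappa> = 0\<close>. Then \<open>f\<close> vanishes, contradicting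
  the choice of \<open>i\<close>.\<close>

lemma affine_contradiction:
  fixes f :: "int \<Rightarrow> int"
  assumes per: "\<And>y z. y =\<^sub>p z \<Longrightarrow> f y = f z"
    and f0: "f 0 =\<^sub>p 0" and d: "\<not> f i =\<^sub>p 0"
    and c1: "\<And>z. (f z - f (z - f i)) + (f (z + w - f (- i)) - f (z + w)) =\<^sub>p 0"
    and c2: "\<And>z. (f (z - f i) - f (z - f i - f i)) + (f (z + w - f (- i)) - f (z + w)) =\<^sub>p 0"
  shows False
proof -
  define d e g \<kappa> where "d = f i" and "e = f (- i)" and "g = (\<lambda>z. f z - f (z - d))" and "\<kappa> = g 0"
  have step: "g (z + d) =\<^sub>p g z" for z
  proof -
    have "((f (z + d) - f (z + d - f i)) + (f (z + d + w - f (- i)) - f (z + d + w))) -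
      ((f (z + d - f i) - f (z + d - f i - f i)) + (f (z + d + w - f (- i)) - f (z + d + w))) =\<^sub>p 0 - 0"
      by (intro cong_diff c1 c2)
    then show ?thesis by (simp add: g_def d_def cong_iff_dvd_diff)
  qed
  have g_mult: "g (int n * d) =\<^sub>p \<kappa>" for n
  proof (induction n)
    case (Suc n)
    have "g (int (Suc n) * d) = g (int n * d + d)" by (simp add: algebra_simps)
    then show ?case using cong_trans[OF step Suc] by simp
  qed (simp add: \<kappa>_def)
  have g_const: "g z =\<^sub>p \<kappa>" for z
  proof -
    obtain n where n: "int n * d =\<^sub>p z" using pcong_inverse d unfolding d_def by blast
    have "z - d =\<^sub>p int n * d - d" using n by (intro cong_diff) (auto simp: cong_sym)
    then have "g z = g (int n * d)" unfolding g_def using per n by (metis cong_sym)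
    then show ?thesis using g_mult by simp
  qed
  have f_mult: "f (int n * d) =\<^sub>p int n * \<kappa>" for n
  proof (induction n)
    case (Suc n)
    have "f (int (Suc n) * d) = f (int n * d) + g (int (Suc n) * d)" by (simp add: g_def algebra_simps)
    also have "f (int n * d) + g (int (Suc n) * d) =\<^sub>p int n * \<kappa> + \<kappa>"
      by (intro cong_add Suc g_mult)
    finally show ?case by (simp add: algebra_simps)
  qed (use f0 in simp)
  obtain n where n: "int n * d =\<^sub>p i" using pcong_inverse d unfolding d_def by blast
  obtain m where m: "int m * d =\<^sub>p - i" using pcong_inverse d unfolding d_def by blast
  have "int (n + m) * d =\<^sub>p 0" using cong_add[OF n m] by (simp add: algebra_simps)
  then have nm: "p dvd n + m" using rot_nat_mult_0[of d] d unfolding d_def by blast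
  have dk: "d =\<^sub>p int n * \<kappa>" using f_mult[of n] per[OF n] by (simp add: d_def)
  have ek: "e =\<^sub>p int m * \<kappa>" using f_mult[of m] per[OF m] by (simp add: e_def)
  have "e + d =\<^sub>p int (n + m) * \<kappa>" using cong_add[OF ek dk] by (simp add: algebra_simps)
  also have "int (n + m) * \<kappa> =\<^sub>p 0" using nm by (simp add: cong_0_iff flip: of_nat_add)
  finally have ed: "e + d =\<^sub>p 0" .
  have "(w - e) - (w + d) = - (e + d)" by simp
  moreover have "int p dvd - (e + d)" using ed by (simp only: cong_0_iff dvd_minus_iff)
  ultimately have "w - e =\<^sub>p w + d" by (simp only: cong_iff_dvd_diff)
  then have fwe: "f (w - e) = f (w + d)" by (rule per)
  have "(f 0 - f (0 - f i)) + (f (0 + w - f (- i)) - f (0 + w)) =\<^sub>p 0" by (rule c1)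
  moreover have "(f 0 - f (0 - f i)) + (f (0 + w - f (- i)) - f (0 + w)) = g 0 + g (w + d)"
    using fwe by (simp add: g_def d_def e_def)
  ultimately have "g 0 + g (w + d) =\<^sub>p 0" by simp
  then have "\<kappa> + \<kappa> =\<^sub>p 0" using pcong_0_iff[OF cong_add[OF g_const g_const]] by blast
  then have "2 * \<kappa> =\<^sub>p 0" by simp
  then have "\<kappa> =\<^sub>p 0" using pcong_mult_0[of 2 \<kappa>] pcong_2_not_0 by blast
  then have "int n * \<kappa> =\<^sub>p 0" using pcong_mult_0[of "int n" \<kappa>] by blast
  then show False using pcong_0_iff[OF dk] d by (simp add: d_def)
qed

lemma rot_level_1_mult:
  assumes "g \<in> cyclic_aut p" "h \<in> cyclic_aut p" "rot g [] =\<^sub>p 0" "x \<in> {1..p}"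
  shows "rot (h \<circ> g) [x] =\<^sub>p rot g [x] + rot h [x]"
proof -
  have "g [x] = [x]" using action_level_1[OF assms(1,4)] letter_fixed[OF assms(4)] assms(3) by simp
  then show ?thesis using rot_mult[OF assms(1,2), of "[x]"] assms(4) by (simp add: tree_words_Cons)
qed

lemma letter_shift_eq: "x \<in> {1..p} \<Longrightarrow> letter p z = x \<longleftrightarrow> z =\<^sub>p int x"
  using letter_inject[of z "int x"] by simp

text \<open>Within \<open>p\<close> steps an orbit of \<open>u\<close> visits the vertices below each letter exactly once. Between the visits
  below \<open>x\<close> and below \<open>y\<close> the second letter is shifted by an amount \<open>w\<close> which does not depend on this letter.\<close>

lemma orbit_sum_two_columns:
  assumes u: "u \<in> cyclic_aut p" "\<not> rot u [] =\<^sub>p 0"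
    and x: "x \<in> {1..p}" "y \<in> {1..p}" "x \<noteq> y"
  shows "\<exists>w. \<forall>R z. (\<forall>v\<in>{1..p} - {x, y}. \<forall>z. rot R [v, letter p z] =\<^sub>p 0) \<longrightarrow>
    (\<Sum>m<p. rot R ((u ^^ m) [x, letter p z])) =\<^sub>p rot R [x, letter p z] + rot R [y, letter p (z + w)]"
proof -
  let ?r = "rot u []"
  note un = funpow_cyclic_aut[OF u(1)]
  obtain n where n: "int n * ?r =\<^sub>p int y - int x" using pcong_inverse[OF u(2)] by blast
  define m0 where "m0 = n mod p"
  have m0_lt: "m0 < p" using p_pos by (simp add: m0_def)
  have "int m0 =\<^sub>p int n" by (simp add: m0_def cong_def of_nat_mod)
  then have "int m0 * ?r =\<^sub>p int n * ?r" by (rule cong_scalar_right)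
  then have m0: "int m0 * ?r =\<^sub>p int y - int x" using n cong_trans by blast
  have hit: "int x + int m * ?r =\<^sub>p int y \<longleftrightarrow> m = m0" if "m < p" for m
  proof
    assume "int x + int m * ?r =\<^sub>p int y"
    then have "int m * ?r =\<^sub>p int y - int x" by (simp add: cong_iff_dvd_diff algebra_simps)
    then have "?r * int m =\<^sub>p ?r * int m0" using cong_trans[OF _ cong_sym[OF m0]] by (simp add: mult.commute)
    then have "int m =\<^sub>p int m0" using pcong_mult_cancel[OF u(2)] by simp
    then show "m = m0" using that m0_lt by (simp add: cong_def)
  next
    assume "m = m0"
    then show "int x + int m * ?r =\<^sub>p int y" using m0 by (simp add: cong_iff_dvd_diff algebra_simps)
  qed
  have stay: "int x + int m * ?r =\<^sub>p int x \<longleftrightarrow> m = 0" if "m < p" for m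
  proof -
    have "int x + int m * ?r =\<^sub>p int x \<longleftrightarrow> int m * ?r =\<^sub>p 0" by (rule cong_add_lcancel_0)
    then show ?thesis using rot_nat_mult_0[OF u(2), of m] that by (auto dest: dvd_imp_le)
  qed
  have m0_ne: "m0 \<noteq> 0"
  proof
    assume "m0 = 0"
    then have "int x =\<^sub>p int y" using hit[of 0] p_pos by simp
    then show False using letters_eq x by blast
  qed
  define w where "w = rot (u ^^ m0) [x]"
  have act: "(u ^^ m) [x, letter p z] = [letter p (int x + int m * ?r), letter p (z + rot (u ^^ m) [x])]" for m z
  proof -
    have "rot (u ^^ m) [] =\<^sub>p int m * ?r"
      using tree_autD(2)[OF cyclic_aut_closed[OF u(1)]] by (intro rot_funpow_fixed u(1)) auto
    then have "letter p (int x + rot (u ^^ m) []) = letter p (int x + int m * ?r)"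
      by (intro letter_cong cong_add cong_refl)
    then show ?thesis using action_level_2[OF un x(1) letter_range, of m z] by simp
  qed
  have "(\<Sum>m<p. rot R ((u ^^ m) [x, letter p z])) =\<^sub>p rot R [x, letter p z] + rot R [y, letter p (z + w)]"
    if R: "\<forall>v\<in>{1..p} - {x, y}. \<forall>z. rot R [v, letter p z] =\<^sub>p 0" for R z
  proof -
    have "(\<Sum>m<p. rot R ((u ^^ m) [x, letter p z])) =\<^sub>p
      (\<Sum>m<p. (if m = 0 then rot R [x, letter p z] else 0) + (if m = m0 then rot R [y, letter p (z + w)] else 0))"
    proof (rule cong_sum)
      fix m assume "m \<in> {..<p}"
      then have m: "m < p" by simp
      consider "m = 0" | "m = m0" "m \<noteq> 0" | "m \<noteq> 0" "m \<noteq> m0" by blast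
      then show "rot R ((u ^^ m) [x, letter p z]) =\<^sub>p
        (if m = 0 then rot R [x, letter p z] else 0) + (if m = m0 then rot R [y, letter p (z + w)] else 0)"
      proof cases
        case 1
        then show ?thesis using m0_ne by simp
      next
        case 2
        then have "letter p (int x + int m * ?r) = y" using hit[OF m] letter_shift_eq x(2) by blast
        then have "(u ^^ m) [x, letter p z] = [y, letter p (z + w)]" using act[of m z] 2(1) by (simp add: w_def)
        then show ?thesis using 2 by simp
      next
        case 3
        have "letter p (int x + int m * ?r) \<in> {1..p} - {x, y}"
          using 3 hit[OF m] stay[OF m] letter_shift_eq[OF x(1)] letter_shift_eq[OF x(2)] letter_range by blast
        then show ?thesis using R act[of m z] 3 by simp
      qed
    qed
    then show ?thesis using m0_lt p_pos by (simp add: sum.distrib)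
  qed
  then show ?thesis by blast
qed

lemma level_2_letters:
  assumes "w \<in> level p 2"
  obtains x z where "x \<in> {1..p}" "w = [x, letter p z]"
proof -
  obtain x y where "w = [x, y]" "x \<in> {1..p}" "y \<in> {1..p}"
    using assms unfolding numeral_2_eq_2 level_2 by auto
  then show ?thesis using that[of x "int y"] by simp
qed

lemma word_2_in_tree: "x \<in> {1..p} \<Longrightarrow> [x, letter p z] \<in> tree_words p"
  "x \<in> {1..p} \<Longrightarrow> [x, letter p z] \<in> level p 2"
  using letter_range[of z] by (auto simp: tree_words_def level_def)

lemma fixing_level_1_action:
  assumes "g \<in> cyclic_aut p" "rot g [] =\<^sub>p 0" "x \<in> {1..p}"
  shows "g [x, letter p z] = [x, letter p (z + rot g [x])]"
  using action_level_2[OF assms(1,3) letter_range, of z] assms letter_fixed[OF assms(3)] by simp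

lemma pcong_drop_zeros:
  assumes "a =\<^sub>p 0" "b =\<^sub>p 0" "a + c =\<^sub>p d + b"
  shows "c =\<^sub>p d"
proof -
  have "(a + c) - (d + b) - a + b =\<^sub>p 0 - 0 + 0"
    by (intro cong_add cong_diff assms(1,2)) (use assms(3) in \<open>simp add: cong_0_iff cong_iff_dvd_diff\<close>)
  then show ?thesis by (simp add: cong_iff_dvd_diff)
qed

lemma pcong_solve:
  assumes "x =\<^sub>p y + r" "x =\<^sub>p b + c" "y =\<^sub>p d + e"
  shows "r =\<^sub>p b + c - d - e"
proof -
  have "int p dvd (x - (b + c)) - (x - (y + r)) - (y - (d + e))"
    by (rule dvd_diff[OF dvd_diff[OF assms(2,1)[unfolded cong_iff_dvd_diff]] assms(3)[unfolded cong_iff_dvd_diff]])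
  moreover have "(x - (b + c)) - (x - (y + r)) - (y - (d + e)) = r - (b + c - d - e)" by simp
  ultimately show ?thesis by (simp only: cong_iff_dvd_diff)
qed

text \<open>Let \<open>c\<close> be the conjugate of \<open>b\<close> by a power of \<open>a\<close> whose spine letter is a letter \<open>s\<close> at which \<open>b\<close> rotates by
  a non-zero amount \<open>d\<close>. The commutator \<open>Q\<close> of \<open>b\<close> and \<open>c\<close> fixes level 2, and there it has non-zero rotations only
  below the two spine letters \<open>s\<close> and \<open>q\<close>, where they are differences of the vector \<open>F\<close> of \<open>b\<close>. Conjugation by \<open>b\<close> shifts
  the argument below \<open>s\<close> by \<open>d\<close> and leaves it alone below \<open>q\<close>. If the orbit sums of both \<open>Q\<close> and its conjugate \<open>Q2\<close>
  vanished, the two resulting systems of congruences would have exactly the form of \<open>affine_contradiction\<close>.\<close>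

lemma moving_witness_exists:
  assumes u: "u \<in> cyclic_aut p" "\<not> rot u [] =\<^sub>p 0" and dir: "directed q b"
  shows "\<exists>Q\<in>generate (tree_aut p) {rooted_a p, b}. fixlev 2 Q \<and>
    (\<exists>w\<in>level p 2. \<not> (\<Sum>m<p. rot Q ((u ^^ m) w)) =\<^sub>p 0)"
proof -
  let ?H = "generate (tree_aut p) {rooted_a p, b}" and ?A = "tree_aut p"
  have bc: "b \<in> cyclic_aut p" and q: "q \<in> {1..p}" and b0: "rot b [] =\<^sub>p 0" and bq: "rot b [q] =\<^sub>p 0"
    and bqy: "\<And>y. y \<in> {1..p} \<Longrightarrow> rot b [q, y] =\<^sub>p rot b [y]"
    and bxy: "\<And>x y. x \<in> {1..p} \<Longrightarrow> y \<in> {1..p} \<Longrightarrow> x \<noteq> q \<Longrightarrow> rot b [x, y] =\<^sub>p 0"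
    using dir by (auto simp: directed_def)
  obtain s where s: "s \<in> {1..p}" "\<not> rot b [s] =\<^sub>p 0" using dir by (auto simp: directed_def)
  have sq: "s \<noteq> q" using s bq by blast
  have H: "subgroup ?H ?A"
    using cyclic_aut_closed[OF rooted_a_cyclic] cyclic_aut_closed[OF bc] by (intro A.generate_is_subgroup) simp
  have Hc: "?H \<subseteq> cyclic_aut p"
    using bc rooted_a_cyclic by (intro A.generate_subgroup_incl[OF _ subgroup_cyclic_aut]) simp
  have inH: "rooted_a p \<in> ?H" "b \<in> ?H" by (auto intro: generate.incl)
  define F where "F = (\<lambda>z. rot b [letter p z])"
  have F_per: "F y = F z" if "y =\<^sub>p z" for y z using letter_cong[OF that] by (simp add: F_def)
  define i where "i = int s - int q"
  have F_s: "F (int q + i) = rot b [s]" using s(1) by (simp add: F_def i_def)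
  have F_q: "F (int q) = rot b [q]" using letter_int[OF q] by (simp add: F_def)
  define t where "t = nat (i mod int p)"
  have t: "int t =\<^sub>p i" using p_pos by (simp add: t_def cong_def)
  let ?a = "rooted_a p ^^ t"
  have ac: "?a \<in> cyclic_aut p" by (rule funpow_cyclic_aut[OF rooted_a_cyclic])
  have aH: "?a \<in> ?H"
  proof (induction t)
    case 0
    then show ?case using subgroup.one_closed[OF H] by (simp add: id_def)
  next
    case (Suc t)
    then show ?case using subgroup.m_closed[OF H Suc inH(1)] by (simp add: o_def)
  qed
  have a_act: "?a (x # v) = letter p (int x + i) # v" if "x # v \<in> tree_words p" for x v
    using rooted_a_funpow_Cons[OF that, of t] letter_cong[OF cong_add[OF cong_refl t], of "int x"] by simp
  \<comment> \<open>The conjugate of \<open>b\<close> by a power of \<open>a\<close> whose spine letter is \<open>s\<close>.\<close>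
  define c where "c = inv\<^bsub>?A\<^esub> ?a \<otimes>\<^bsub>?A\<^esub> b \<otimes>\<^bsub>?A\<^esub> ?a"
  have cH: "c \<in> ?H" unfolding c_def using H aH inH by (simp add: subgroup.m_closed subgroup.m_inv_closed del: tree_aut_simps)
  then have cc: "c \<in> cyclic_aut p" using Hc by blast
  have "?a \<otimes>\<^bsub>?A\<^esub> c = b \<otimes>\<^bsub>?A\<^esub> ?a"
  proof -
    have k: "?a \<in> carrier ?A" "b \<in> carrier ?A" using ac bc cyclic_aut_closed by blast+
    have "?a \<otimes>\<^bsub>?A\<^esub> c = (?a \<otimes>\<^bsub>?A\<^esub> inv\<^bsub>?A\<^esub> ?a) \<otimes>\<^bsub>?A\<^esub> (b \<otimes>\<^bsub>?A\<^esub> ?a)"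
      unfolding c_def using k by (simp only: A.m_assoc A.m_closed A.inv_closed)
    also have "\<dots> = b \<otimes>\<^bsub>?A\<^esub> ?a" using k by (simp only: A.r_inv A.l_one A.m_closed)
    finally show ?thesis .
  qed
  then have ca: "c \<circ> ?a = ?a \<circ> b" by (simp only: tree_aut_simps)
  have conj_rot: "rot ?a w + rot c (?a w) =\<^sub>p rot b w + rot ?a (b w)" if "w \<in> tree_words p" for w
    using rot_mult[OF ac cc that] rot_mult[OF bc ac that] unfolding ca by (simp add: cong_def)
  have nonempty: "b w \<noteq> [] \<and> b w \<in> tree_words p" if "w \<noteq> []" "w \<in> tree_words p" for w
    using tree_aut_words(1,4)[OF cyclic_aut_closed[OF bc], of w] that by auto
  have c_shift: "rot c (?a w) =\<^sub>p rot b w" if "w \<noteq> []" "w \<in> tree_words p" for w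
  proof -
    have "rot ?a w =\<^sub>p 0" using rot_rooted_a_funpow[OF that(2), of t] that(1) by simp
    moreover have "rot ?a (b w) =\<^sub>p 0" using rot_rooted_a_funpow[of "b w" t] nonempty[OF that] by simp
    ultimately show ?thesis using conj_rot[OF that(2)] by (rule pcong_drop_zeros)
  qed
  have c0: "rot c [] =\<^sub>p 0"
  proof -
    have "?a [] = []" "b [] = []"
      using tree_autD(2)[OF cyclic_aut_closed[OF ac]] tree_autD(2)[OF cyclic_aut_closed[OF bc]] by auto
    then have "rot ?a [] + rot c [] =\<^sub>p rot ?a [] + rot b []" using conj_rot[of "[]"] by (simp add: add.commute)
    then have "rot c [] =\<^sub>p rot b []" by (simp only: cong_add_lcancel)
    then show ?thesis using pcong_0_iff b0 by blast
  qed
  have c_rot: "rot c (x # v) =\<^sub>p rot b (letter p (int x - i) # v)" if "x # v \<in> tree_words p" for x v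
  proof -
    have w: "letter p (int x - i) # v \<in> tree_words p" using that letter_range by (simp add: tree_words_Cons)
    have "?a (letter p (int x - i) # v) = x # v"
      using a_act[OF w] that by (simp add: tree_words_Cons)
    then show ?thesis using c_shift[of "letter p (int x - i) # v"] w by simp
  qed
  have shift_q: "letter p (int x - i) = q \<longleftrightarrow> x = s" if "x \<in> {1..p}" for x
  proof -
    have "letter p (int x - i) = q \<longleftrightarrow> int x =\<^sub>p int s"
      using letter_shift_eq[OF q, of "int x - i"] by (simp add: i_def cong_iff_dvd_diff algebra_simps)
    then show ?thesis using letters_eq[OF that s(1)] by auto
  qed
  have c_s: "rot c [s, letter p z] =\<^sub>p F z" for z
  proof -
    have "rot c [s, letter p z] =\<^sub>p rot b [q, letter p z]"
      using c_rot[OF word_2_in_tree(1)[OF s(1)], of z] shift_q[OF s(1)] by simp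
    then show ?thesis using bqy[OF letter_range] unfolding F_def by (rule cong_trans)
  qed
  have c_other: "rot c [x, letter p z] =\<^sub>p 0" if "x \<in> {1..p}" "x \<noteq> s" for x z
    using cong_trans[OF c_rot[OF word_2_in_tree(1)[OF that(1)], of z]] bxy[OF letter_range letter_range]
      shift_q[OF that(1)] that(2) by blast
  define d e where "d = F (int q + i)" and "e = F (int q - i)"
  have c1_s: "rot c [s] =\<^sub>p 0"
    using cong_trans[OF c_rot[of s "[]"]] shift_q[OF s(1)] bq s(1) by (simp add: tree_words_Cons)
  have c1_q: "rot c [q] =\<^sub>p e"
    using c_rot[of q "[]"] q by (simp add: tree_words_Cons e_def F_def)
  have d: "d = rot b [s]" using F_s by (simp add: d_def)
  \<comment> \<open>This commutator is characterised by \<open>Q \<circ> (b \<circ> c) = c \<circ> b\<close>, which avoids the rotations of inverses.\<close>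
  define Q where "Q = inv\<^bsub>?A\<^esub> (c \<otimes>\<^bsub>?A\<^esub> b) \<otimes>\<^bsub>?A\<^esub> (b \<otimes>\<^bsub>?A\<^esub> c)"
  have QH: "Q \<in> ?H" unfolding Q_def using H cH inH by (simp add: subgroup.m_closed subgroup.m_inv_closed del: tree_aut_simps)
  then have Qc: "Q \<in> cyclic_aut p" using Hc by blast
  have bA: "b \<in> carrier ?A" and cA: "c \<in> carrier ?A" and QA: "Q \<in> carrier ?A"
    using bc cc Qc cyclic_aut_closed by blast+
  have "(c \<otimes>\<^bsub>?A\<^esub> b) \<otimes>\<^bsub>?A\<^esub> Q = b \<otimes>\<^bsub>?A\<^esub> c"
  proof -
    have "(c \<otimes>\<^bsub>?A\<^esub> b) \<otimes>\<^bsub>?A\<^esub> Q =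
      ((c \<otimes>\<^bsub>?A\<^esub> b) \<otimes>\<^bsub>?A\<^esub> inv\<^bsub>?A\<^esub> (c \<otimes>\<^bsub>?A\<^esub> b)) \<otimes>\<^bsub>?A\<^esub> (b \<otimes>\<^bsub>?A\<^esub> c)"
      unfolding Q_def using bA cA by (simp only: A.m_assoc[of "c \<otimes>\<^bsub>?A\<^esub> b"] A.m_closed A.inv_closed)
    also have "\<dots> = b \<otimes>\<^bsub>?A\<^esub> c" using bA cA by (simp only: A.r_inv A.l_one A.m_closed)
    finally show ?thesis .
  qed
  then have Qcomm: "Q \<circ> (b \<circ> c) = c \<circ> b" by (simp only: tree_aut_simps)
  note b_act = fixing_level_1_action[OF bc b0]
  note c_act = fixing_level_1_action[OF cc c0]
  have bcc: "b \<circ> c \<in> cyclic_aut p" and cbc: "c \<circ> b \<in> cyclic_aut p"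
    using subgroup.m_closed[OF subgroup_cyclic_aut cc bc] subgroup.m_closed[OF subgroup_cyclic_aut bc cc]
    by (simp_all only: tree_aut_simps)
  have Q_fix: "Q [x, letter p z] = [x, letter p z]" if x: "x \<in> {1..p}" for x z
  proof -
    let ?z = "z - rot c [x] - rot b [x]"
    have 1: "(b \<circ> c) [x, letter p ?z] = [x, letter p z]" "(c \<circ> b) [x, letter p ?z] = [x, letter p z]"
      using b_act[OF x] c_act[OF x] by (simp_all add: algebra_simps)
    show ?thesis using fun_cong[OF Qcomm, of "[x, letter p ?z]"] unfolding o_apply[of Q] 1 .
  qed
  have Q_rot: "rot Q [x, letter p (z + rot c [x] + rot b [x])] =\<^sub>p
      rot b [x, letter p z] + rot c [x, letter p (z + rot b [x])]
      - rot c [x, letter p z] - rot b [x, letter p (z + rot c [x])]" if x: "x \<in> {1..p}" for x z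
  proof -
    let ?v = "[x, letter p z]"
    have v: "?v \<in> tree_words p" by (rule word_2_in_tree[OF x])
    have "(b \<circ> c) ?v = [x, letter p (z + rot c [x] + rot b [x])]" using b_act[OF x] c_act[OF x] by simp
    then have "rot (c \<circ> b) ?v =\<^sub>p rot (b \<circ> c) ?v + rot Q [x, letter p (z + rot c [x] + rot b [x])]"
      using rot_mult[OF bcc Qc v] unfolding Qcomm by simp
    moreover have "rot (c \<circ> b) ?v =\<^sub>p rot b ?v + rot c [x, letter p (z + rot b [x])]"
      using rot_mult[OF bc cc v] b_act[OF x] by simp
    moreover have "rot (b \<circ> c) ?v =\<^sub>p rot c ?v + rot b [x, letter p (z + rot c [x])]"
      using rot_mult[OF cc bc v] c_act[OF x] by simp
    ultimately show ?thesis by (rule pcong_solve)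
  qed
  have Q_s: "rot Q [s, letter p z] =\<^sub>p F z - F (z - d)" for z
  proof -
    have "letter p (z - d + rot c [s] + rot b [s]) = letter p z"
      using cong_add[OF cong_refl[of z] c1_s] by (intro letter_cong) (simp add: d)
    moreover have "rot b [s, letter p (z - d)] + rot c [s, letter p (z - d + rot b [s])]
      - rot c [s, letter p (z - d)] - rot b [s, letter p (z - d + rot c [s])] =\<^sub>p 0 + F (z - d + rot b [s]) - F (z - d) - 0"
      by (intro cong_add cong_diff c_s bxy s letter_range sq)
    ultimately show ?thesis using cong_trans[OF Q_rot[OF s(1), of "z - d"]] by (simp add: d)
  qed
  have Q_q: "rot Q [q, letter p z] =\<^sub>p F (z - e) - F z" for z
  proof -
    have bF: "rot b [q, letter p y] =\<^sub>p F y" for y unfolding F_def by (rule bqy[OF letter_range])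
    have ze: "z - e + rot c [q] =\<^sub>p z" using cong_add[OF cong_refl[of "z - e"] c1_q] by simp
    have "letter p (z - e + rot c [q] + rot b [q]) = letter p z"
      using cong_add[OF ze bq] by (intro letter_cong) simp
    moreover have "rot b [q, letter p (z - e)] + rot c [q, letter p (z - e + rot b [q])]
      - rot c [q, letter p (z - e)] - rot b [q, letter p (z - e + rot c [q])] =\<^sub>p F (z - e) + 0 - 0 - F (z - e + rot c [q])"
      by (intro cong_add cong_diff bF c_other q sq[symmetric])
    ultimately show ?thesis using cong_trans[OF Q_rot[OF q, of "z - e"]] F_per[OF ze] by simp
  qed
  have Q_other: "rot Q [x, letter p z] =\<^sub>p 0" if x: "x \<in> {1..p}" "x \<noteq> s" "x \<noteq> q" for x z
  proof -
    let ?z = "z - rot c [x] - rot b [x]"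
    have "rot b [x, letter p ?z] + rot c [x, letter p (?z + rot b [x])]
      - rot c [x, letter p ?z] - rot b [x, letter p (?z + rot c [x])] =\<^sub>p 0 + 0 - 0 - 0"
      by (intro cong_add cong_diff bxy c_other x letter_range)
    then show ?thesis using cong_trans[OF Q_rot[OF x(1), of ?z]] by simp
  qed
  define Q2 where "Q2 = inv\<^bsub>?A\<^esub> b \<otimes>\<^bsub>?A\<^esub> Q \<otimes>\<^bsub>?A\<^esub> b"
  have Q2H: "Q2 \<in> ?H" unfolding Q2_def using H QH inH by (simp add: subgroup.m_closed subgroup.m_inv_closed del: tree_aut_simps)
  then have Q2c: "Q2 \<in> cyclic_aut p" using Hc by blast
  have "b \<otimes>\<^bsub>?A\<^esub> Q2 = Q \<otimes>\<^bsub>?A\<^esub> b"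
  proof -
    have "b \<otimes>\<^bsub>?A\<^esub> Q2 = (b \<otimes>\<^bsub>?A\<^esub> inv\<^bsub>?A\<^esub> b) \<otimes>\<^bsub>?A\<^esub> (Q \<otimes>\<^bsub>?A\<^esub> b)"
      unfolding Q2_def using bA QA by (simp only: A.m_assoc A.m_closed A.inv_closed)
    also have "\<dots> = Q \<otimes>\<^bsub>?A\<^esub> b" using bA QA by (simp only: A.r_inv A.l_one A.m_closed)
    finally show ?thesis .
  qed
  then have Q2b: "Q2 \<circ> b = b \<circ> Q" by (simp only: tree_aut_simps)
  have Q2_fix: "Q2 [x, letter p z] = [x, letter p z]" if x: "x \<in> {1..p}" for x z
    using fun_cong[OF Q2b, of "[x, letter p (z - rot b [x])]"] Q_fix[OF x] b_act[OF x] by simp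
  have Q2_rot: "rot Q2 [x, letter p (z + rot b [x])] =\<^sub>p rot Q [x, letter p z]" if x: "x \<in> {1..p}" for x z
  proof -
    have v: "[x, letter p z] \<in> tree_words p" by (rule word_2_in_tree[OF x])
    have "rot b [x, letter p z] + rot Q2 [x, letter p (z + rot b [x])] =\<^sub>p
      rot Q [x, letter p z] + rot b [x, letter p z]"
      using rot_mult[OF bc Q2c v] rot_mult[OF Qc bc v] Q_fix[OF x] b_act[OF x] unfolding Q2b
      by (simp add: cong_def)
    then show ?thesis by (simp add: cong_iff_dvd_diff)
  qed
  have Q2_s: "rot Q2 [s, letter p z] =\<^sub>p F (z - d) - F (z - d - d)" for z
    using cong_trans[OF Q2_rot[OF s(1), of "z - d"] Q_s] by (simp add: d)
  have Q2_q: "rot Q2 [q, letter p z] =\<^sub>p F (z - e) - F z" for z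
  proof -
    have "letter p (z + rot b [q]) = letter p z" using cong_add[OF cong_refl[of z] bq] by (intro letter_cong) simp
    then show ?thesis using cong_trans[OF Q2_rot[OF q, of z] Q_q] by simp
  qed
  have Q2_other: "rot Q2 [x, letter p z] =\<^sub>p 0" if x: "x \<in> {1..p}" "x \<noteq> s" "x \<noteq> q" for x z
    using cong_trans[OF Q2_rot[OF x(1), of "z - rot b [x]"] Q_other[OF x]] by simp
  obtain w where w: "\<And>R z. \<forall>v\<in>{1..p} - {s, q}. \<forall>z. rot R [v, letter p z] =\<^sub>p 0 \<Longrightarrow>
    (\<Sum>m<p. rot R ((u ^^ m) [s, letter p z])) =\<^sub>p rot R [s, letter p z] + rot R [q, letter p (z + w)]"
    using orbit_sum_two_columns[OF u s(1) q sq] by blast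
  have sums: "(\<Sum>m<p. rot Q ((u ^^ m) [s, letter p z])) =\<^sub>p (F z - F (z - d)) + (F (z + w - e) - F (z + w))"
    "(\<Sum>m<p. rot Q2 ((u ^^ m) [s, letter p z])) =\<^sub>p (F (z - d) - F (z - d - d)) + (F (z + w - e) - F (z + w))" for z
    using cong_trans[OF w[of Q z] cong_add[OF Q_s Q_q]] cong_trans[OF w[of Q2 z] cong_add[OF Q2_s Q2_q]]
      Q_other Q2_other by auto
  have fix2: "fixlev 2 Q" "fixlev 2 Q2"
    using Q_fix Q2_fix level_2_letters unfolding fixes_level_def by metis+
  show ?thesis
  proof (rule ccontr)
    assume contra: "\<not> ?thesis"
    have z: "(\<Sum>m<p. rot Q ((u ^^ m) [s, letter p z])) =\<^sub>p 0"
      "(\<Sum>m<p. rot Q2 ((u ^^ m) [s, letter p z])) =\<^sub>p 0" for z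
      using contra QH Q2H fix2 word_2_in_tree(2)[OF s(1), of z] by blast+
    define f where "f = (\<lambda>z. F (z + int q))"
    have fi: "f i = d" "f (- i) = e" by (simp_all add: f_def d_def e_def add.commute)
    show False
    proof (rule affine_contradiction[of f i w])
      show "f y = f z" if "y =\<^sub>p z" for y z
        unfolding f_def by (intro F_per cong_add that cong_refl)
      show "f 0 =\<^sub>p 0" using F_q bq by (simp add: f_def)
      show "\<not> f i =\<^sub>p 0" unfolding fi using s(2) d by simp
      fix z
      show "f z - f (z - f i) + (f (z + w - f (- i)) - f (z + w)) =\<^sub>p 0"
        using pcong_0_iff[OF sums(1)[of "z + int q"]] z(1)[of "z + int q"] unfolding fi
        by (simp add: f_def algebra_simps)
      show "f (z - f i) - f (z - f i - f i) + (f (z + w - f (- i)) - f (z + w)) =\<^sub>p 0"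
        using pcong_0_iff[OF sums(2)[of "z + int q"]] z(2)[of "z + int q"] unfolding fi
        by (simp add: f_def algebra_simps)
    qed
  qed
qed

lemma funpow_level: "g \<in> cyclic_aut p \<Longrightarrow> w \<in> level p n \<Longrightarrow> (g ^^ m) w \<in> level p n"
  using bij_betw_apply[OF tree_aut_bij_level[OF cyclic_aut_closed[OF funpow_cyclic_aut]]] by blast

text \<open>As \<open>R\<close> fixes level 2, composing \<open>u\<close> with \<open>R\<close> does not change orbits on level 2; it only adds the rotations of
  \<open>R\<close> collected along the orbit.\<close>

lemma rot_power_p_perturbed:
  assumes u: "u \<in> cyclic_aut p" and R: "R \<in> cyclic_aut p" "fixlev 2 R" and w: "w \<in> level p 2"
  shows "rot ((R \<circ> u) ^^ p) w =\<^sub>p rot (u ^^ p) w + (\<Sum>m<p. rot R ((u ^^ m) (u w)))"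
proof -
  have Ru: "R \<circ> u \<in> cyclic_aut p"
    using subgroup.m_closed[OF subgroup_cyclic_aut u R(1)] by (simp only: tree_aut_simps)
  have same: "((R \<circ> u) ^^ m) w = (u ^^ m) w" for m
  proof (induction m)
    case (Suc m)
    have "u ((u ^^ m) w) \<in> level p 2" using funpow_level[OF u w, of "Suc m"] by simp
    then show ?case using Suc R(2) by (simp add: fixes_level_def)
  qed simp
  have wt: "w \<in> tree_words p" using w by (simp add: level_def)
  have "rot ((R \<circ> u) ^^ p) w =\<^sub>p (\<Sum>m<p. rot (R \<circ> u) ((u ^^ m) w))"
    using rot_funpow[OF Ru wt, of p] by (simp only: same)
  also have "(\<Sum>m<p. rot (R \<circ> u) ((u ^^ m) w)) =\<^sub>p (\<Sum>m<p. rot u ((u ^^ m) w) + rot R ((u ^^ m) (u w)))"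
  proof (rule cong_sum)
    fix m
    have "rot (R \<circ> u) ((u ^^ m) w) =\<^sub>p rot u ((u ^^ m) w) + rot R (u ((u ^^ m) w))"
      using funpow_words[OF u, of m w] wt by (intro rot_mult u R) simp
    then show "rot (R \<circ> u) ((u ^^ m) w) =\<^sub>p rot u ((u ^^ m) w) + rot R ((u ^^ m) (u w))"
      by (simp add: funpow_swap1)
  qed
  also have "(\<Sum>m<p. rot u ((u ^^ m) w) + rot R ((u ^^ m) (u w))) =
      (\<Sum>m<p. rot u ((u ^^ m) w)) + (\<Sum>m<p. rot R ((u ^^ m) (u w)))"
    by (rule sum.distrib)
  also have "(\<Sum>m<p. rot u ((u ^^ m) w)) + (\<Sum>m<p. rot R ((u ^^ m) (u w))) =\<^sub>p
      rot (u ^^ p) w + (\<Sum>m<p. rot R ((u ^^ m) (u w)))"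
    by (intro cong_add cong_refl cong_sym[OF rot_funpow[OF u wt]])
  finally show ?thesis .
qed

lemma one_not_0: "\<not> 1 =\<^sub>p 0"
  using p_gt2 by (simp add: cong_def)

lemma left_cancel_in_subgroup:
  assumes H: "subgroup H (tree_aut p)" and g: "g \<in> H" "h \<in> carrier (tree_aut p)" "h \<circ> g \<in> H"
  shows "h \<in> H"
proof -
  have gc: "g \<in> carrier (tree_aut p)" using subgroup.subset[OF H] g by blast
  have "inv\<^bsub>tree_aut p\<^esub> g \<otimes>\<^bsub>tree_aut p\<^esub> (g \<otimes>\<^bsub>tree_aut p\<^esub> h) \<in> H"
    using subgroup.m_closed[OF H subgroup.m_inv_closed[OF H g(1)], of "g \<otimes>\<^bsub>tree_aut p\<^esub> h"] g(3)
    by (simp only: tree_aut_simps)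
  also have "inv\<^bsub>tree_aut p\<^esub> g \<otimes>\<^bsub>tree_aut p\<^esub> (g \<otimes>\<^bsub>tree_aut p\<^esub> h) = h"
    using gc g(2) by (simp only: A.m_assoc[symmetric] A.inv_closed A.l_inv A.l_one)
  finally show ?thesis .
qed

lemma right_cancel_in_subgroup:
  assumes H: "subgroup H (tree_aut p)" and g: "g \<in> carrier (tree_aut p)" "h \<in> H" "h \<circ> g \<in> H"
  shows "g \<in> H"
proof -
  have hc: "h \<in> carrier (tree_aut p)" using subgroup.subset[OF H] g by blast
  have "(g \<otimes>\<^bsub>tree_aut p\<^esub> h) \<otimes>\<^bsub>tree_aut p\<^esub> inv\<^bsub>tree_aut p\<^esub> h \<in> H"
    using subgroup.m_closed[OF H _ subgroup.m_inv_closed[OF H g(2)], of "g \<otimes>\<^bsub>tree_aut p\<^esub> h"] g(3)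
    by (simp only: tree_aut_simps)
  also have "(g \<otimes>\<^bsub>tree_aut p\<^esub> h) \<otimes>\<^bsub>tree_aut p\<^esub> inv\<^bsub>tree_aut p\<^esub> h = g"
    using hc g(1) by (simp only: A.m_assoc A.inv_closed A.r_inv A.r_one)
  finally show ?thesis .
qed

end

context directed_group
begin

lemma sum_rot_2_eq_1: "g \<in> G \<Longrightarrow> sum_rot 2 g =\<^sub>p sum_rot 1 g"
proof -
  assume g: "g \<in> G"
  have "sum_rot 2 g - sum_rot 1 g =\<^sub>p 0"
  proof (rule hom_vanishes_on_G[OF _ _ g])
    fix g h assume "g \<in> G" "h \<in> G"
    then have "sum_rot 2 (h \<circ> g) - sum_rot 1 (h \<circ> g) =\<^sub>p (sum_rot 2 g + sum_rot 2 h) - (sum_rot 1 g + sum_rot 1 h)"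
      by (intro cong_diff sum_rot_mult G_cyclic)
    then show "sum_rot 2 (h \<circ> g) - sum_rot 1 (h \<circ> g) =\<^sub>p (sum_rot 2 g - sum_rot 1 g) + (sum_rot 2 h - sum_rot 1 h)"
      by (simp add: algebra_simps)
  next
    fix x assume "x \<in> insert (rooted_a p) B"
    then show "sum_rot 2 x - sum_rot 1 x =\<^sub>p 0"
    proof
      assume "x = rooted_a p"
      then show ?thesis using cong_diff[OF sum_rot_rooted_a[of 2] sum_rot_rooted_a[of 1]] by simp
    next
      assume "x \<in> B"
      then show ?thesis using B_directed sum_rot_directed by (auto simp: cong_iff_dvd_diff)
    qed
  qed
  then show ?thesis by (simp add: cong_iff_dvd_diff)
qed

lemma root_rot_mult:
  assumes "g \<in> G" "h \<in> G"
  shows "rot (h \<circ> g) [] =\<^sub>p rot g [] + rot h []"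
  using rot_mult[OF G_cyclic G_cyclic tree_words_Nil, OF assms] tree_autD(2)[OF cyclic_aut_closed[OF G_cyclic[OF assms(1)]]]
  by simp

lemma B_root: "b \<in> B \<Longrightarrow> rot b [] =\<^sub>p 0"
  using B_directed by (auto simp: directed_def)

lemma a_root: "rot (rooted_a p) [] =\<^sub>p 1"
  using rot_rooted_a[of "[]"] by simp

lemma deep_subset_G: "{g \<in> G. deep g} \<subseteq> G"
  by blast

lemma subgroup_deep: "subgroup (generate (tree_aut p) {g \<in> G. deep g}) (tree_aut p)"
  using G_cyclic cyclic_aut_closed by (intro A.generate_is_subgroup) blast

text \<open>Every element with non-zero rotation at the root and non-zero \<open>sum_rot 1\<close> is deep. These conditions are preserved
  when a directed generator is multiplied on, unless the sum happens to cancel, so there are enough of them to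
  generate: first \<open>a b0\<close> and \<open>a b0 b0\<close>, hence \<open>b0\<close> and \<open>a\<close>, then \<open>a b0 b\<close> or \<open>a b\<close> for the other \<open>b\<close>. The
  second product is needed only if the first one has sum zero.\<close>

lemma deep_generate_if_sum_nonzero:
  assumes b0: "b0 \<in> B" "\<not> sum_rot 1 b0 =\<^sub>p 0"
  shows "generate GG {g \<in> G. deep g} = G"
proof -
  let ?H = "generate (tree_aut p) {g \<in> G. deep g}" and ?a = "rooted_a p"
  note H = subgroup_deep and mult = sum_rot_mult[OF G_cyclic G_cyclic]
  have inH: "g \<in> ?H" if "g \<in> G" "\<not> rot g [] =\<^sub>p 0" "\<not> sum_rot 1 g =\<^sub>p 0" for g
  proof -
    have "\<not> sum_rot 2 g =\<^sub>p 0" using pcong_0_iff[OF sum_rot_2_eq_1[OF that(1)]] that(3) by blast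
    then have "deep g" by (rule deep_if_sums_nonzero[OF G_cyclic[OF that(1)] that(2,3)])
    then show ?thesis using that(1) by (intro generate.incl) simp
  qed
  have sa: "sum_rot 1 ?a =\<^sub>p 0" by (rule sum_rot_rooted_a) simp
  note aG = gens_in_G(1) and bG = gens_in_G(2)[OF b0(1)]
  define x1 where "x1 = b0 \<circ> ?a"
  have x1G: "x1 \<in> G" unfolding x1_def by (rule comp_in_G[OF aG bG])
  have x1r: "rot x1 [] =\<^sub>p 1" unfolding x1_def
    using cong_trans[OF root_rot_mult[OF aG bG] cong_add[OF a_root B_root[OF b0(1)]]] by simp
  have x1s: "sum_rot 1 x1 =\<^sub>p sum_rot 1 b0" unfolding x1_def
    using cong_trans[OF mult[OF aG bG] cong_add[OF sa cong_refl]] by simp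
  have x1H: "x1 \<in> ?H"
    using inH[OF x1G] pcong_0_iff[OF x1r] pcong_0_iff[OF x1s] one_not_0 b0(2) by blast
  have with_b: "b \<circ> x1 \<in> G" "\<not> rot (b \<circ> x1) [] =\<^sub>p 0" "sum_rot 1 (b \<circ> x1) =\<^sub>p sum_rot 1 b0 + sum_rot 1 b" if b: "b \<in> B" for b
  proof -
    have bG: "b \<in> G" using gens_in_G(2) b .
    show "b \<circ> x1 \<in> G" by (rule comp_in_G[OF x1G bG])
    have "rot (b \<circ> x1) [] =\<^sub>p 1 + 0" by (rule cong_trans[OF root_rot_mult[OF x1G bG] cong_add[OF x1r B_root[OF b]]])
    then show "\<not> rot (b \<circ> x1) [] =\<^sub>p 0" using pcong_0_iff one_not_0 by (metis add.right_neutral)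
    show "sum_rot 1 (b \<circ> x1) =\<^sub>p sum_rot 1 b0 + sum_rot 1 b"
      by (rule cong_trans[OF mult[OF x1G bG] cong_add[OF x1s cong_refl]])
  qed
  have "b0 \<circ> x1 \<in> ?H"
  proof -
    have "\<not> 2 * sum_rot 1 b0 =\<^sub>p 0" using pcong_mult_0[of 2 "sum_rot 1 b0"] pcong_2_not_0 b0(2) by blast
    then have "\<not> sum_rot 1 (b0 \<circ> x1) =\<^sub>p 0" using pcong_0_iff[OF with_b(3)[OF b0(1)]] by simp
    then show ?thesis by (intro inH with_b b0)
  qed
  then have b0H: "b0 \<in> ?H"
    by (rule left_cancel_in_subgroup[OF H x1H cyclic_aut_closed[OF G_cyclic[OF bG]]])
  have aH: "?a \<in> ?H"
    using right_cancel_in_subgroup[OF H cyclic_aut_closed[OF rooted_a_cyclic] b0H] x1H unfolding x1_def by blast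
  have BH: "b \<in> ?H" if b: "b \<in> B" for b
  proof (cases "sum_rot 1 b0 + sum_rot 1 b =\<^sub>p 0")
    case False
    then have "b \<circ> x1 \<in> ?H" using pcong_0_iff[OF with_b(3)[OF b]] by (intro inH with_b b) blast
    then show ?thesis by (rule left_cancel_in_subgroup[OF H x1H cyclic_aut_closed[OF G_cyclic[OF gens_in_G(2)[OF b]]]])
  next
    case True
    have bG: "b \<in> G" using gens_in_G(2) b .
    have "\<not> sum_rot 1 b =\<^sub>p 0"
    proof
      assume z: "sum_rot 1 b =\<^sub>p 0"
      have "sum_rot 1 b0 =\<^sub>p 0" using cong_diff[OF True z] by simp
      then show False using b0(2) by blast
    qed
    moreover have "sum_rot 1 (b \<circ> ?a) =\<^sub>p sum_rot 1 b"
      using cong_trans[OF mult[OF aG bG] cong_add[OF sa cong_refl]] by simp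
    ultimately have "\<not> sum_rot 1 (b \<circ> ?a) =\<^sub>p 0" using pcong_0_iff by blast
    moreover have "rot (b \<circ> ?a) [] =\<^sub>p 1"
      using cong_trans[OF root_rot_mult[OF aG bG] cong_add[OF a_root B_root[OF b]]] by simp
    then have "\<not> rot (b \<circ> ?a) [] =\<^sub>p 0" using pcong_0_iff one_not_0 by blast
    ultimately have "b \<circ> ?a \<in> ?H" by (intro inH comp_in_G[OF aG bG])
    then show ?thesis by (rule left_cancel_in_subgroup[OF H aH cyclic_aut_closed[OF G_cyclic[OF bG]]])
  qed
  show ?thesis using aH BH by (intro generate_eq_G deep_subset_G) blast+
qed

text \<open>Every \<open>u\<close> moving level 1 lies in the subgroup generated by deep elements: if \<open>u\<close> is not deep itself, then \<open>u Q\<close> and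
  \<open>u Q Q\<close> are deep for a suitable \<open>Q\<close>, and the quotient of the two is \<open>Q\<close>. Doubling the orbit sum keeps it non-zero
  because \<open>p\<close> is odd.\<close>

lemma deep_generate_if_sums_zero:
  assumes zero: "\<And>b. b \<in> B \<Longrightarrow> sum_rot 1 b =\<^sub>p 0"
  shows "generate GG {g \<in> G. deep g} = G"
proof -
  let ?H = "generate (tree_aut p) {g \<in> G. deep g}" and ?a = "rooted_a p"
  note H = subgroup_deep
  obtain b q where b: "b \<in> B" "directed q b" using B_ne B_directed by blast
  have sum0: "sum_rot 1 g =\<^sub>p 0" if "g \<in> G" for g
  proof (rule hom_vanishes_on_G[OF sum_rot_mult[OF G_cyclic G_cyclic] _ that])
    fix x assume "x \<in> insert ?a B"
    then show "sum_rot 1 x =\<^sub>p 0" using zero sum_rot_rooted_a[of 1] by auto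
  qed
  have inH: "g \<in> ?H" if "g \<in> G" "\<not> rot g [] =\<^sub>p 0" "\<not> fixlev 3 (g ^^ p)" for g
  proof -
    have "deep g" by (rule deep_if_power_p_nontrivial[OF G_cyclic[OF that(1)] that(2) sum0[OF that(1)] that(3)])
    then show ?thesis using that(1) by (intro generate.incl) simp
  qed
  have movers: "u \<in> ?H" if uG: "u \<in> G" and ur: "\<not> rot u [] =\<^sub>p 0" for u
  proof (cases "fixlev 3 (u ^^ p)")
    case False
    then show ?thesis by (rule inH[OF uG ur])
  next
    case True
    note uc = G_cyclic[OF uG]
    have "generate (tree_aut p) {?a, b} \<subseteq> G"
      using gens_in_G b by (intro A.generate_subgroup_incl[OF _ subgroup_G]) simp
    then obtain Q v where Q: "Q \<in> G" "fixlev 2 Q" and v: "v \<in> level p 2" "\<not> (\<Sum>m<p. rot Q ((u ^^ m) v)) =\<^sub>p 0"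
      using moving_witness_exists[OF uc ur b(2)] by blast
    have "v \<in> u ` level p 2"
      using v(1) bij_betw_imp_surj_on[OF tree_aut_bij_level[OF cyclic_aut_closed[OF uc], of 2]] by simp
    then obtain w where w: "w \<in> level p 2" "u w = v" by blast
    have Ru: "R \<circ> u \<in> ?H" if R: "R \<in> G" "fixlev 2 R" "\<not> (\<Sum>m<p. rot R ((u ^^ m) v)) =\<^sub>p 0" for R
    proof (rule inH[OF comp_in_G[OF uG R(1)]])
      have Rr: "rot R [] =\<^sub>p 0" using R(2) unfolding fixlev_2[OF G_cyclic[OF R(1)]] fixlev_1_iff[OF G_cyclic[OF R(1)]] by blast
      have "rot (R \<circ> u) [] =\<^sub>p rot u []"
        using cong_trans[OF root_rot_mult[OF uG R(1)] cong_add[OF cong_refl Rr]] by simp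
      then show "\<not> rot (R \<circ> u) [] =\<^sub>p 0" using pcong_0_iff ur by blast
      show "\<not> fixlev 3 ((R \<circ> u) ^^ p)"
      proof
        assume f: "fixlev 3 ((R \<circ> u) ^^ p)"
        have "rot ((R \<circ> u) ^^ p) w =\<^sub>p 0"
          using f w(1) fixlev_3[OF funpow_cyclic_aut[OF G_cyclic[OF comp_in_G[OF uG R(1)]]]] by blast
        moreover have "rot (u ^^ p) w =\<^sub>p 0"
          using True w(1) fixlev_3[OF funpow_cyclic_aut[OF uc]] by blast
        moreover have "rot ((R \<circ> u) ^^ p) w =\<^sub>p rot (u ^^ p) w + (\<Sum>m<p. rot R ((u ^^ m) v))"
          using rot_power_p_perturbed[OF uc G_cyclic[OF R(1)] R(2) w(1)] unfolding w(2) .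
        ultimately have "(\<Sum>m<p. rot R ((u ^^ m) v)) =\<^sub>p 0"
          using pcong_drop_zeros[of "rot (u ^^ p) w" 0 "\<Sum>m<p. rot R ((u ^^ m) v)" 0]
          by (simp add: cong_def)
        then show False using R(3) by blast
      qed
    qed
    have Qu: "Q \<circ> u \<in> ?H" by (rule Ru[OF Q v(2)])
    have QQ: "Q \<circ> Q \<in> G" "fixlev 2 (Q \<circ> Q)" using comp_in_G Q by (auto simp: fixes_level_def)
    have "\<not> (\<Sum>m<p. rot (Q \<circ> Q) ((u ^^ m) v)) =\<^sub>p 0"
    proof -
      have "(\<Sum>m<p. rot (Q \<circ> Q) ((u ^^ m) v)) =\<^sub>p (\<Sum>m<p. 2 * rot Q ((u ^^ m) v))"
      proof (rule cong_sum)
        fix m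
        have l: "(u ^^ m) v \<in> level p 2" by (rule funpow_level[OF uc v(1)])
        have "rot (Q \<circ> Q) ((u ^^ m) v) =\<^sub>p rot Q ((u ^^ m) v) + rot Q (Q ((u ^^ m) v))"
          using l by (intro rot_mult G_cyclic Q) (simp add: level_def)
        then show "rot (Q \<circ> Q) ((u ^^ m) v) =\<^sub>p 2 * rot Q ((u ^^ m) v)"
          using Q(2) l by (simp add: fixes_level_def)
      qed
      also have "(\<Sum>m<p. 2 * rot Q ((u ^^ m) v)) = 2 * (\<Sum>m<p. rot Q ((u ^^ m) v))"
        by (simp add: sum_distrib_left)
      finally show ?thesis
        using pcong_0_iff pcong_mult_0[of 2 "\<Sum>m<p. rot Q ((u ^^ m) v)"] pcong_2_not_0 v(2) by blast
    qed
    then have "(Q \<circ> Q) \<circ> u \<in> ?H" by (rule Ru[OF QQ])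
    then have "Q \<circ> (Q \<circ> u) \<in> ?H" by (simp only: o_assoc)
    then have "Q \<in> ?H" by (rule left_cancel_in_subgroup[OF H Qu cyclic_aut_closed[OF G_cyclic[OF Q(1)]]])
    then show ?thesis using Qu by (rule right_cancel_in_subgroup[OF H cyclic_aut_closed[OF uc]])
  qed
  have aH: "?a \<in> ?H" using movers[OF gens_in_G(1)] pcong_0_iff[OF a_root] one_not_0 by blast
  have "b \<in> ?H" if b: "b \<in> B" for b
  proof -
    note bG = gens_in_G(2)[OF b] and aG = gens_in_G(1)
    have "rot (b \<circ> ?a) [] =\<^sub>p 1"
      using cong_trans[OF root_rot_mult[OF aG bG] cong_add[OF a_root B_root[OF b]]] by simp
    then have "b \<circ> ?a \<in> ?H" using pcong_0_iff one_not_0 by (intro movers comp_in_G[OF aG bG]) blast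
    then show ?thesis by (rule left_cancel_in_subgroup[OF H aH cyclic_aut_closed[OF G_cyclic[OF bG]]])
  qed
  then show ?thesis using aH by (intro generate_eq_G deep_subset_G) blast+
qed

theorem ramification_structure_level_ge_3:
  assumes "k \<ge> 3"
  shows "\<exists>T1 T2. ramification_structure (GG Mod level_stab p G k) T1 T2"
  using deep_generate_if_sum_nonzero deep_generate_if_sums_zero ramification_structure_from_deep[OF assms] by blast

section \<open>Level 2 and power moments\<close>

lemma shifted_power_sum_expand:
  fixes F :: "nat \<Rightarrow> int"
  shows "(\<Sum>x\<in>{1..p}. (int x - t) ^ n * F x) =
    (\<Sum>j\<le>n. of_nat (n choose j) * (- t) ^ (n - j) * (\<Sum>x\<in>{1..p}. int x ^ j * F x))"
proof -
  have "(int x - t) ^ n * F x = (\<Sum>j\<le>n. of_nat (n choose j) * (- t) ^ (n - j) * (int x ^ j * F x))" for x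
  proof -
    have "(int x - t) ^ n * F x = (\<Sum>j\<le>n. of_nat (n choose j) * int x ^ j * (- t) ^ (n - j)) * F x"
      using binomial_ring[of "int x" "- t" n] by simp
    also have "\<dots> = (\<Sum>j\<le>n. of_nat (n choose j) * (- t) ^ (n - j) * (int x ^ j * F x))"
      unfolding sum_distrib_right by (rule sum.cong) (simp_all only: mult_ac)
    finally show ?thesis .
  qed
  then have "(\<Sum>x\<in>{1..p}. (int x - t) ^ n * F x) =
      (\<Sum>x\<in>{1..p}. \<Sum>j\<le>n. of_nat (n choose j) * (- t) ^ (n - j) * (int x ^ j * F x))"
    by simp
  also have "\<dots> = (\<Sum>j\<le>n. of_nat (n choose j) * (- t) ^ (n - j) * (\<Sum>x\<in>{1..p}. int x ^ j * F x))"
    by (subst sum.swap) (simp add: sum_distrib_left)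
  finally show ?thesis .
qed

lemma shifted_power_sum_vanishes:
  fixes F :: "nat \<Rightarrow> int"
  assumes "\<And>j. j \<le> n \<Longrightarrow> (\<Sum>x\<in>{1..p}. int x ^ j * F x) =\<^sub>p 0"
  shows "(\<Sum>x\<in>{1..p}. (int x - t) ^ n * F x) =\<^sub>p 0"
proof -
  have "(\<Sum>x\<in>{1..p}. (int x - t) ^ n * F x) =
      (\<Sum>j\<le>n. of_nat (n choose j) * (- t) ^ (n - j) * (\<Sum>x\<in>{1..p}. int x ^ j * F x))"
    by (rule shifted_power_sum_expand)
  also have "(\<Sum>j\<le>n. of_nat (n choose j) * (- t) ^ (n - j) * (\<Sum>x\<in>{1..p}. int x ^ j * F x)) =\<^sub>p
      (\<Sum>j\<le>n. of_nat (n choose j) * (- t) ^ (n - j) * 0)"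
    by (intro cong_sum cong_mult cong_refl assms) simp
  finally show ?thesis by simp
qed

lemma shifted_power_sum:
  fixes F :: "nat \<Rightarrow> int"
  assumes "\<And>j. j < n \<Longrightarrow> (\<Sum>x\<in>{1..p}. int x ^ j * F x) =\<^sub>p 0"
  shows "(\<Sum>x\<in>{1..p}. (int x - t) ^ n * F x) =\<^sub>p (\<Sum>x\<in>{1..p}. int x ^ n * F x)"
proof -
  have "(\<Sum>x\<in>{1..p}. (int x - t) ^ n * F x) =
      (\<Sum>j\<le>n. of_nat (n choose j) * (- t) ^ (n - j) * (\<Sum>x\<in>{1..p}. int x ^ j * F x))"
    by (rule shifted_power_sum_expand)
  also have "(\<Sum>j\<le>n. of_nat (n choose j) * (- t) ^ (n - j) * (\<Sum>x\<in>{1..p}. int x ^ j * F x)) = (\<Sum>j<n. of_nat (n choose j) * (- t) ^ (n - j) * (\<Sum>x\<in>{1..p}. int x ^ j * F x)) + (\<Sum>x\<in>{1..p}. int x ^ n * F x)"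
    by (simp flip: lessThan_Suc_atMost)
  finally have eq: "(\<Sum>x\<in>{1..p}. (int x - t) ^ n * F x) =
    (\<Sum>j<n. of_nat (n choose j) * (- t) ^ (n - j) * (\<Sum>x\<in>{1..p}. int x ^ j * F x)) + (\<Sum>x\<in>{1..p}. int x ^ n * F x)" .
  have "(\<Sum>j<n. of_nat (n choose j) * (- t) ^ (n - j) * (\<Sum>x\<in>{1..p}. int x ^ j * F x)) =\<^sub>p
      (\<Sum>j<n. of_nat (n choose j) * (- t) ^ (n - j) * 0)"
    by (intro cong_sum cong_mult cong_refl assms) simp
  from cong_add[OF this cong_refl] show ?thesis unfolding eq by simp
qed

lemma fermat_int: "\<not> a =\<^sub>p 0 \<Longrightarrow> a ^ (p - 1) =\<^sub>p 1"
proof -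
  assume a: "\<not> a =\<^sub>p 0"
  have "int (nat (a mod int p)) =\<^sub>p a" using p_pos by (simp add: cong_def)
  then obtain n :: nat where n: "int n =\<^sub>p a" by blast
  have "\<not> p dvd n" using a pcong_0_iff[OF n] by (simp add: cong_0_iff)
  then have "[n ^ (p - 1) = 1] (mod p)" by (rule fermat_theorem[OF prime_p])
  then have "int (n ^ (p - 1)) =\<^sub>p int 1" by (simp only: cong_int_iff)
  then have "int n ^ (p - 1) =\<^sub>p 1" by (simp only: of_nat_power of_nat_1)
  then show ?thesis by (rule cong_trans[OF cong_sym[OF cong_pow[OF n]]])
qed

text \<open>By the little theorem of Fermat, \<open>1 - (x - l)^(p - 1)\<close> is the indicator function of \<open>l\<close> modulo \<open>p\<close>; its values are a
  combination of powers of \<open>x\<close>.\<close>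

lemma power_sums_determine:
  fixes F :: "nat \<Rightarrow> int"
  assumes "\<And>j. (\<Sum>x\<in>{1..p}. int x ^ j * F x) =\<^sub>p 0" and l: "l \<in> {1..p}"
  shows "F l =\<^sub>p 0"
proof -
  have "(\<Sum>x\<in>{1..p}. (int x - int l) ^ (p - 1) * F x) =\<^sub>p (\<Sum>x\<in>{1..p}. F x - (if x = l then F x else 0))"
  proof (rule cong_sum)
    fix x assume x: "x \<in> {1..p}"
    show "(int x - int l) ^ (p - 1) * F x =\<^sub>p F x - (if x = l then F x else 0)"
    proof (cases "x = l")
      case True
      then show ?thesis using p_gt2 by (simp add: power_0_left)
    next
      case False
      then have "\<not> int x - int l =\<^sub>p 0"
        using letters_eq[OF x l] by (auto simp: cong_iff_dvd_diff)
      then show ?thesis using cong_mult[OF fermat_int cong_refl[of "F x"]] False by simp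
    qed
  qed
  also have "(\<Sum>x\<in>{1..p}. F x - (if x = l then F x else 0)) = (\<Sum>x\<in>{1..p}. F x) - F l"
    using l by (simp add: sum_subtractf)
  finally have 1: "(\<Sum>x\<in>{1..p}. (int x - int l) ^ (p - 1) * F x) =\<^sub>p (\<Sum>x\<in>{1..p}. F x) - F l" .
  have 2: "(\<Sum>x\<in>{1..p}. (int x - int l) ^ (p - 1) * F x) =\<^sub>p 0"
    by (rule shifted_power_sum_vanishes[OF assms(1)])
  have 3: "(\<Sum>x\<in>{1..p}. F x) =\<^sub>p 0" using assms(1)[of 0] by simp
  have "(\<Sum>x\<in>{1..p}. F x) - F l =\<^sub>p 0" using 2 pcong_0_iff[OF 1] by blast
  then have "(\<Sum>x\<in>{1..p}. F x) - ((\<Sum>x\<in>{1..p}. F x) - F l) =\<^sub>p 0 - 0" by (intro cong_diff 3)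
  then show ?thesis by simp
qed

definition moment :: "nat \<Rightarrow> (nat list \<Rightarrow> nat list) \<Rightarrow> int" where
  "moment n g = (\<Sum>x\<in>{1..p}. int x ^ n * rot g [x])"

lemma bij_betw_shift: "bij_betw (\<lambda>x. letter p (int x + t)) {1..p} {1..p}"
proof (rule bij_betw_byWitness[where f' = "\<lambda>x. letter p (int x - t)"])
  show "\<forall>x\<in>{1..p}. letter p (int (letter p (int x + t)) - t) = x"
    using letter_letter(1)[of "int x + t" "- t" for x] by simp
  show "\<forall>x\<in>{1..p}. letter p (int (letter p (int x - t)) + t) = x" by simp
qed (use letter_range in auto)

lemma moment_shift:
  assumes "\<And>j. j < n \<Longrightarrow> moment j g =\<^sub>p 0"
  shows "(\<Sum>x\<in>{1..p}. int x ^ n * rot g [letter p (int x + t)]) =\<^sub>p moment n g"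
proof -
  have "(\<Sum>x\<in>{1..p}. int x ^ n * rot g [letter p (int x + t)]) =\<^sub>p
    (\<Sum>x\<in>{1..p}. (int (letter p (int x + t)) - t) ^ n * rot g [letter p (int x + t)])"
  proof (intro cong_sum cong_mult cong_pow cong_refl)
    fix x
    show "int x =\<^sub>p int (letter p (int x + t)) - t"
      using cong_diff[OF cong_sym[OF letter_pcong[of "int x + t"]] cong_refl[of t]] by simp
  qed
  also have "(\<Sum>x\<in>{1..p}. (int (letter p (int x + t)) - t) ^ n * rot g [letter p (int x + t)]) =
    (\<Sum>x\<in>{1..p}. (int x - t) ^ n * rot g [x])"
    by (rule sum.reindex_bij_betw[OF bij_betw_shift])
  also have "(\<Sum>x\<in>{1..p}. (int x - t) ^ n * rot g [x]) =\<^sub>p moment n g"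
    unfolding moment_def by (rule shifted_power_sum) (use assms in \<open>simp add: moment_def\<close>)
  finally show ?thesis .
qed

text \<open>The rotation at the root translates the argument of \<open>h\<close>; by the binomial theorem a translation changes the
  \<open>n\<close>-th moment only by multiples of lower moments.\<close>

lemma moment_mult:
  assumes g: "g \<in> cyclic_aut p" and h: "h \<in> cyclic_aut p" "\<And>j. j < n \<Longrightarrow> moment j h =\<^sub>p 0"
  shows "moment n (h \<circ> g) =\<^sub>p moment n g + moment n h"
proof -
  have "moment n (h \<circ> g) =\<^sub>p (\<Sum>x\<in>{1..p}. int x ^ n * (rot g [x] + rot h [letter p (int x + rot g [])]))"
    unfolding moment_def
  proof (intro cong_sum cong_mult cong_refl)
    fix x assume x: "x \<in> {1..p}"
    show "rot (h \<circ> g) [x] =\<^sub>p rot g [x] + rot h [letter p (int x + rot g [])]"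
      using rot_mult[OF g h(1), of "[x]"] action_level_1[OF g x] x by (simp add: tree_words_Cons)
  qed
  also have "(\<Sum>x\<in>{1..p}. int x ^ n * (rot g [x] + rot h [letter p (int x + rot g [])])) =
    moment n g + (\<Sum>x\<in>{1..p}. int x ^ n * rot h [letter p (int x + rot g [])])"
    by (simp add: moment_def algebra_simps sum.distrib)
  also have "moment n g + (\<Sum>x\<in>{1..p}. int x ^ n * rot h [letter p (int x + rot g [])]) =\<^sub>p moment n g + moment n h"
    by (intro cong_add cong_refl moment_shift h(2))
  finally show ?thesis .
qed

end

context directed_group
begin

text \<open>The first moment that is not identically zero on \<open>G\<close> is a homomorphism on \<open>G\<close>. It vanishes at \<open>a\<close>, so not at
  some \<open>b\<close>, and then at no directed generator, since their level-1 rotations are proportional up to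
  translation.\<close>

lemma invariant_exists:
  assumes proportional: "\<And>b b'. b \<in> B \<Longrightarrow> b' \<in> B \<Longrightarrow> \<exists>c t. \<not> c =\<^sub>p 0 \<and>
    (\<forall>x\<in>{1..p}. rot b' [x] =\<^sub>p c * rot b [letter p (int x + t)])"
  obtains \<phi> :: "(nat list \<Rightarrow> nat list) \<Rightarrow> int" where
    "\<And>g h. g \<in> G \<Longrightarrow> h \<in> G \<Longrightarrow> \<phi> (h \<circ> g) =\<^sub>p \<phi> g + \<phi> h"
    "\<phi> (rooted_a p) =\<^sub>p 0" "\<And>b. b \<in> B \<Longrightarrow> \<not> \<phi> b =\<^sub>p 0"
    "\<And>g. g \<in> cyclic_aut p \<Longrightarrow> fixlev 2 g \<Longrightarrow> \<phi> g =\<^sub>p 0"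
proof -
  define n where "n = (LEAST n. \<exists>g\<in>G. \<not> moment n g =\<^sub>p 0)"
  obtain b0 where b0: "b0 \<in> B" using B_ne by blast
  have ex: "\<exists>n. \<exists>g\<in>G. \<not> moment n g =\<^sub>p 0"
  proof (rule ccontr)
    assume "\<not> ?thesis"
    then have "moment j b0 =\<^sub>p 0" for j using gens_in_G(2)[OF b0] by blast
    then have "rot b0 [x] =\<^sub>p 0" if "x \<in> {1..p}" for x
      using power_sums_determine[of "\<lambda>x. rot b0 [x]" x] that unfolding moment_def by blast
    then show False using B_directed[OF b0] by (auto simp: directed_def)
  qed
  obtain g0 where g0: "g0 \<in> G" "\<not> moment n g0 =\<^sub>p 0" using LeastI_ex[OF ex] unfolding n_def by blast
  have low: "moment j g =\<^sub>p 0" if "j < n" "g \<in> G" for j g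
    using not_less_Least[of j] that unfolding n_def by blast
  have hom: "moment n (h \<circ> g) =\<^sub>p moment n g + moment n h" if "g \<in> G" "h \<in> G" for g h
    using that low by (intro moment_mult G_cyclic)
  have zeros: "moment n g =\<^sub>p 0" if "\<And>x. x \<in> {1..p} \<Longrightarrow> rot g [x] =\<^sub>p 0" for g
  proof -
    have "moment n g =\<^sub>p (\<Sum>x\<in>{1..p}. int x ^ n * 0)"
      unfolding moment_def by (intro cong_sum cong_mult cong_refl that)
    then show ?thesis by simp
  qed
  have a0: "moment n (rooted_a p) =\<^sub>p 0"
    by (rule zeros) (use rot_rooted_a[of "[x]" for x] in \<open>simp add: tree_words_Cons\<close>)
  have "\<exists>b\<in>B. \<not> moment n b =\<^sub>p 0"
    using hom_vanishes_on_G[OF hom _ g0(1)] g0(2) a0 by blast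
  then obtain b where b: "b \<in> B" "\<not> moment n b =\<^sub>p 0" by blast
  show ?thesis
  proof (rule that[OF hom a0])
    fix b' assume b': "b' \<in> B"
    obtain c t where c: "\<not> c =\<^sub>p 0" "\<And>x. x \<in> {1..p} \<Longrightarrow> rot b' [x] =\<^sub>p c * rot b [letter p (int x + t)]"
      using proportional[OF b(1) b'] by blast
    have "moment n b' =\<^sub>p (\<Sum>x\<in>{1..p}. int x ^ n * (c * rot b [letter p (int x + t)]))"
      unfolding moment_def by (intro cong_sum cong_mult cong_refl c(2))
    also have "(\<Sum>x\<in>{1..p}. int x ^ n * (c * rot b [letter p (int x + t)])) =
      c * (\<Sum>x\<in>{1..p}. int x ^ n * rot b [letter p (int x + t)])"
      by (simp add: sum_distrib_left mult_ac)
    also have "c * (\<Sum>x\<in>{1..p}. int x ^ n * rot b [letter p (int x + t)]) =\<^sub>p c * moment n b"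
      by (intro cong_mult cong_refl moment_shift low gens_in_G(2) b(1))
    finally show "\<not> moment n b' =\<^sub>p 0" using pcong_0_iff pcong_mult_0[of c "moment n b"] c(1) b(2) by blast
  next
    fix g assume "g \<in> cyclic_aut p" "fixlev 2 g"
    then show "moment n g =\<^sub>p 0" using fixlev_2 zeros by blast
  qed
qed

text \<open>Suppose a power of a generator \<open>x\<close> is conjugate to \<open>y ^^ n\<close> modulo the stabiliser of level 2, where \<open>y\<close> is \<open>a b\<close> or
  \<open>a b b\<close>. If \<open>x\<close> is \<open>a\<close>, the homomorphism \<open>\<phi>\<close> shows that \<open>p\<close> divides \<open>n\<close>, and the rotation at the root that the power
  of \<open>a\<close> is trivial. If \<open>x\<close> is directed, the rotation at the root shows that \<open>p\<close> divides \<open>n\<close>; then \<open>y ^^ n\<close> has constant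
  rotations on level 1, so the power of \<open>x\<close> has the same constant rotations, and the constant is 0 because \<open>x\<close> does
  not rotate at its spine letter.\<close>

theorem ramification_structure_level_2:
  assumes proportional: "\<And>b b'. b \<in> B \<Longrightarrow> b' \<in> B \<Longrightarrow> \<exists>c t. \<not> c =\<^sub>p 0 \<and>
    (\<forall>x\<in>{1..p}. rot b' [x] =\<^sub>p c * rot b [letter p (int x + t)])"
  shows "\<exists>T1 T2. ramification_structure (GG Mod level_stab p G 2) T1 T2"
proof -
  interpret N: normal "level_stab p G 2" GG by (rule stab_normal)
  let ?a = "rooted_a p"
  note aG = gens_in_G(1) and bG = gens_in_G(2)
  obtain \<phi> :: "(nat list \<Rightarrow> nat list) \<Rightarrow> int" where
    hom: "\<And>g h. g \<in> G \<Longrightarrow> h \<in> G \<Longrightarrow> \<phi> (h \<circ> g) =\<^sub>p \<phi> g + \<phi> h"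
    and phi_a: "\<phi> ?a =\<^sub>p 0" and phi_b: "\<And>b. b \<in> B \<Longrightarrow> \<not> \<phi> b =\<^sub>p 0"
    and phi_deep: "\<And>g. g \<in> cyclic_aut p \<Longrightarrow> fixlev 2 g \<Longrightarrow> \<phi> g =\<^sub>p 0"
    using invariant_exists[OF proportional] by blast
  define Y where "Y = (\<lambda>b. b \<circ> ?a) ` B \<union> (\<lambda>b. b \<circ> (b \<circ> ?a)) ` B"
  have Y: "y \<in> G \<and> rot y [] =\<^sub>p 1 \<and> \<not> \<phi> y =\<^sub>p 0" if "y \<in> Y" for y
  proof -
    have ba: "b \<circ> ?a \<in> G" "rot (b \<circ> ?a) [] =\<^sub>p 1" "\<phi> (b \<circ> ?a) =\<^sub>p \<phi> b" if b: "b \<in> B" for b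
    proof -
      show "b \<circ> ?a \<in> G" by (rule comp_in_G[OF aG bG[OF b]])
      show "rot (b \<circ> ?a) [] =\<^sub>p 1"
        using cong_trans[OF root_rot_mult[OF aG bG[OF b]] cong_add[OF a_root B_root[OF b]]] by simp
      show "\<phi> (b \<circ> ?a) =\<^sub>p \<phi> b"
        using cong_trans[OF hom[OF aG bG[OF b]] cong_add[OF phi_a cong_refl]] by simp
    qed
    have bba: "b \<circ> (b \<circ> ?a) \<in> G" "rot (b \<circ> (b \<circ> ?a)) [] =\<^sub>p 1" "\<phi> (b \<circ> (b \<circ> ?a)) =\<^sub>p 2 * \<phi> b" if b: "b \<in> B" for b
    proof -
      note y1 = ba[OF b]
      show "b \<circ> (b \<circ> ?a) \<in> G" by (rule comp_in_G[OF y1(1) bG[OF b]])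
      show "rot (b \<circ> (b \<circ> ?a)) [] =\<^sub>p 1"
        using cong_trans[OF root_rot_mult[OF y1(1) bG[OF b]] cong_add[OF y1(2) B_root[OF b]]] by simp
      show "\<phi> (b \<circ> (b \<circ> ?a)) =\<^sub>p 2 * \<phi> b"
        using cong_trans[OF hom[OF y1(1) bG[OF b]] cong_add[OF y1(3) cong_refl]] by simp
    qed
    consider b where "b \<in> B" "y = b \<circ> ?a" | b where "b \<in> B" "y = b \<circ> (b \<circ> ?a)"
      using \<open>y \<in> Y\<close> by (auto simp: Y_def)
    then show ?thesis
    proof cases
      case (1 b)
      then show ?thesis using ba[OF 1(1)] phi_b pcong_0_iff by blast
    next
      case (2 b)
      then show ?thesis using bba[OF 2(1)] phi_b pcong_0_iff pcong_mult_0[of 2 "\<phi> b"] pcong_2_not_0 by blast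
    qed
  qed
  have YG: "Y \<subseteq> G" using Y by blast
  have genY: "generate GG Y = G"
  proof -
    let ?H = "generate (tree_aut p) Y"
    have H: "subgroup ?H (tree_aut p)" using YG G_cyclic cyclic_aut_closed by (intro A.generate_is_subgroup) blast
    have BH: "b \<in> ?H \<and> ?a \<in> ?H" if b: "b \<in> B" for b
    proof
      have 1: "b \<circ> ?a \<in> ?H" "b \<circ> (b \<circ> ?a) \<in> ?H" using b by (auto simp: Y_def intro: generate.incl)
      then show 2: "b \<in> ?H"
        by (rule left_cancel_in_subgroup[OF H _ cyclic_aut_closed[OF G_cyclic[OF bG[OF b]]]])
      show "?a \<in> ?H"
        by (rule right_cancel_in_subgroup[OF H cyclic_aut_closed[OF rooted_a_cyclic] 2 1(1)])
    qed
    then show ?thesis using B_ne by (intro generate_eq_G YG) blast+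
  qed
  note stab = level_stab_fixes_level
  show ?thesis
  proof (rule N.ramification_structure_quotient[OF finite_quotient, of "insert ?a B" Y])
    show "insert ?a B \<subseteq> carrier GG - level_stab p G 2"
      using gens_in_G gen_not_deep by (auto simp: stab)
    show "Y \<subseteq> carrier GG - level_stab p G 2"
    proof
      fix y assume y: "y \<in> Y"
      have "\<not> rot y [] =\<^sub>p 0" using Y[OF y] pcong_0_iff one_not_0 by blast
      then have "\<not> fixlev 2 y" using Y[OF y] fixlev_2[OF G_cyclic] fixlev_1_iff[OF G_cyclic] by blast
      then show "y \<in> carrier GG - level_stab p G 2" using Y[OF y] by (simp add: stab)
    qed
    show "generate GG (insert ?a B) = carrier GG" by (rule generate_gens)
    show "generate GG Y = carrier GG" using genY by simp
    show "Y \<noteq> {}" using B_ne by (auto simp: Y_def)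
    fix x y g h and m n :: nat
    assume x: "x \<in> insert ?a B" and y: "y \<in> Y" and "g \<in> carrier GG" and "h \<in> level_stab p G 2"
      and eq: "inv\<^bsub>GG\<^esub> g \<otimes>\<^bsub>GG\<^esub> x [^]\<^bsub>GG\<^esub> m \<otimes>\<^bsub>GG\<^esub> g = h \<otimes>\<^bsub>GG\<^esub> y [^]\<^bsub>GG\<^esub> n"
    then have g: "g \<in> G" and h: "h \<in> G" "fixlev 2 h" by (simp_all add: stab)
    have xG: "x \<in> G" using x gens_in_G by auto
    have yG: "y \<in> G" using y YG by blast
    note xmG = funpow_in_G[OF xG, of m] and ynG = funpow_in_G[OF yG, of n]
    have "x [^]\<^bsub>GG\<^esub> m \<otimes>\<^bsub>GG\<^esub> g = g \<otimes>\<^bsub>GG\<^esub> (h \<otimes>\<^bsub>GG\<^esub> y [^]\<^bsub>GG\<^esub> n)"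
    proof -
      have c: "g \<in> carrier GG" "x [^]\<^bsub>GG\<^esub> m \<in> carrier GG" using g xmG by (simp_all add: GG_simps(3) del: nat_pow_def)
      show ?thesis unfolding eq[symmetric] using c
        by (simp only: GG.m_assoc[symmetric] GG.m_closed GG.inv_closed GG.r_inv GG.l_one)
    qed
    then have comm: "g \<circ> x ^^ m = (y ^^ n \<circ> h) \<circ> g" by (simp only: GG_simps)
    have ynhG: "y ^^ n \<circ> h \<in> G" by (rule comp_in_G[OF h(1) ynG])
    have conj: "int m * \<psi> x =\<^sub>p int n * \<psi> y"
      if hom: "\<And>g h. g \<in> G \<Longrightarrow> h \<in> G \<Longrightarrow> \<psi> (h \<circ> g) =\<^sub>p \<psi> g + \<psi> h" and h0: "\<psi> h =\<^sub>p 0"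
      for \<psi> :: "(nat list \<Rightarrow> nat list) \<Rightarrow> int"
    proof -
      have 1: "\<psi> (g \<circ> x ^^ m) =\<^sub>p int m * \<psi> x + \<psi> g"
        by (rule cong_trans[OF hom[OF xmG g] cong_add[OF hom_funpow[OF hom xG] cong_refl]])
      have 2: "\<psi> (y ^^ n \<circ> h) =\<^sub>p 0 + int n * \<psi> y"
        by (rule cong_trans[OF hom[OF h(1) ynG] cong_add[OF h0 hom_funpow[OF hom yG]]])
      have 3: "\<psi> (g \<circ> x ^^ m) =\<^sub>p \<psi> g + (0 + int n * \<psi> y)"
        unfolding comm by (rule cong_trans[OF hom[OF g ynhG] cong_add[OF cong_refl 2]])
      have "int m * \<psi> x + \<psi> g =\<^sub>p int n * \<psi> y + \<psi> g"
        using cong_trans[OF cong_sym[OF 1] 3] by (simp add: add.commute)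
      then show ?thesis by (simp only: cong_add_rcancel)
    qed
    have h_root: "rot h [] =\<^sub>p 0" and h_1: "\<And>z. z \<in> {1..p} \<Longrightarrow> rot h [z] =\<^sub>p 0"
      using h(2) fixlev_2[OF G_cyclic[OF h(1)]] fixlev_1_iff[OF G_cyclic[OF h(1)]] by blast+
    have roots: "int m * rot x [] =\<^sub>p int n * rot y []" by (rule conj[of "\<lambda>g. rot g []", OF root_rot_mult h_root])
    have phis: "int m * \<phi> x =\<^sub>p int n * \<phi> y" by (rule conj[OF hom phi_deep[OF G_cyclic[OF h(1)] h(2)]])
    have y_root: "\<not> rot y [] =\<^sub>p 0" using Y[OF y] pcong_0_iff one_not_0 by blast
    have "p dvd m"
    proof (cases "x = ?a")
      case True
      have "int m * \<phi> x =\<^sub>p 0" unfolding True using cong_mult[OF cong_refl phi_a, of "int m"] by simp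
      then have "int n * \<phi> y =\<^sub>p 0" using pcong_0_iff[OF phis] by blast
      then have "p dvd n" using rot_nat_mult_0[of "\<phi> y"] Y[OF y] by blast
      then have "int n * rot y [] =\<^sub>p 0" using rot_nat_mult_0[OF y_root] by blast
      then have "int m * rot ?a [] =\<^sub>p 0" using pcong_0_iff[OF roots] True by blast
      moreover have "\<not> rot ?a [] =\<^sub>p 0" using pcong_0_iff[OF a_root] one_not_0 by blast
      ultimately show ?thesis using rot_nat_mult_0 by blast
    next
      case False
      then have xB: "x \<in> B" using x by blast
      then obtain q where q: "directed q x" using B_directed by blast
      have xr: "rot x [] =\<^sub>p 0" by (rule B_root[OF xB])
      have "int m * rot x [] =\<^sub>p 0" using cong_mult[OF cong_refl xr, of "int m"] by simp
      then have "p dvd n" using pcong_0_iff[OF roots] rot_nat_mult_0[OF y_root] by blast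
      then obtain k where k: "n = p * k" by blast
      \<comment> \<open>A power of \<open>y\<close> in the stabiliser of level 1 has constant rotations on level 1.\<close>
      have y_rot: "rot (y ^^ n) [z] =\<^sub>p int k * sum_rot 1 y" if z: "z \<in> {1..p}" for z
      proof -
        have "fixlev 1 (y ^^ p)" using fixlev_1_funpow[OF G_cyclic[OF yG] y_root, of p] by simp
        then have "(y ^^ p) [z] = [z]" using z by (simp add: fixes_level_def level_1)
        then have "rot ((y ^^ p) ^^ k) [z] =\<^sub>p int k * rot (y ^^ p) [z]"
          using z by (intro rot_funpow_fixed funpow_cyclic_aut G_cyclic yG) (auto simp: tree_words_Cons)
        moreover have "int k * rot (y ^^ p) [z] =\<^sub>p int k * sum_rot 1 y"
          by (intro cong_mult cong_refl rot_power_p G_cyclic yG y_root z)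
        ultimately show ?thesis unfolding k funpow_mult[symmetric] by (rule cong_trans)
      qed
      have x_rot: "rot (x ^^ m) [z] =\<^sub>p int m * rot x [z]" if z: "z \<in> {1..p}" for z
      proof -
        have "x [z] = [z]" using action_level_1[OF G_cyclic[OF xG] z] letter_fixed[OF z] xr by simp
        then show ?thesis using z by (intro rot_funpow_fixed G_cyclic xG) (auto simp: tree_words_Cons)
      qed
      have xm_root: "rot (x ^^ m) [] =\<^sub>p 0"
        using cong_trans[OF hom_funpow[of "\<lambda>g. rot g []", OF root_rot_mult xG] cong_mult[OF cong_refl xr]] by simp
      have same: "int m * rot x [z] =\<^sub>p int k * sum_rot 1 y" if z: "z \<in> {1..p}" for z
      proof -
        obtain v where v: "v \<in> {1..p}" "g [z] = [v]"
          using action_level_1[OF G_cyclic[OF g] z] letter_range by blast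
        have "rot (g \<circ> x ^^ m) [z] =\<^sub>p rot (x ^^ m) [z] + rot g [z]"
          by (rule rot_level_1_mult[OF G_cyclic[OF xmG] G_cyclic[OF g] xm_root z])
        moreover have "rot (g \<circ> x ^^ m) [z] =\<^sub>p rot g [z] + rot (y ^^ n \<circ> h) [v]"
          unfolding comm using rot_mult[OF G_cyclic[OF g] G_cyclic[OF ynhG], of "[z]"] z v(2)
          by (simp add: tree_words_Cons)
        moreover have "rot (y ^^ n \<circ> h) [v] =\<^sub>p 0 + int k * sum_rot 1 y"
          by (rule cong_trans[OF rot_level_1_mult[OF G_cyclic[OF h(1)] G_cyclic[OF ynG] h_root v(1)]
            cong_add[OF h_1[OF v(1)] y_rot[OF v(1)]]])
        ultimately have "rot (x ^^ m) [z] =\<^sub>p int k * sum_rot 1 y"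
          using pcong_solve[of "rot (g \<circ> x ^^ m) [z]" "rot g [z]" "rot (x ^^ m) [z]" "rot g [z]" "rot (y ^^ n \<circ> h) [v]" "rot g [z]" 0]
          by (simp add: add.commute) (rule cong_trans)
        then show ?thesis by (rule cong_trans[OF cong_sym[OF x_rot[OF z]]])
      qed
      have "int m * rot x [q] =\<^sub>p 0"
        using q cong_mult[OF cong_refl, of "rot x [q]" 0 "int p" "int m"] by (simp add: directed_def)
      moreover have "q \<in> {1..p}" using q by (simp add: directed_def)
      ultimately have "int k * sum_rot 1 y =\<^sub>p 0" using pcong_0_iff[OF same] by blast
      moreover obtain z where z: "z \<in> {1..p}" "\<not> rot x [z] =\<^sub>p 0" using q by (auto simp: directed_def)
      ultimately have "int m * rot x [z] =\<^sub>p 0" using pcong_0_iff[OF same[OF z(1)]] by blast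
      then show ?thesis using rot_nat_mult_0[OF z(2)] by blast
    qed
    then obtain k where "m = p * k" by blast
    then have "x ^^ m = (x ^^ p) ^^ k" by (simp only: funpow_mult)
    then have "x ^^ m = id" using gen_order_p[OF x] by (simp add: id_funpow)
    then show "x [^]\<^bsub>GG\<^esub> m \<in> level_stab p G 2"
      unfolding GG_simps using id_in_G by (simp add: stab fixes_level_def)
  qed simp
qed

end

section \<open>Defining vectors spanning a line\<close>

lemma (in vectorspace) carrier_of_dim_0:
  assumes fd: "fin_dim" and d: "dim = 0"
  shows "carrier V = {\<zero>\<^bsub>V\<^esub>}"
proof -
  have "\<exists>A. finite A \<and> card A = dim \<and> A \<subseteq> carrier V \<and> gen_set A"
    unfolding dim_def by (rule LeastI_ex) (use fd in \<open>auto simp: fin_dim_def\<close>)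
  then have "gen_set {}" using d by auto
  then show ?thesis by (simp add: span_empty)
qed

lemma (in vectorspace) carrier_of_dim_1:
  assumes fd: "fin_dim" and d: "dim = 1"
  shows "\<exists>a\<in>carrier V. \<forall>v\<in>carrier V. \<exists>c\<in>carrier K. v = c \<odot>\<^bsub>V\<^esub> a"
proof -
  have "\<exists>A. finite A \<and> card A = dim \<and> A \<subseteq> carrier V \<and> gen_set A"
    unfolding dim_def by (rule LeastI_ex) (use fd in \<open>auto simp: fin_dim_def\<close>)
  then obtain a where a: "a \<in> carrier V" "gen_set {a}" using d by (auto simp: card_1_singleton_iff)
  show ?thesis
  proof (intro bexI[OF _ a(1)] ballI)
    fix v assume "v \<in> carrier V"
    then have "v \<in> span {a}" using a(2) by simp
    then obtain c A where v: "v = lincomb c A" "A \<subseteq> {a}" "c \<in> A \<rightarrow> carrier K"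
      unfolding span_def by blast
    consider "A = {}" | "A = {a}" using v(2) by blast
    then show "\<exists>c\<in>carrier K. v = c \<odot>\<^bsub>V\<^esub> a"
    proof cases
      case 1
      then have "v = \<zero>\<^bsub>K\<^esub> \<odot>\<^bsub>V\<^esub> a" using v(1) a(1) by (simp add: lincomb_def)
      then show ?thesis by blast
    next
      case 2
      then have "c a \<in> carrier K" "v = c a \<odot>\<^bsub>V\<^esub> a"
        using v a(1) by (auto simp: lincomb_def)
      then show ?thesis by blast
    qed
  qed
qed

lemma (in vectorspace) fin_dim_span_vs:
  assumes "finite S" "S \<subseteq> carrier V"
  shows "vectorspace K (span_vs S)" "vectorspace.fin_dim K (span_vs S)"
proof -
  show vs: "vectorspace K (span_vs S)"
    by (rule subspace_is_vs[OF span_is_subspace[OF assms(2)]])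
  have "S \<subseteq> span S" by (rule in_own_span[OF assms(2)])
  moreover have "LinearCombinations.module.span K (span_vs S) S = span S"
    using span_li_not_depend(1)[OF in_own_span[OF assms(2)]] span_is_submodule[OF assms(2)] by simp
  ultimately show "vectorspace.fin_dim K (span_vs S)"
    unfolding vectorspace.fin_dim_def[OF vs] using assms(1) by auto
qed

context odd_prime_tree
begin

lemma Fp_space_smult:
  assumes "k \<in> {1..p-1}"
  shows "(c \<odot>\<^bsub>Fp_space p\<^esub> v) k =\<^sub>p c * v k"
proof -
  interpret R: residues "int p" "Fp p" using p_gt2 by unfold_locales auto
  show ?thesis using assms unfolding Fp_space_def R.func_space_def by (simp add: residue_ring_def cong_def)
qed

lemma Fp_space_smult_zero:
  assumes "c =\<^sub>p 0"
  shows "c \<odot>\<^bsub>Fp_space p\<^esub> v = \<zero>\<^bsub>Fp_space p\<^esub>"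
proof -
  interpret R: residues "int p" "Fp p" using p_gt2 by unfold_locales auto
  show ?thesis using assms unfolding Fp_space_zero unfolding Fp_space_def R.func_space_def
    by (auto simp: residue_ring_def cong_0_iff fun_eq_iff)
qed

lemma span_dim_pos:
  assumes "finite S" "S \<subseteq> carrier (Fp_space p)" "e \<in> S" "e \<noteq> \<zero>\<^bsub>Fp_space p\<^esub>"
  shows "span_dim p S \<ge> 1"
proof (rule ccontr)
  interpret V: vectorspace "Fp p" "Fp_space p" by (rule vectorspace_Fp_space[OF prime_p])
  assume "\<not> span_dim p S \<ge> 1"
  then have "V.span S = {\<zero>\<^bsub>Fp_space p\<^esub>}"
    using vectorspace.carrier_of_dim_0[OF V.fin_dim_span_vs[OF assms(1,2)]] by (simp add: span_dim_def)
  then show False using V.in_own_span[OF assms(2)] assms(3,4) by blast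
qed

lemma proportional_if_span_dim_1:
  assumes S: "finite S" "S \<subseteq> carrier (Fp_space p)" "span_dim p S = 1"
    and e: "e \<in> S" "e \<noteq> \<zero>\<^bsub>Fp_space p\<^esub>" and e': "e' \<in> S" "e' \<noteq> \<zero>\<^bsub>Fp_space p\<^esub>"
  shows "\<exists>c. \<not> c =\<^sub>p 0 \<and> (\<forall>z. vec_entry e' z =\<^sub>p c * vec_entry e z)"
proof -
  interpret V: vectorspace "Fp p" "Fp_space p" by (rule vectorspace_Fp_space[OF prime_p])
  have "\<exists>v. \<forall>u\<in>V.span S. \<exists>c. u = c \<odot>\<^bsub>Fp_space p\<^esub> v"
    using vectorspace.carrier_of_dim_1[OF V.fin_dim_span_vs[OF S(1,2)]] S(3)
    by (simp add: span_dim_def) blast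
  then obtain v where "\<forall>u\<in>V.span S. \<exists>c. u = c \<odot>\<^bsub>Fp_space p\<^esub> v" ..
  then obtain c c' where c: "e = c \<odot>\<^bsub>Fp_space p\<^esub> v" "e' = c' \<odot>\<^bsub>Fp_space p\<^esub> v"
    using V.in_own_span[OF S(2)] e(1) e'(1) by blast
  have ne: "\<not> c =\<^sub>p 0" "\<not> c' =\<^sub>p 0" using Fp_space_smult_zero c e(2) e'(2) by blast+
  obtain n where n: "int n * c =\<^sub>p c'" using pcong_inverse[OF ne(1)] by blast
  show ?thesis
  proof (intro exI conjI allI)
    show "\<not> int n =\<^sub>p 0" using pcong_0_iff[OF n] pcong_mult_0 ne(2) by blast
    fix z
    show "vec_entry e' z =\<^sub>p int n * vec_entry e z"
    proof (cases "z =\<^sub>p 0")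
      case True
      then show ?thesis by (simp add: vec_entry_def)
    next
      case False
      let ?k = "nat (z mod int p)"
      have "z mod int p \<noteq> 0" "0 \<le> z mod int p" "z mod int p < int p" using False p_pos by (auto simp: cong_def)
      then have k: "?k \<in> {1..p-1}" by auto
      have "e' ?k =\<^sub>p c' * v ?k" unfolding c(2) by (rule Fp_space_smult[OF k])
      also have "c' * v ?k =\<^sub>p int n * c * v ?k" by (rule cong_scalar_right[OF cong_sym[OF n]])
      also have "int n * c * v ?k = int n * (c * v ?k)" by simp
      also have "int n * (c * v ?k) =\<^sub>p int n * e ?k"
        unfolding c(1) by (rule cong_scalar_left[OF cong_sym[OF Fp_space_smult[OF k]]])
      finally show ?thesis using False by (simp add: vec_entry_def)
    qed
  qed
qed

end

section \<open>Multi-EGS groups\<close>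

theorem theorem1p1:
  fixes p r :: nat
    and E :: "nat \<Rightarrow> (nat \<Rightarrow> int) list"
    and G :: "(nat list \<Rightarrow> nat list) set"
  assumes "prime p" and "odd p"
    and "multi_EGS_data p E"
    and "G = multi_EGS p E"
    and "\<not> GGS_group p G"
    and "r = span_dim p (defining_vectors p E)"
  shows "(regular_branch_over p G (derived (tree_aut p) G) \<longrightarrow>
           (\<forall>k\<ge>r+1. \<exists>T1 T2. ramification_structure
              ((tree_aut p)\<lparr>carrier := G\<rparr> Mod level_stab p G k) T1 T2))
       \<and> (periodic_group ((tree_aut p)\<lparr>carrier := G\<rparr>) \<and>
          \<not> regular_branch_over p G (derived (tree_aut p) G) \<longrightarrow>
           (\<forall>k\<ge>5. \<exists>T1 T2. ramification_structure
              ((tree_aut p)\<lparr>carrier := G\<rparr> Mod level_stab p G k) T1 T2))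
       \<and> (\<not> periodic_group ((tree_aut p)\<lparr>carrier := G\<rparr>) \<and>
          \<not> regular_branch_over p G (derived (tree_aut p) G) \<longrightarrow>
           (\<forall>k\<ge>3. \<exists>T1 T2. ramification_structure
              ((tree_aut p)\<lparr>carrier := G\<rparr> Mod level_stab p G k) T1 T2))"
proof -
  interpret T: odd_prime_tree p using assms(1,2) by unfold_locales
  interpret V: vectorspace "Fp p" "Fp_space p" by (rule vectorspace_Fp_space[OF assms(1)])
  let ?S = "defining_vectors p E"
  have E: "e \<in> carrier (Fp_space p)" "e \<noteq> \<zero>\<^bsub>Fp_space p\<^esub>" if "j \<in> {1..p}" "e \<in> set (E j)" for j e
    using assms(3) that V.vs_zero_lin_dep[of "set (E j)"] by (auto simp: multi_EGS_data_def)
  have S: "finite ?S" "?S \<subseteq> carrier (Fp_space p)" using E by (auto simp: defining_vectors_def)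
  define B where "B = {directed_b p j e | j e. j \<in> {1..p} \<and> e \<in> set (E j)}"
  have "\<exists>j\<in>{1..p}. \<exists>e. e \<in> set (E j)"
    using assms(3) unfolding multi_EGS_data_def length_0_conv ex_in_conv set_empty by blast
  then obtain j0 e0 where je0: "j0 \<in> {1..p}" "e0 \<in> set (E j0)" by blast
  interpret D: directed_group p B
  proof unfold_locales
    show "B \<noteq> {}" using je0 by (auto simp: B_def)
    fix b assume "b \<in> B"
    then obtain j e where je: "j \<in> {1..p}" "e \<in> set (E j)" "b = directed_b p j e" by (auto simp: B_def)
    have "T.directed (p - j + 1) b"
      unfolding je(3) by (rule T.directed_directed_b[OF je(1) E[OF je(1,2)]])
    then show "\<exists>q. T.directed q b" by blast
  qed
  have G: "G = D.G" unfolding D.G_def unfolding assms(4) multi_EGS_def B_def by simp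
  have r: "r \<ge> 1"
    unfolding assms(6) by (rule T.span_dim_pos[OF S _ E(2)[OF je0]]) (use je0 in \<open>auto simp: defining_vectors_def\<close>)
  have ge3: "\<exists>T1 T2. ramification_structure ((tree_aut p)\<lparr>carrier := G\<rparr> Mod level_stab p G k) T1 T2" if "k \<ge> 3" for k
    unfolding G by (rule D.ramification_structure_level_ge_3[OF that])
  have eq2: "\<exists>T1 T2. ramification_structure ((tree_aut p)\<lparr>carrier := G\<rparr> Mod level_stab p G 2) T1 T2" if "r = 1"
    unfolding G
  proof (rule D.ramification_structure_level_2)
    fix b b' assume "b \<in> B" "b' \<in> B"
    then obtain j e j' e' where je: "j \<in> {1..p}" "e \<in> set (E j)" "b = directed_b p j e"
      and je': "j' \<in> {1..p}" "e' \<in> set (E j')" "b' = directed_b p j' e'" by (auto simp: B_def)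
    have eS: "e \<in> ?S" "e' \<in> ?S" using je je' by (auto simp: defining_vectors_def)
    have d: "span_dim p ?S = 1" using that assms(6) by simp
    obtain c where c: "\<not> [c = 0] (mod int p)" "\<And>z. [T.vec_entry e' z = c * T.vec_entry e z] (mod int p)"
      using T.proportional_if_span_dim_1[OF S d eS(1) E(2)[OF je(1,2)] eS(2) E(2)[OF je'(1,2)]] by blast
    define t where "t = int (p - j + 1) - int (p - j' + 1)"
    have "[rot b' [x] = c * rot b [letter p (int x + t)]] (mod int p)" if x: "x \<in> {1..p}" for x
    proof -
      have "[rot b' [x] = T.vec_entry e' (int x - int (p - j' + 1))] (mod int p)"
        unfolding je'(3) by (rule T.directed_b_rot[OF je'(1) E(1)[OF je'(1,2)] x])
      also have "[T.vec_entry e' (int x - int (p - j' + 1)) = c * T.vec_entry e (int x - int (p - j' + 1))] (mod int p)"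
        by (rule c(2))
      also have "T.vec_entry e (int x - int (p - j' + 1)) = T.vec_entry e (int (letter p (int x + t)) - int (p - j + 1))"
      proof (rule T.vec_entry_cong)
        have "[int (letter p (int x + t)) - int (p - j + 1) = int x + t - int (p - j + 1)] (mod int p)"
          by (intro cong_diff T.letter_pcong cong_refl)
        moreover have "int x + t - int (p - j + 1) = int x - int (p - j' + 1)" by (simp add: t_def)
        ultimately show "[int x - int (p - j' + 1) = int (letter p (int x + t)) - int (p - j + 1)] (mod int p)"
          by (simp only: cong_sym)
      qed
      also have "[c * T.vec_entry e (int (letter p (int x + t)) - int (p - j + 1)) = c * rot b [letter p (int x + t)]] (mod int p)"
        unfolding je(3)
        by (rule cong_scalar_left[OF cong_sym[OF T.directed_b_rot[OF je(1) E(1)[OF je(1,2)] T.letter_range]]])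
      finally show ?thesis .
    qed
    then show "\<exists>c t. \<not> [c = 0] (mod int p) \<and>
      (\<forall>x\<in>{1..p}. [rot b' [x] = c * rot b [letter p (int x + t)]] (mod int p))" using c(1) by blast
  qed
  \<comment> \<open>Since \<open>r \<ge> 1\<close>, such a level is at least 3 or is level 2 with \<open>r = 1\<close>.\<close>
  have "\<exists>T1 T2. ramification_structure ((tree_aut p)\<lparr>carrier := G\<rparr> Mod level_stab p G k) T1 T2" if "k \<ge> r + 1" for k
  proof (cases "k \<ge> 3")
    case True
    then show ?thesis by (rule ge3)
  next
    case False
    then have "k = 2" "r = 1" using r that by auto
    then show ?thesis using eq2 by simp
  qed
  then show ?thesis using ge3 by simp
qed

end
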